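(* Let $R$ be a standard graded polynomial ring in $n\ge 2$ variables over a field $k$, with maximal graded ideal $\mathfrak m$. Let $M$ be a non-zero finitely generated graded $R$-module of dimension $d$ with $\operatorname{reg}(M)=\operatorname{indeg}(M)=:r$ and $H^0_{\mathfrak m}(M)=0$. Let $P_M$ be the Hilbert polynomial of $M$. Then, for every $i\ge 0$, $$\dim_k\operatorname{Tor}_i^R(M,k)=\sum_{\ell=0}^{\min\{i,d-1\}}(-1)^\ell\binom{n-\ell-1}{i-\ell}\Delta^\ell P_M(r+\ell).$$
   Context: $\operatorname{indeg}(M)=\min\{t: M_t\neq 0\}$; $\operatorname{reg}(M)=\max\{i+t : H^i_{\mathfrak m}(M)_t\neq 0\}$ is the Castelnuovo-Mumford regularity. For a polynomial $P$, $\Delta^0P=P$, $\Delta P(t):=P(t)-P(t-1)$ and $\Delta^iP:=\Delta(\Delta^{i-1}P)$. Binomial coefficients $\binom{a}{b}$ are $0$ if $a<b$. *)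

theory Defs
  imports
    "HOL-Library.Poly_Mapping"
    "HOL-Library.FuncSet"
    "HOL-Library.Cardinality"
    "HOL-Library.Extended_Real"
    "HOL-Computational_Algebra.Polynomial"
begin

section \<open>The polynomial ring\<close>

text \<open>The ring \<open>R = k[x\<^sub>i | i \<in> 'n]\<close> in \<open>CARD('n)\<close> variables. The linear order
  on the variables only serves to fix the signs in the Cech complex.\<close>

type_synonym ('n, 'k) mpoly = "('n \<Rightarrow>\<^sub>0 nat) \<Rightarrow>\<^sub>0 'k"

definition const :: "'k \<Rightarrow> ('n::finite, 'k::field) mpoly" where
  "const c = Poly_Mapping.single 0 c"

definition var :: "'n \<Rightarrow> ('n::finite, 'k::field) mpoly" where
  "var i = Poly_Mapping.single (Poly_Mapping.single i 1) 1"

definition homogeneous :: "nat \<Rightarrow> ('n::finite, 'k::field) mpoly \<Rightarrow> bool" where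
  "homogeneous e f \<longleftrightarrow>
    (\<forall>\<alpha>\<in>Poly_Mapping.keys f. (\<Sum>i\<in>UNIV. Poly_Mapping.lookup \<alpha> i) = e)"

section \<open>Finitely generated graded modules\<close>

text \<open>A module has carrier type \<open>'m\<close> and scalar multiplication \<open>sm\<close>; \<open>G t\<close> is its
  homogeneous component of degree \<open>t\<close>. The last clause states that the module is the
  (internal) direct sum of the \<open>G t\<close>.\<close>

definition graded_module ::
  "(('n::finite, 'k::field) mpoly \<Rightarrow> 'm::ab_group_add \<Rightarrow> 'm) \<Rightarrow> (int \<Rightarrow> 'm set) \<Rightarrow> bool" where
  "graded_module sm G \<longleftrightarrow> module sm
    \<and> (\<forall>t. 0 \<in> G t \<and> (\<forall>x\<in>G t. \<forall>y\<in>G t. x - y \<in> G t))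
    \<and> (\<forall>e t f. homogeneous e f \<longrightarrow> (\<forall>x\<in>G t. sm f x \<in> G (t + int e)))
    \<and> (\<forall>x. \<exists>!c :: int \<Rightarrow>\<^sub>0 'm. (\<forall>t. Poly_Mapping.lookup c t \<in> G t)
          \<and> x = (\<Sum>t\<in>Poly_Mapping.keys c. Poly_Mapping.lookup c t))"

definition finitely_generated :: "('r::comm_ring_1 \<Rightarrow> 'm::ab_group_add \<Rightarrow> 'm) \<Rightarrow> bool" where
  "finitely_generated sm \<longleftrightarrow> (\<exists>B. finite B \<and> module.span sm B = UNIV)"

text \<open>The value is \<open>\<infinity>\<close> for the zero module and an integer for every other
  finitely generated graded module.\<close>

definition indeg :: "(int \<Rightarrow> 'm::ab_group_add set) \<Rightarrow> ereal" where
  "indeg G = (INF t\<in>{t. G t \<noteq> {0}}. ereal (real_of_int t))"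

definition annihilator :: "('r::comm_ring_1 \<Rightarrow> 'm::ab_group_add \<Rightarrow> 'm) \<Rightarrow> 'r set" where
  "annihilator sm = {f. \<forall>x. sm f x = 0}"

definition prime_ideal :: "'r::comm_ring_1 set \<Rightarrow> bool" where
  "prime_ideal I \<longleftrightarrow> module.subspace (*) I \<and> I \<noteq> UNIV
    \<and> (\<forall>a b. a * b \<in> I \<longrightarrow> a \<in> I \<or> b \<in> I)"

text \<open>The Krull dimension of \<open>R / Ann M\<close>, for \<open>M \<noteq> 0\<close>.\<close>

definition krull_dim :: "('r::comm_ring_1 \<Rightarrow> 'm::ab_group_add \<Rightarrow> 'm) \<Rightarrow> enat" where
  "krull_dim sm = (SUP l\<in>{l. \<exists>P. (\<forall>j\<le>l. prime_ideal (P j) \<and> annihilator sm \<subseteq> P j)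
                             \<and> (\<forall>j<l. P j \<subset> P (Suc j))}. enat l)"

section \<open>Hilbert polynomial\<close>

definition kscale :: "(('n::finite, 'k::field) mpoly \<Rightarrow> 'm \<Rightarrow> 'm) \<Rightarrow> 'k \<Rightarrow> 'm \<Rightarrow> 'm" where
  "kscale sm c = sm (const c)"

definition hilbert_function ::
  "(('n::finite, 'k::field) mpoly \<Rightarrow> 'm::ab_group_add \<Rightarrow> 'm) \<Rightarrow> (int \<Rightarrow> 'm set) \<Rightarrow> int \<Rightarrow> nat" where
  "hilbert_function sm G t = vector_space.dim (kscale sm) (G t)"

definition hilbert_poly ::
  "(('n::finite, 'k::field) mpoly \<Rightarrow> 'm::ab_group_add \<Rightarrow> 'm) \<Rightarrow> (int \<Rightarrow> 'm set) \<Rightarrow> rat poly" where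
  "hilbert_poly sm G =
    (THE P. \<forall>\<^sub>F t in at_top. poly P (of_int t) = of_nat (hilbert_function sm G t))"

definition backward_diff :: "'a::comm_ring_1 poly \<Rightarrow> 'a poly" where
  "backward_diff P = P - pcompose P [:-1, 1:]"

section \<open>Local cohomology and regularity\<close>

text \<open>The element \<open>m / f\<^sup>a\<close> of the localization \<open>M\<^sub>f\<close>, as the equivalence class
  of the pair \<open>(m, a)\<close>.\<close>

definition fraction :: "('r::comm_ring_1 \<Rightarrow> 'm::ab_group_add \<Rightarrow> 'm) \<Rightarrow> 'r \<Rightarrow> 'm \<Rightarrow> nat \<Rightarrow> ('m \<times> nat) set" where
  "fraction sm f m a = {(m', b). \<exists>c. sm (f ^ c) (sm (f ^ b) m) = sm (f ^ c) (sm (f ^ a) m')}"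

definition var_prod :: "'n set \<Rightarrow> ('n::finite, 'k::field) mpoly" where
  "var_prod S = (\<Prod>i\<in>S. var i)"

text \<open>\<open>H\<^sup>p\<^sub>\<mm>(M)\<close> is the cohomology of the Cech complex
  \<open>C\<^sup>p = \<Oplus>\<^bsub>|S| = p\<^esub> M\<^bsub>x_S\<^esub>\<close> on the variables, where \<open>x_S\<close> is the product of the variables
  in \<open>S\<close>. All maps are homogeneous of degree 0, so \<open>H\<^sup>p\<^sub>\<mm>(M)\<^sub>t\<close> is computed by the
  degree \<open>t\<close> strand; \<open>m / x_S\<^sup>a\<close> has degree \<open>deg m - a |S|\<close>.\<close>

definition cech_cochains ::
  "(('n::{finite,linorder}, 'k::field) mpoly \<Rightarrow> 'm::ab_group_add \<Rightarrow> 'm) \<Rightarrow> (int \<Rightarrow> 'm set)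
    \<Rightarrow> nat \<Rightarrow> int \<Rightarrow> ('n set \<Rightarrow> ('m \<times> nat) set) set" where
  "cech_cochains sm G p t =
    (\<Pi>\<^sub>E S\<in>{S. card S = p}. {fraction sm (var_prod S) m a | m a. m \<in> G (t + int a * int p)})"

definition cech_zero ::
  "(('n::{finite,linorder}, 'k::field) mpoly \<Rightarrow> 'm::ab_group_add \<Rightarrow> 'm)
    \<Rightarrow> nat \<Rightarrow> 'n set \<Rightarrow> ('m \<times> nat) set" where
  "cech_zero sm p = (\<lambda>S\<in>{S. card S = p}. fraction sm (var_prod S) 0 0)"

text \<open>The component at \<open>T\<close> is \<open>\<Sum>\<^bsub>i\<in>T\<^esub> \<plusminus> c (T - {i})\<close> in \<open>M\<^bsub>x_T\<^esub>\<close>. The summands are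
  written over a common exponent \<open>a\<close>, and \<open>m / x_S\<^sup>a\<close> with \<open>S = T - {i}\<close> is mapped to
  \<open>x\<^sub>i\<^sup>a m / x_T\<^sup>a\<close> by the localization map.\<close>

definition cech_diff ::
  "(('n::{finite,linorder}, 'k::field) mpoly \<Rightarrow> 'm::ab_group_add \<Rightarrow> 'm)
    \<Rightarrow> nat \<Rightarrow> ('n set \<Rightarrow> ('m \<times> nat) set) \<Rightarrow> 'n set \<Rightarrow> ('m \<times> nat) set" where
  "cech_diff sm p c = (\<lambda>T\<in>{T. card T = Suc p}.
     THE z. \<exists>m a. (\<forall>i\<in>T. c (T - {i}) = fraction sm (var_prod (T - {i})) (m i) a)
       \<and> z = fraction sm (var_prod T) (\<Sum>i\<in>T. sm ((-1) ^ card {j\<in>T. j < i} * var i ^ a) (m i)) a)"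

definition cech_cocycles ::
  "(('n::{finite,linorder}, 'k::field) mpoly \<Rightarrow> 'm::ab_group_add \<Rightarrow> 'm) \<Rightarrow> (int \<Rightarrow> 'm set)
    \<Rightarrow> nat \<Rightarrow> int \<Rightarrow> ('n set \<Rightarrow> ('m \<times> nat) set) set" where
  "cech_cocycles sm G p t = {c \<in> cech_cochains sm G p t. cech_diff sm p c = cech_zero sm (Suc p)}"

fun cech_coboundaries ::
  "(('n::{finite,linorder}, 'k::field) mpoly \<Rightarrow> 'm::ab_group_add \<Rightarrow> 'm) \<Rightarrow> (int \<Rightarrow> 'm set)
    \<Rightarrow> nat \<Rightarrow> int \<Rightarrow> ('n set \<Rightarrow> ('m \<times> nat) set) set" where
  "cech_coboundaries sm G 0 t = {cech_zero sm 0}"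
| "cech_coboundaries sm G (Suc p) t = cech_diff sm p ` cech_cochains sm G p t"

text \<open>\<open>H\<^sup>p\<^sub>\<mm>(M)\<^sub>t = 0\<close>.\<close>

definition local_cohomology_vanishes ::
  "(('n::{finite,linorder}, 'k::field) mpoly \<Rightarrow> 'm::ab_group_add \<Rightarrow> 'm) \<Rightarrow> (int \<Rightarrow> 'm set)
    \<Rightarrow> nat \<Rightarrow> int \<Rightarrow> bool" where
  "local_cohomology_vanishes sm G p t \<longleftrightarrow> cech_cocycles sm G p t = cech_coboundaries sm G p t"

text \<open>A finite supremum of a set of integers is attained, so this is the maximum
  whenever the maximum exists (which it does for finitely generated \<open>M \<noteq> 0\<close>).\<close>

definition regularity ::
  "(('n::{finite,linorder}, 'k::field) mpoly \<Rightarrow> 'm::ab_group_add \<Rightarrow> 'm) \<Rightarrow> (int \<Rightarrow> 'm set) \<Rightarrow> ereal" where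
  "regularity sm G =
    (SUP (p, t)\<in>{(p, t). \<not> local_cohomology_vanishes sm G p t}. ereal (real_of_int (int p + t)))"

section \<open>Tor\<close>

definition free_scale :: "'r::comm_ring_1 \<Rightarrow> ('b \<Rightarrow>\<^sub>0 'r) \<Rightarrow> ('b \<Rightarrow>\<^sub>0 'r)" where
  "free_scale a v = Poly_Mapping.map ((*) a) v"

text \<open>A free resolution \<open>\<dots> \<rightarrow> F\<^sub>1 \<rightarrow> F\<^sub>0 \<rightarrow> M \<rightarrow> 0\<close> with maps \<open>d i : F\<^bsub>i+1\<^esub> \<rightarrow> F\<^sub>i\<close>
  and augmentation \<open>\<epsilon>\<close>. All \<open>F\<^sub>i\<close> are taken to be \<open>R\<^sup>(\<^sup>\<nat>\<^sup>)\<close>: every countably generated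
  module over a polynomial ring over a field has such a resolution (a submodule of \<open>R\<^sup>(\<^sup>\<nat>\<^sup>)\<close> has
  countable dimension over the field), and Tor does not depend on the resolution.\<close>

definition free_resolution ::
  "('r::comm_ring_1 \<Rightarrow> 'm::ab_group_add \<Rightarrow> 'm)
    \<Rightarrow> (nat \<Rightarrow> (nat \<Rightarrow>\<^sub>0 'r) \<Rightarrow> (nat \<Rightarrow>\<^sub>0 'r)) \<Rightarrow> ((nat \<Rightarrow>\<^sub>0 'r) \<Rightarrow> 'm) \<Rightarrow> bool" where
  "free_resolution sm d \<epsilon> \<longleftrightarrow>
     (\<forall>i. module_hom free_scale free_scale (d i)) \<and> module_hom free_scale sm \<epsilon>
   \<and> surj \<epsilon> \<and> range (d 0) = {v. \<epsilon> v = 0} \<and> (\<forall>i. range (d (Suc i)) = {v. d i v = 0})"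

text \<open>\<open>A \<otimes> B\<close> is the free module on \<open>A \<times> B\<close> modulo the submodule \<open>tensor_relations\<close>;
  \<open>tensor_map f\<close> is the map of free modules inducing \<open>f \<otimes> id\<close>.\<close>

definition tensor_relations ::
  "('r::comm_ring_1 \<Rightarrow> 'a::ab_group_add \<Rightarrow> 'a) \<Rightarrow> ('r \<Rightarrow> 'b::ab_group_add \<Rightarrow> 'b)
    \<Rightarrow> ('a \<times> 'b \<Rightarrow>\<^sub>0 'r) set" where
  "tensor_relations sa sb = (let e = (\<lambda>x y. Poly_Mapping.single (x, y) (1::'r)) in
     module.span free_scale
      ({e (x + x') y - e x y - e x' y | x x' y. True}
     \<union> {e x (y + y') - e x y - e x y' | x y y'. True}
     \<union> {e (sa a x) y - free_scale a (e x y) | a x y. True}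
     \<union> {e x (sb a y) - free_scale a (e x y) | a x y. True}))"

definition tensor_map :: "('a \<Rightarrow> 'c) \<Rightarrow> ('a \<times> 'b \<Rightarrow>\<^sub>0 'r::comm_ring_1) \<Rightarrow> ('c \<times> 'b \<Rightarrow>\<^sub>0 'r)" where
  "tensor_map f z =
    (\<Sum>(x, y)\<in>Poly_Mapping.keys z. Poly_Mapping.single (f x, y) (Poly_Mapping.lookup z (x, y)))"

text \<open>Preimages, in the free module on \<open>F\<^sub>i \<times> N\<close>, of the cycles and the boundaries of
  \<open>F \<otimes> N\<close> in homological degree \<open>i\<close>.\<close>

fun tor_cycles ::
  "(nat \<Rightarrow> (nat \<Rightarrow>\<^sub>0 'r::comm_ring_1) \<Rightarrow> (nat \<Rightarrow>\<^sub>0 'r)) \<Rightarrow> ('r \<Rightarrow> 'b::ab_group_add \<Rightarrow> 'b)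
    \<Rightarrow> nat \<Rightarrow> ((nat \<Rightarrow>\<^sub>0 'r) \<times> 'b \<Rightarrow>\<^sub>0 'r) set" where
  "tor_cycles d sn 0 = UNIV"
| "tor_cycles d sn (Suc i) = {z. tensor_map (d i) z \<in> tensor_relations free_scale sn}"

definition tor_boundaries ::
  "(nat \<Rightarrow> (nat \<Rightarrow>\<^sub>0 'r::comm_ring_1) \<Rightarrow> (nat \<Rightarrow>\<^sub>0 'r)) \<Rightarrow> ('r \<Rightarrow> 'b::ab_group_add \<Rightarrow> 'b)
    \<Rightarrow> nat \<Rightarrow> ((nat \<Rightarrow>\<^sub>0 'r) \<times> 'b \<Rightarrow>\<^sub>0 'r) set" where
  "tor_boundaries d sn i =
    {tensor_map (d i) w + z | w z. z \<in> tensor_relations free_scale sn}"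

text \<open>The dimension of the quotient space \<open>Z / W\<close>, if finite: \<open>B\<close> ranges over the finite sets
  of representatives of the elements of a basis of \<open>Z / W\<close>.\<close>

definition quotient_dim :: "('k::field \<Rightarrow> 'v::ab_group_add \<Rightarrow> 'v) \<Rightarrow> 'v set \<Rightarrow> 'v set \<Rightarrow> nat" where
  "quotient_dim s Z W = (THE n. \<exists>B. finite B \<and> card B = n \<and> B \<subseteq> Z
     \<and> \<not> module.dependent s B \<and> module.span s B \<inter> W = {0} \<and> module.span s (B \<union> W) = Z)"

text \<open>The action of \<open>R\<close> on \<open>k = R / \<mm>\<close>.\<close>

definition residue_scale :: "('n::finite, 'k::field) mpoly \<Rightarrow> 'k \<Rightarrow> 'k" where
  "residue_scale f c = Poly_Mapping.lookup f 0 * c"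

text \<open>\<open>dim\<^sub>k Tor\<^sub>i(M, k)\<close>.\<close>

definition tor_dim ::
  "(('n::finite, 'k::field) mpoly \<Rightarrow> 'm::ab_group_add \<Rightarrow> 'm) \<Rightarrow> nat \<Rightarrow> nat" where
  "tor_dim sm i = (let d = (SOME d. \<exists>\<epsilon>. free_resolution sm d \<epsilon>) in
     quotient_dim (kscale free_scale) (tor_cycles d residue_scale i)
       (tor_boundaries d residue_scale i))"

end

theory Submission
  imports Defs "HOL-Library.Function_Algebras"
begin

text \<open>
  Shifting along the syzygies of a free resolution identifies \<open>Tor\<^sub>i(M, k)\<close> with the Koszul homology
  \<open>H\<^sub>i(x; M)\<close>. A diagram chase in the double complex formed by the Cech and the Koszul complex shows
  that vanishing of \<open>H\<^sup>p\<^sub>\<mm>(M)\<^sub>t\<close> for \<open>p + t > r\<close> makes the Koszul complex exact wherever the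
  coefficients have degree \<open>> r\<close>. As \<open>M\<close> lives in degrees \<open>\<ge> r\<close>, only coefficients of degree \<open>r\<close>
  contribute, and the Betti numbers are the Euler characteristics
  \<open>\<beta>\<^sub>i = \<Sum>\<^sub>q (-1)\<^sup>q (n choose i-q) H\<^sub>M(r+q)\<close>. They vanish for \<open>i \<ge> n\<close> because the socle lies in
  \<open>H\<^sup>0\<^sub>\<mm>(M) = 0\<close>; this says that the \<open>n\<close>-th difference of \<open>H\<^sub>M\<close> vanishes from \<open>r\<close> on, so \<open>H\<^sub>M = P\<^sub>M\<close>
  there, and Newton interpolation at \<open>r\<close> turns the sum into the stated one, with \<open>n\<close> in place of \<open>d\<close>.
  Finally \<open>deg P\<^sub>M < d\<close>: large growth of \<open>R/I\<close> forces a long chain of primes above \<open>I\<close>.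
\<close>

section \<open>Dimensions of quotient spaces\<close>

text \<open>\<open>tor_dim\<close> uses an arbitrary, ungraded resolution by free modules of
  countable rank, so Betti numbers cannot be read off from ranks. The Koszul complex on
  \<open>M\<close> is graded, and its chains over one graded component form a finite-dimensional
  space that can be counted. Homology groups and localizations are never formed as types. Homology
  is a pair of a space and a subspace, fractions are handled through numerators over a common
  denominator, and isomorphisms are linear relations that match the subspaces. Two numbers in the
  formula have separate origins. The evaluation point \<open>r + l\<close> is where the
  \<open>l\<close>-th backward difference becomes the \<open>l\<close>-th forward difference at
  \<open>r\<close>, the Newton coefficient. The truncation at \<open>d - 1\<close> belongs to
  dimension theory: \<open>d\<close> is given by chains of primes, and the summands from order
  \<open>d\<close> on vanish once the Hilbert polynomial has degree below \<open>d\<close>. On that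
  side the Hilbert functions of quotients of the polynomial ring enter only through their order of
  growth, which makes sense without knowing them to be eventually polynomial.\<close>

text \<open>The same notion as \<open>quotient_dim\<close>, with indexed families instead of sets of
  representatives: families can be lifted along linear relations without injectivity conditions.\<close>

definition qdim :: "('k::field \<Rightarrow> 'v::ab_group_add \<Rightarrow> 'v) \<Rightarrow> 'v set \<Rightarrow> 'v set \<Rightarrow> nat \<Rightarrow> bool" where
  "qdim s Z W n \<longleftrightarrow> (\<exists>b. (\<forall>i<n. b i \<in> Z)
     \<and> (\<forall>c. (\<Sum>i<n. s (c i) (b i)) \<in> W \<longrightarrow> (\<forall>i<n. c i = 0))
     \<and> (\<forall>z\<in>Z. \<exists>c. z - (\<Sum>i<n. s (c i) (b i)) \<in> W))"

lemma sum_lessThan_add: "(\<Sum>i<a + b. f i) = (\<Sum>i<a. f i) + (\<Sum>i<b. f (a + i :: nat) :: 'z::comm_monoid_add)"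
  by (induction b) (auto simp: add.assoc)

context vector_space
begin

lemma family_card_le:
  assumes fin: "finite T" and T: "\<And>i. i < n \<Longrightarrow> v i \<in> span T"
    and ind: "\<And>c. (\<Sum>i<n. scale (c i) (v i)) = 0 \<Longrightarrow> \<forall>i<n. c i = 0"
  shows "inj_on v {..<n}" "independent (v ` {..<n})" "n \<le> card T"
proof -
  show inj: "inj_on v {..<n}"
  proof (rule inj_onI, rule ccontr)
    fix i j assume ij: "i \<in> {..<n}" "j \<in> {..<n}" "v i = v j" "i \<noteq> j"
    define c where "c = (\<lambda>k. if k = i then 1 else if k = j then -1 else (0::'a))"
    have "(\<Sum>k<n. scale (c k) (v k)) = (\<Sum>k\<in>{i,j}. scale (c k) (v k))"
      using ij by (intro sum.mono_neutral_right) (auto simp: c_def)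
    also have "\<dots> = 0" using ij by (simp add: c_def)
    finally have "\<forall>k<n. c k = 0" using ind by blast
    then show False using ij by (auto simp: c_def)
  qed
  show indep: "independent (v ` {..<n})"
  proof (rule independent_if_scalars_zero)
    fix f x assume s0: "(\<Sum>x\<in>v ` {..<n}. scale (f x) x) = 0" and x: "x \<in> v ` {..<n}"
    have "(\<Sum>i<n. scale (f (v i)) (v i)) = 0"
      using s0 by (simp add: sum.reindex[OF inj])
    then show "f x = 0" using ind[of "\<lambda>i. f (v i)"] x by auto
  qed simp
  have "card (v ` {..<n}) \<le> card T"
    using independent_span_bound[OF fin indep] T by auto
  then show "n \<le> card T" using inj by (simp add: card_image)
qed

text \<open>Modulo \<open>W\<close> each \<open>b i\<close> can be replaced by an element
  \<open>v i\<close> of the span of \<open>b'\<close>. A linear relation among the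
  \<open>v i\<close> is one among the \<open>b i\<close> modulo \<open>W\<close>, so the
  \<open>v i\<close> are independent and the exchange bound applies.\<close>

lemma qdim_le:
  assumes W: "subspace W" and n: "qdim scale Z W n" and m: "qdim scale Z W m"
  shows "n \<le> m"
proof -
  obtain b where b: "\<And>i. i < n \<Longrightarrow> b i \<in> Z"
    "\<And>c. (\<Sum>i<n. scale (c i) (b i)) \<in> W \<Longrightarrow> \<forall>i<n. c i = 0"
    using n unfolding qdim_def by blast
  obtain b' where b': "\<And>z. z \<in> Z \<Longrightarrow> \<exists>c. z - (\<Sum>i<m. scale (c i) (b' i)) \<in> W"
    using m unfolding qdim_def by blast
  have "\<forall>i. \<exists>v. i < n \<longrightarrow> v \<in> span (b' ` {..<m}) \<and> b i - v \<in> W"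
  proof
    fix i show "\<exists>v. i < n \<longrightarrow> v \<in> span (b' ` {..<m}) \<and> b i - v \<in> W"
    proof (cases "i < n")
      case True
      then obtain c where "b i - (\<Sum>j<m. scale (c j) (b' j)) \<in> W" using b' b by blast
      moreover have "(\<Sum>j<m. scale (c j) (b' j)) \<in> span (b' ` {..<m})"
        by (intro span_sum span_scale span_base) auto
      ultimately show ?thesis by blast
    qed auto
  qed
  then obtain v where v: "\<And>i. i < n \<Longrightarrow> v i \<in> span (b' ` {..<m})" "\<And>i. i < n \<Longrightarrow> b i - v i \<in> W"
    by metis
  have "n \<le> card (b' ` {..<m})"
  proof (rule family_card_le(3)[where v = v])
    fix c assume c: "(\<Sum>i<n. scale (c i) (v i)) = 0"
    have "(\<Sum>i<n. scale (c i) (b i)) = (\<Sum>i<n. scale (c i) (b i - v i))"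
      using c by (simp add: scale_right_diff_distrib sum_subtractf)
    also have "\<dots> \<in> W" using v(2) W by (intro subspace_sum subspace_scale) auto
    finally show "\<forall>i<n. c i = 0" using b(2) by blast
  qed (use v in auto)
  also have "\<dots> \<le> m" using card_image_le[of "{..<m}" b'] by simp
  finally show ?thesis .
qed

lemma qdim_unique:
  assumes "subspace W" "qdim scale Z W n" "qdim scale Z W m"
  shows "n = m"
  using qdim_le[OF assms(1,2,3)] qdim_le[OF assms(1,3,2)] by simp

text \<open>Passage to the format of \<open>quotient_dim\<close>. Independence modulo
  \<open>W\<close> implies plain independence because \<open>0\<close> lies in \<open>W\<close>, and
  this makes the family injective.\<close>

lemma qdim_imp_set_basis:
  assumes Z: "subspace Z" and W: "subspace W" and WZ: "W \<subseteq> Z" and n: "qdim scale Z W n"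
  shows "\<exists>B. finite B \<and> card B = n \<and> B \<subseteq> Z \<and> independent B \<and> span B \<inter> W = {0} \<and> span (B \<union> W) = Z"
proof -
  obtain b where b: "\<And>i. i < n \<Longrightarrow> b i \<in> Z"
    "\<And>c. (\<Sum>i<n. scale (c i) (b i)) \<in> W \<Longrightarrow> \<forall>i<n. c i = 0"
    "\<And>z. z \<in> Z \<Longrightarrow> \<exists>c. z - (\<Sum>i<n. scale (c i) (b i)) \<in> W"
    using n unfolding qdim_def by blast
  let ?B = "b ` {..<n}"
  have ind: "\<And>c. (\<Sum>i<n. scale (c i) (b i)) = 0 \<Longrightarrow> \<forall>i<n. c i = 0"
    using b(2) subspace_0[OF W] by metis
  note * = family_card_le[of ?B n b, OF _ span_base ind]
  have inj: "inj_on b {..<n}" and indep: "independent ?B" using * by auto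
  have "span ?B \<inter> W \<subseteq> {0}"
  proof
    fix x assume x: "x \<in> span ?B \<inter> W"
    then obtain u where "x = (\<Sum>v\<in>?B. scale (u v) v)" using span_finite[of ?B] by auto
    then have x': "x = (\<Sum>i<n. scale (u (b i)) (b i))" by (simp add: sum.reindex[OF inj])
    then have "\<forall>i<n. u (b i) = 0" using b(2)[of "\<lambda>i. u (b i)"] x by auto
    then show "x \<in> {0}" using x' by simp
  qed
  then have int: "span ?B \<inter> W = {0}" using span_zero subspace_0[OF W] by blast
  have "span (?B \<union> W) = Z"
  proof
    show "span (?B \<union> W) \<subseteq> Z" using b(1) WZ by (intro span_minimal Z) auto
    show "Z \<subseteq> span (?B \<union> W)"
    proof
      fix z assume "z \<in> Z"
      then obtain c where c: "z - (\<Sum>i<n. scale (c i) (b i)) \<in> W" using b(3) by blast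
      have "(\<Sum>i<n. scale (c i) (b i)) \<in> span (?B \<union> W)"
        by (intro span_sum span_scale span_base) auto
      moreover have "z - (\<Sum>i<n. scale (c i) (b i)) \<in> span (?B \<union> W)" using c by (intro span_base) auto
      ultimately show "z \<in> span (?B \<union> W)" using span_add by fastforce
    qed
  qed
  then show ?thesis using int indep inj b(1) by (intro exI[of _ ?B]) (auto simp: card_image)
qed

lemma set_basis_imp_qdim:
  assumes W: "subspace W" and B: "finite B" "B \<subseteq> Z" "independent B" "span B \<inter> W = {0}" "span (B \<union> W) = Z"
  shows "qdim scale Z W (card B)"
proof -
  obtain b where b: "bij_betw b {..<card B} B"
    using ex_bij_betw_nat_finite[OF B(1)] by (auto simp: atLeast0LessThan)
  have inj: "inj_on b {..<card B}" and im: "b ` {..<card B} = B"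
    using b by (auto simp: bij_betw_def)
  have sum_eq: "(\<Sum>i<card B. scale (u (b i)) (b i)) = (\<Sum>v\<in>B. scale (u v) v)" for u
    using sum.reindex[OF inj, of "\<lambda>v. scale (u v) v"] im by simp
  show ?thesis unfolding qdim_def
  proof (intro exI[of _ b] conjI allI impI ballI)
    fix i assume "i < card B" then show "b i \<in> Z" using im B(2) by auto
  next
    fix c i assume c: "(\<Sum>i<card B. scale (c i) (b i)) \<in> W" and i: "i < card B"
    \<comment> \<open>Coefficients indexed by positions become coefficients indexed by
      vectors.\<close>
    define u where "u v = c (inv_into {..<card B} b v)" for v
    have u: "u (b j) = c j" if "j < card B" for j using inj that by (simp add: u_def)
    have e: "(\<Sum>i<card B. scale (c i) (b i)) = (\<Sum>v\<in>B. scale (u v) v)"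
      using sum_eq[of u] by (simp add: u)
    have "(\<Sum>v\<in>B. scale (u v) v) \<in> span B" by (intro span_sum span_scale span_base)
    then have "(\<Sum>v\<in>B. scale (u v) v) = 0" using c e B(4) by auto
    then have "u (b i) = 0" using independentD[OF B(3,1)] i im by blast
    then show "c i = 0" using u i by simp
  next
    fix z assume "z \<in> Z"
    then obtain x y where xy: "z = x + y" "x \<in> span B" "y \<in> W"
      using B(5) span_Un[of B W] span_eq_iff[THEN iffD2, OF W] by auto
    then obtain u where "x = (\<Sum>v\<in>B. scale (u v) v)" using span_finite[OF B(1)] by auto
    then have "z - (\<Sum>i<card B. scale (u (b i)) (b i)) \<in> W" using xy sum_eq[of u] by simp
    then show "\<exists>c. z - (\<Sum>i<card B. scale (c i) (b i)) \<in> W" by (rule exI[of _ "\<lambda>i. u (b i)"])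
  qed
qed

text \<open>One translation gives existence for the definite description; the other, together with
  \<open>qdim_unique\<close>, gives uniqueness.\<close>

lemma quotient_dim_eq:
  assumes Z: "subspace Z" and W: "subspace W" and WZ: "W \<subseteq> Z" and n: "qdim scale Z W n"
  shows "quotient_dim scale Z W = n"
  unfolding quotient_dim_def
proof (rule the_equality)
  show "\<exists>B. finite B \<and> card B = n \<and> B \<subseteq> Z \<and> independent B \<and> span B \<inter> W = {0} \<and> span (B \<union> W) = Z"
    by (rule qdim_imp_set_basis[OF assms])
next
  fix m assume "\<exists>B. finite B \<and> card B = m \<and> B \<subseteq> Z \<and> independent B \<and> span B \<inter> W = {0} \<and> span (B \<union> W) = Z"
  then show "m = n" using set_basis_imp_qdim[OF W] qdim_unique[OF W] n by blast
qed

lemma qdim_dim: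
  assumes Z: "subspace Z" and n: "qdim scale Z {0} n"
  shows "dim Z = n"
proof -
  obtain B where "finite B" "card B = n" "B \<subseteq> Z" "independent B" "span (B \<union> {0}) = Z"
    using qdim_imp_set_basis[OF Z _ _ n] subspace_0[OF Z] by auto
  then show ?thesis by (intro dim_unique[of B]) auto
qed

lemma qdim_self: "subspace W \<Longrightarrow> qdim scale W W 0"
  unfolding qdim_def by (auto simp: subspace_0)

text \<open>Representatives of a basis of \<open>Z / V\<close> followed by those of a basis of
  \<open>V / W\<close> represent a basis of \<open>Z / W\<close>.\<close>

lemma qdim_add:
  assumes V: "subspace V" and WV: "W \<subseteq> V" and VZ: "V \<subseteq> Z"
    and a: "qdim scale Z V a" and b: "qdim scale V W b"
  shows "qdim scale Z W (a + b)"
proof -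
  obtain f where f: "\<And>i. i < a \<Longrightarrow> f i \<in> Z"
    "\<And>c. (\<Sum>i<a. scale (c i) (f i)) \<in> V \<Longrightarrow> \<forall>i<a. c i = 0"
    "\<And>z. z \<in> Z \<Longrightarrow> \<exists>c. z - (\<Sum>i<a. scale (c i) (f i)) \<in> V"
    using a unfolding qdim_def by blast
  obtain g where g: "\<And>i. i < b \<Longrightarrow> g i \<in> V"
    "\<And>c. (\<Sum>i<b. scale (c i) (g i)) \<in> W \<Longrightarrow> \<forall>i<b. c i = 0"
    "\<And>z. z \<in> V \<Longrightarrow> \<exists>c. z - (\<Sum>i<b. scale (c i) (g i)) \<in> W"
    using b unfolding qdim_def by blast
  define h where "h i = (if i < a then f i else g (i - a))" for i
  have h: "(\<Sum>i<a + b. scale (c i) (h i)) = (\<Sum>i<a. scale (c i) (f i)) + (\<Sum>i<b. scale (c (a + i)) (g i))" for c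
    unfolding sum_lessThan_add by (simp add: h_def)
  have gV: "(\<Sum>i<b. scale (c i) (g i)) \<in> V" for c
    using g(1) V by (intro subspace_sum subspace_scale) auto
  show ?thesis unfolding qdim_def
  proof (intro exI[of _ h] conjI allI impI ballI)
    fix i assume i: "i < a + b"
    then have "i - a < b" if "\<not> i < a" using that by linarith
    then show "h i \<in> Z" using f(1) g(1) VZ i by (auto simp: h_def)
  next
    fix c i assume c: "(\<Sum>i<a + b. scale (c i) (h i)) \<in> W" and i: "i < a + b"
    have "(\<Sum>i<a. scale (c i) (f i)) \<in> V"
      using c WV gV subspace_diff[OF V] unfolding h by (metis add_diff_cancel_right' subsetD)
    then have 1: "\<forall>i<a. c i = 0" using f(2) by blast
    then have "(\<Sum>i<b. scale (c (a + i)) (g i)) \<in> W" using c unfolding h by simp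
    then have "\<forall>i<b. c (a + i) = 0" by (rule g(2)[of "\<lambda>i. c (a + i)"])
    then show "c i = 0" using 1 i by (metis add_diff_inverse_nat nat_add_left_cancel_less)
  next
    fix z assume "z \<in> Z"
    then obtain c where "z - (\<Sum>i<a. scale (c i) (f i)) \<in> V" using f(3) by blast
    then obtain c' where c': "z - (\<Sum>i<a. scale (c i) (f i)) - (\<Sum>i<b. scale (c' i) (g i)) \<in> W" using g(3) by blast
    have "(\<Sum>i<a + b. scale ((if i < a then c i else c' (i - a))) (h i))
        = (\<Sum>i<a. scale (c i) (f i)) + (\<Sum>i<b. scale (c' i) (g i))" unfolding h by simp
    then show "\<exists>c. z - (\<Sum>i<a + b. scale (c i) (h i)) \<in> W" using c' by (metis diff_diff_add)
  qed
qed

text \<open>A longest family that is independent modulo \<open>W\<close> also spans modulo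
  \<open>W\<close>. Lengths are bounded by \<open>card T\<close> since such a family is independent
  outright.\<close>

lemma qdim_exists:
  assumes Z: "subspace Z" and W: "subspace W" and T: "finite T" "Z \<subseteq> span T"
  shows "\<exists>n\<le>card T. qdim scale Z W n"
proof -
  define Q where "Q n \<longleftrightarrow> (\<exists>b. (\<forall>i<n. b i \<in> Z) \<and> (\<forall>c. (\<Sum>i<n. scale (c i) (b i)) \<in> W \<longrightarrow> (\<forall>i<n. c i = 0)))" for n :: nat
  have bd: "n \<le> card T" if Qn: "Q n" for n
  proof -
    obtain b where b: "\<And>i. i < n \<Longrightarrow> b i \<in> Z" "\<And>c. (\<Sum>i<n. scale (c i) (b i)) \<in> W \<Longrightarrow> \<forall>i<n. c i = 0"
      using Qn unfolding Q_def by blast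
    show ?thesis
      by (rule family_card_le(3)[of T n b]) (use b T subspace_0[OF W] in \<open>auto simp: subset_iff\<close>)
  qed
  have "Q 0" unfolding Q_def by simp
  define n where "n = (GREATEST n. Q n)"
  have Qn: "Q n" and mx: "\<And>m. Q m \<Longrightarrow> m \<le> n"
    unfolding n_def using GreatestI_nat[of Q 0 "card T"] Greatest_le_nat[of Q _ "card T"] \<open>Q 0\<close> bd by blast+
  obtain b where b: "\<And>i. i < n \<Longrightarrow> b i \<in> Z" "\<And>c. (\<Sum>i<n. scale (c i) (b i)) \<in> W \<Longrightarrow> \<forall>i<n. c i = 0"
    using Qn unfolding Q_def by blast
  have "\<exists>c. z - (\<Sum>i<n. scale (c i) (b i)) \<in> W" if z: "z \<in> Z" for z
  proof (rule ccontr)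
    assume no: "\<nexists>c. z - (\<Sum>i<n. scale (c i) (b i)) \<in> W"
    define b' where "b' = b(n := z)"
    have s: "(\<Sum>i<Suc n. scale (c i) (b' i)) = (\<Sum>i<n. scale (c i) (b i)) + scale (c n) z" for c
      by (simp add: b'_def)
    have "c i = 0" if c: "(\<Sum>i<Suc n. scale (c i) (b' i)) \<in> W" and i: "i < Suc n" for c i
    proof -
      have "c n = 0"
      proof (rule ccontr)
        \<comment> \<open>Dividing by \<open>c n\<close> would express \<open>z\<close> modulo
          \<open>W\<close> by the old family.\<close>
        assume n0: "c n \<noteq> 0"
        have "scale (1 / c n) ((\<Sum>i<n. scale (c i) (b i)) + scale (c n) z) \<in> W"
          using c s W by (metis subspace_scale)
        moreover have "scale (1 / c n) ((\<Sum>i<n. scale (c i) (b i)) + scale (c n) z)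
           = z - (\<Sum>i<n. scale (- (c i / c n)) (b i))"
          using n0 by (simp add: scale_right_distrib scale_sum_right sum_negf)
        ultimately show False using no by metis
      qed
      moreover from this have "(\<Sum>i<n. scale (c i) (b i)) \<in> W"
        using c unfolding s by simp
      ultimately show ?thesis using b(2)[of c] i by (cases "i = n") auto
    qed
    then have "Q (Suc n)" unfolding Q_def using b(1) z by (intro exI[of _ b']) (auto simp: b'_def less_Suc_eq)
    then show False using mx by fastforce
  qed
  then have "qdim scale Z W n" unfolding qdim_def using b by (intro exI[of _ b]) auto
  then show ?thesis using bd[OF Qn] by blast
qed

end

text \<open>A connecting map depends on a choice of lifts; the relation between all lifts and their
  images avoids the choice, so isomorphisms of quotients are used in the form of linear relations.
  The proof lifts a basis of \<open>Z' / W'\<close> along \<open>\<rho>\<close>.\<close>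

lemma qdim_transfer:
  assumes s: "vector_space s" and s': "vector_space s'"
    and 0: "\<rho> 0 0" and add: "\<And>x x' y y'. \<rho> x x' \<Longrightarrow> \<rho> y y' \<Longrightarrow> \<rho> (x + y) (x' + y')"
    and scale: "\<And>c x x'. \<rho> x x' \<Longrightarrow> \<rho> (s c x) (s' c x')"
    and Z: "module.subspace s Z" and Z': "module.subspace s' Z'"
    and total: "\<And>z. z \<in> Z \<Longrightarrow> \<exists>z'\<in>Z'. \<rho> z z'"
    and onto: "\<And>z'. z' \<in> Z' \<Longrightarrow> \<exists>z\<in>Z. \<rho> z z'"
    and W: "\<And>z z'. z \<in> Z \<Longrightarrow> z' \<in> Z' \<Longrightarrow> \<rho> z z' \<Longrightarrow> z \<in> W \<longleftrightarrow> z' \<in> W'"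
    and n: "qdim s' Z' W' n"
  shows "qdim s Z W n"
proof -
  interpret v: vector_space s by fact
  interpret v': vector_space s' by fact
  obtain b' where b': "\<And>i. i < n \<Longrightarrow> b' i \<in> Z'"
    "\<And>c. (\<Sum>i<n. s' (c i) (b' i)) \<in> W' \<Longrightarrow> \<forall>i<n. c i = 0"
    "\<And>z. z \<in> Z' \<Longrightarrow> \<exists>c. z - (\<Sum>i<n. s' (c i) (b' i)) \<in> W'"
    using n unfolding qdim_def by blast
  have "\<forall>i. \<exists>x. i < n \<longrightarrow> x \<in> Z \<and> \<rho> x (b' i)" using onto b'(1) by blast
  then obtain b where b: "\<And>i. i < n \<Longrightarrow> b i \<in> Z" "\<And>i. i < n \<Longrightarrow> \<rho> (b i) (b' i)" by metis
  have sums: "\<rho> (\<Sum>i<m. s (c i) (b i)) (\<Sum>i<m. s' (c i) (b' i))" if "m \<le> n" for m c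
    using that
  proof (induction m)
    case (Suc m)
    then show ?case using add[OF _ scale[OF b(2)], of _ _ m "c m"] by simp
  qed (simp add: 0)
  have neg: "\<rho> (x - y) (x' - y')" if "\<rho> x x'" "\<rho> y y'" for x x' y y'
    using add[OF that(1) scale[OF that(2), of "-1"]] by simp
  have bZ: "(\<Sum>i<n. s (c i) (b i)) \<in> Z" for c using b Z by (intro v.subspace_sum v.subspace_scale) auto
  have bZ': "(\<Sum>i<n. s' (c i) (b' i)) \<in> Z'" for c using b' Z' by (intro v'.subspace_sum v'.subspace_scale) auto
  show ?thesis unfolding qdim_def
  proof (intro exI[of _ b] conjI allI impI ballI)
    fix i assume "i < n" then show "b i \<in> Z" using b by blast
  next
    fix c i assume "(\<Sum>i<n. s (c i) (b i)) \<in> W" "i < n"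
    then show "c i = 0" using W[OF bZ bZ' sums[OF order_refl]] b'(2) by blast
  next
    fix z assume z: "z \<in> Z"
    then obtain z' where z': "z' \<in> Z'" "\<rho> z z'" using total by blast
    then obtain c where c: "z' - (\<Sum>i<n. s' (c i) (b' i)) \<in> W'" using b'(3) by blast
    have "z - (\<Sum>i<n. s (c i) (b i)) \<in> W"
      using W[OF v.subspace_diff[OF Z z bZ] v'.subspace_diff[OF Z' z'(1) bZ'] neg[OF z'(2) sums[OF order_refl]]] c by blast
    then show "\<exists>c. z - (\<Sum>i<n. s (c i) (b i)) \<in> W" by blast
  qed
qed

section \<open>Koszul complexes\<close>

text \<open>The sign of the position of \<open>i\<close> in \<open>U\<close>. Counting only elements
  strictly below \<open>i\<close> makes it indifferent to whether \<open>i\<close> belongs to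
  \<open>U\<close>.\<close>

definition sg :: "'n::linorder \<Rightarrow> 'n set \<Rightarrow> 'r::comm_ring_1" where
  "sg i U = (-1) ^ card {j\<in>U. j < i}"

lemma sg_square [simp]: "sg i U * sg i U = 1"
  by (simp add: sg_def flip: power_mult_distrib)

lemma sg_square_left [simp]: "sg i U * (sg i U * a) = a"
  by (simp add: mult.assoc[symmetric])

lemma sg_cases: "sg i U = 1 \<or> sg i U = -1"
  unfolding sg_def by (metis neg_one_even_power neg_one_odd_power)

lemma sg_insert_self [simp]: "sg i (insert i U) = sg i U"
  unfolding sg_def by (rule arg_cong[where f = "\<lambda>A. (-1) ^ card A"]) auto

lemma sg_remove_self [simp]: "sg i (U - {i}) = sg i U"
  unfolding sg_def by (rule arg_cong[where f = "\<lambda>A. (-1) ^ card A"]) auto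

lemma sg_insert:
  fixes U :: "'n::{finite,linorder} set"
  assumes "j \<notin> U"
  shows "sg i (insert j U) = (if j < i then - sg i U else sg i U)"
proof -
  have "{k \<in> insert j U. k < i} = (if j < i then insert j {k\<in>U. k < i} else {k\<in>U. k < i})" by auto
  then show ?thesis using assms by (auto simp: sg_def)
qed

text \<open>Exactly one of \<open>i < j\<close> and \<open>j < i\<close> holds, so inserting the
  other index flips exactly one of the two signs.\<close>

lemma sg_swap:
  fixes U :: "'n::{finite,linorder} set"
  assumes "i \<notin> U" "j \<notin> U" "i \<noteq> j"
  shows "sg i U * sg j (insert i U) = - (sg j U * sg i (insert j U))"
  using assms by (auto simp: sg_insert mult.commute)

text \<open>The pairs \<open>(i, j)\<close> and \<open>(j, i)\<close> cancel. The argument is an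
  induction on \<open>A\<close> because in characteristic 2 a sum that equals its own negative may
  be nonzero.\<close>

lemma antisymmetric_sum_eq_0:
  fixes g :: "'i \<Rightarrow> 'i \<Rightarrow> 'v::ab_group_add"
  assumes "finite A" and "\<And>i j. i \<in> A \<Longrightarrow> j \<in> A \<Longrightarrow> i \<noteq> j \<Longrightarrow> g i j = - g j i"
  shows "(\<Sum>i\<in>A. \<Sum>j\<in>A - {i}. g i j) = 0"
  using assms
proof (induction A)
  case (insert a A)
  have 1: "(\<Sum>j\<in>insert a A - {i}. g i j) = g i a + (\<Sum>j\<in>A - {i}. g i j)" if "i \<in> A" for i
  proof -
    have "insert a A - {i} = insert a (A - {i})" using that insert.hyps by auto
    then show ?thesis using insert.hyps by simp
  qed
  have 2: "insert a A - {a} = A" using insert.hyps by auto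
  have ih: "(\<Sum>i\<in>A. \<Sum>j\<in>A - {i}. g i j) = 0" by (rule insert.IH, rule insert.prems) auto
  have "(\<Sum>i\<in>insert a A. \<Sum>j\<in>insert a A - {i}. g i j) = (\<Sum>j\<in>A. g a j) + (\<Sum>i\<in>A. g i a)"
    using insert.hyps by (simp add: 1 2 sum.distrib ih)
  also have "(\<Sum>i\<in>A. g i a) = (\<Sum>i\<in>A. - g a i)"
    by (intro sum.cong refl insert.prems) (use insert.hyps in auto)
  finally show ?case by (simp add: sum_negf)
qed simp

text \<open>The differential of the Koszul complex of \<open>y\<close>. A chain stores at
  \<open>U\<close> the coefficient of the exterior monomial with index set \<open>U\<close>; the new
  coefficient at \<open>U\<close> collects all ways of contracting one index away.\<close>

definition kd :: "('r::comm_ring_1 \<Rightarrow> 'm::ab_group_add \<Rightarrow> 'm) \<Rightarrow> ('n::{finite,linorder} \<Rightarrow> 'r) \<Rightarrow> ('n set \<Rightarrow> 'm) \<Rightarrow> 'n set \<Rightarrow> 'm" where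
  "kd sm y w U = (\<Sum>i\<in>- U. sm (sg i U * y i) (w (insert i U)))"

text \<open>The Cech differential on numerators: with \<open>y i = var i ^ a\<close>, numerators
  over \<open>var_prod S ^ a\<close> go to numerators over \<open>var_prod T ^ a\<close>.\<close>

definition cd :: "('r::comm_ring_1 \<Rightarrow> 'm::ab_group_add \<Rightarrow> 'm) \<Rightarrow> ('n::{finite,linorder} \<Rightarrow> 'r) \<Rightarrow> ('n set \<Rightarrow> 'm) \<Rightarrow> 'n set \<Rightarrow> 'm" where
  "cd sm y m T = (\<Sum>i\<in>T. sm (sg i T * y i) (m (T - {i})))"

text \<open>Left exterior multiplication by the basis vector with index \<open>s\<close>.\<close>

definition wedge :: "('r::comm_ring_1 \<Rightarrow> 'm::ab_group_add \<Rightarrow> 'm) \<Rightarrow> 'n::{finite,linorder} \<Rightarrow> ('n set \<Rightarrow> 'm) \<Rightarrow> 'n set \<Rightarrow> 'm" where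
  "wedge sm s w U = (if s \<in> U then sm (sg s U) (w (U - {s})) else 0)"

context module
begin

lemma sg_scale_cases: "scale (sg i U) v = v \<or> scale (sg i U) v = - v"
  using sg_cases[of i U] by (metis scale_minus_left scale_one)

lemma kd_add: "kd scale y (\<lambda>U. w U + w' U) U = kd scale y w U + kd scale y w' U"
  by (simp add: kd_def scale_right_distrib sum.distrib)

lemma kd_diff: "kd scale y (\<lambda>U. w U - w' U) U = kd scale y w U - kd scale y w' U"
  by (simp add: kd_def scale_right_diff_distrib sum_subtractf)

lemma kd_scale: "kd scale y (\<lambda>U. scale a (w U)) U = scale a (kd scale y w U)"
  by (simp add: kd_def scale_sum_right mult.commute)

lemma kd_zero [simp]: "kd scale y (\<lambda>U. 0) U = 0"
  by (simp add: kd_def)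

lemma cd_diff: "cd scale y (\<lambda>U. w U - w' U) U = cd scale y w U - cd scale y w' U"
  by (simp add: cd_def scale_right_diff_distrib sum_subtractf)

lemma cd_zero [simp]: "cd scale y (\<lambda>U. 0) U = 0"
  by (simp add: cd_def)

lemma kd_kd: "kd scale y (kd scale y w) U = 0"
proof -
  define g where "g i j = scale (sg i U * y i * (sg j (insert i U) * y j)) (w (insert j (insert i U)))" for i j
  have "kd scale y (kd scale y w) U = (\<Sum>i\<in>-U. \<Sum>j\<in>-U - {i}. g i j)"
    unfolding kd_def g_def scale_sum_right
    by (intro sum.cong) (auto simp: Compl_insert)
  also have "\<dots> = 0"
  proof (rule antisymmetric_sum_eq_0)
    fix i j assume ij: "i \<in> -U" "j \<in> -U" "i \<noteq> j"
    have "sg i U * y i * (sg j (insert i U) * y j) = (sg i U * sg j (insert i U)) * (y i * y j)"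
      by (simp add: mult_ac)
    also have "\<dots> = - (sg j U * sg i (insert j U)) * (y i * y j)"
      using ij by (subst sg_swap) auto
    also have "\<dots> = - (sg j U * y j * (sg i (insert j U) * y i))" by (simp add: mult_ac)
    finally show "g i j = - g j i" unfolding g_def
      by (metis (no_types) insert_commute scale_minus_left)
  qed simp
  finally show ?thesis .
qed

lemma cd_cd: "cd scale y (cd scale y m) T = 0"
proof -
  define g where "g i j = scale (sg i T * y i * (sg j (T - {i}) * y j)) (m (T - {i} - {j}))" for i j
  have "cd scale y (cd scale y m) T = (\<Sum>i\<in>T. \<Sum>j\<in>T - {i}. g i j)"
    unfolding cd_def g_def scale_sum_right by (intro sum.cong) auto
  also have "\<dots> = 0"
  proof (rule antisymmetric_sum_eq_0)
    fix i j assume ij: "i \<in> T" "j \<in> T" "i \<noteq> j"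
    \<comment> \<open>Signs are normalized to the set \<open>V\<close> that contains neither index,
      where \<open>sg_swap\<close> applies.\<close>
    define V where "V = T - {i} - {j}"
    have V: "i \<notin> V" "j \<notin> V" "T - {i} = insert j V" "T - {j} = insert i V" "T = insert i (insert j V)"
      "T = insert j (insert i V)" using ij by (auto simp: V_def)
    have 1: "sg i T = sg i (insert j V)" "sg j T = sg j (insert i V)"
      by (metis V(5) sg_insert_self, metis V(6) sg_insert_self)
    have 2: "sg j (T - {i}) = sg j V" "sg i (T - {j}) = sg i V" using V by simp_all
    have "sg i T * y i * (sg j (T - {i}) * y j) = (sg j V * sg i (insert j V)) * (y i * y j)"
      by (simp only: 1 2) (simp add: mult_ac)
    also have "\<dots> = - (sg i V * sg j (insert i V)) * (y i * y j)"
      using V ij by (subst sg_swap) auto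
    also have "\<dots> = - (sg j T * y j * (sg i (T - {j}) * y i))"
      by (simp only: 1 2) (simp add: mult_ac)
    finally have c: "sg i T * y i * (sg j (T - {i}) * y j) = - (sg j T * y j * (sg i (T - {j}) * y i))" .
    have "T - {i} - {j} = T - {j} - {i}" by auto
    then show "g i j = - g j i" unfolding g_def c scale_minus_left by simp
  qed simp
  finally show ?thesis .
qed

lemma kd_cd: "kd scale y (\<lambda>U. cd scale z (\<lambda>S. w S U) T) U = cd scale z (\<lambda>S. kd scale y (w S) U) T"
  unfolding kd_def cd_def scale_sum_right by (subst sum.swap) (simp add: mult_ac)

text \<open>The Leibniz rule. Among the summands of the inner differential, the one that puts
  \<open>s\<close> back gives the multiple by \<open>y s\<close>; the others match those of the
  left-hand side up to the sign from \<open>sg_swap\<close>.\<close>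

lemma kd_wedge_in:
  assumes "s \<in> U"
  shows "kd scale y (wedge scale s w) U = scale (y s) (w U) - wedge scale s (kd scale y w) U"
proof -
  have c: "- (U - {s}) = insert s (- U)" using assms by auto
  have "wedge scale s (kd scale y w) U = (\<Sum>i\<in>insert s (-U). scale (sg s U * (sg i (U - {s}) * y i)) (w (insert i (U - {s}))))"
    using assms by (simp add: wedge_def kd_def c scale_sum_right del: sum.insert)
  also have "\<dots> = scale (y s) (w U) + (\<Sum>i\<in>-U. scale (sg s U * (sg i (U - {s}) * y i)) (w (insert i (U - {s}))))"
    using assms by (simp add: insert_absorb)
  also have "(\<Sum>i\<in>-U. scale (sg s U * (sg i (U - {s}) * y i)) (w (insert i (U - {s})))) =
     (\<Sum>i\<in>-U. - scale (sg i U * y i) (wedge scale s w (insert i U)))"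
  proof (rule sum.cong)
    fix i assume i: "i \<in> - U"
    define V where "V = U - {s}"
    have V: "s \<notin> V" "U = insert s V" "i \<notin> V" "i \<noteq> s" using assms i by (auto simp: V_def)
    have 1: "insert i U - {s} = insert i V" using V by auto
    have "sg s (insert i U) = (sg s (insert i V) :: 'a)" using V by (metis insert_commute sg_insert_self)
    then have "scale (sg i U * y i) (wedge scale s w (insert i U)) = scale ((sg i (insert s V) * sg s (insert i V)) * y i) (w (insert i V))"
      using assms by (simp add: wedge_def 1 mult_ac) (simp add: V(2))
    also have "sg i (insert s V) * sg s (insert i V) = - (sg s V * sg i V)"
      using V sg_swap[of s V i] by (auto simp: sg_insert mult_ac)
    finally show "scale (sg s U * (sg i (U - {s}) * y i)) (w (insert i (U - {s}))) =
       - scale (sg i U * y i) (wedge scale s w (insert i U))"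
      by (simp add: V_def[symmetric] mult_ac) (simp add: V(2))
  qed simp
  finally show ?thesis unfolding kd_def[of scale y "wedge scale s w" U] sum_negf by (simp add: algebra_simps)
qed

lemma kd_wedge_notin:
  assumes "s \<notin> U"
  shows "kd scale y (wedge scale s w) U = scale (y s) (w U)"
proof -
  have "kd scale y (wedge scale s w) U = (\<Sum>i\<in>{s}. scale (sg i U * y i) (wedge scale s w (insert i U)))"
    unfolding kd_def using assms by (intro sum.mono_neutral_right) (auto simp: wedge_def)
  also have "\<dots> = scale (y s) (w U)" using assms by (simp add: wedge_def mult_ac)
  finally show ?thesis .
qed

text \<open>Multiplication by \<open>y s\<close> is null-homotopic on the Koszul complex. Where
  \<open>y s\<close> is invertible this contracts the complex, which drives the chase in the double
  complex.\<close>

lemma kd_wedge: "kd scale y (wedge scale s w) U = scale (y s) (w U) - wedge scale s (kd scale y w) U"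
proof (cases "s \<in> U")
  case False
  then show ?thesis by (simp add: kd_wedge_notin) (simp add: wedge_def)
qed (rule kd_wedge_in)

end

text \<open>\<open>N\<close> is a plain set, so that besides a submodule it may be a single graded
  component \<open>G t\<close>, which the differential maps into \<open>G (t + 1)\<close>. The
  cardinality of \<open>U\<close> is the homological degree.\<close>

definition kchains :: "'m::zero set \<Rightarrow> nat \<Rightarrow> ('n set \<Rightarrow> 'm) set" where
  "kchains N q = {w. \<forall>U. w U \<in> N \<and> (card U \<noteq> q \<longrightarrow> w U = 0)}"

definition kcycles where
  "kcycles sm y N q = {w \<in> kchains N q. \<forall>U. kd sm y w U = 0}"

definition kboundaries where
  "kboundaries sm y N q = {kd sm y u | u. u \<in> kchains N (Suc q)}"

context module
begin

lemma kd_kchains: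
  assumes "subspace N" "u \<in> kchains N (Suc q)"
  shows "kd scale y u \<in> kchains N q"
proof -
  have "kd scale y u U \<in> N" for U
    unfolding kd_def using assms by (intro subspace_sum subspace_scale) (auto simp: kchains_def)
  moreover have "kd scale y u U = 0" if "card U \<noteq> q" for U
    unfolding kd_def using assms that by (intro sum.neutral) (auto simp: kchains_def)
  ultimately show ?thesis by (auto simp: kchains_def)
qed

lemma kboundaries_subset_kcycles: "subspace N \<Longrightarrow> kboundaries scale y N q \<subseteq> kcycles scale y N q"
  using kd_kchains by (auto simp: kboundaries_def kcycles_def kd_kd)

text \<open>A module on which every \<open>y i\<close> can be divided off by an operator \<open>D i\<close> that is linear over
  the other \<open>y j\<close> is acyclic: \<open>w \<mapsto> e\<^sub>i \<and> D\<^sub>i w\<close> is a homotopy between the identity and a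
  map that kills all components involving \<open>e\<^sub>i\<close>.\<close>

lemma koszul_acyclic:
  fixes D :: "'n::{finite,linorder} \<Rightarrow> 'b \<Rightarrow> 'b"
  assumes D_add: "\<And>i u v. D i (u + v) = D i u + D i v"
    and D_other: "\<And>i j v. i \<noteq> j \<Longrightarrow> D i (scale (y j) v) = scale (y j) (D i v)"
    and D_same: "\<And>i v. D i (scale (y i) v) = v"
    and w: "w \<in> kcycles scale y UNIV q" and q: "q > 0"
  shows "w \<in> kboundaries scale y UNIV q"
proof -
  interpret D: additive "D i" for i by unfold_locales (rule D_add)
  \<comment> \<open>\<open>D i\<close> is only additive; signs pass through it because they are 1 or
    -1.\<close>
  have D_sg: "D i (scale (sg j U * a) v) = scale (sg j U) (D i (scale a v))" for i j U a v
  proof -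
    have "sg j U = (1::'a) \<or> sg j U = (- 1::'a)" by (rule sg_cases)
    then show ?thesis by (auto simp: D.minus)
  qed
  \<comment> \<open>The homotopy identity. The term subtracted on the right is the remainder of
    \<open>w\<close> on division by \<open>y i\<close>, kept only where \<open>i\<close> does not
    occur.\<close>
  have hom: "kd scale y (wedge scale i (\<lambda>U. D i (w U))) U + wedge scale i (\<lambda>U. D i (kd scale y w U)) U
     = w U - (if i \<in> U then 0 else w U - scale (y i) (D i (w U)))" for w i U
  proof (cases "i \<in> U")
    case True
    define V where "V = U - {i}"
    have V: "i \<notin> V" "insert i V = U" using True by (auto simp: V_def)
    have c: "- V = insert i (- U)" using True by (auto simp: V_def)
    have 1: "D i (kd scale y w V) = scale (sg i V) (w U) + (\<Sum>j\<in>-U. scale (sg j V * y j) (D i (w (insert j V))))"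
    proof -
      have "D i (kd scale y w V) = (\<Sum>j\<in>-V. scale (sg j V) (D i (scale (y j) (w (insert j V)))))"
        by (simp add: kd_def D.sum D_sg)
      also have "\<dots> = scale (sg i V) (w U) + (\<Sum>j\<in>-U. scale (sg j V) (D i (scale (y j) (w (insert j V)))))"
        using True V by (simp add: c D_same)
      also have "(\<Sum>j\<in>-U. scale (sg j V) (D i (scale (y j) (w (insert j V))))) = (\<Sum>j\<in>-U. scale (sg j V * y j) (D i (w (insert j V))))"
      proof (rule sum.cong)
        fix j assume "j \<in> -U"
        then have "i \<noteq> j" using True by auto
        then show "scale (sg j V) (D i (scale (y j) (w (insert j V)))) = scale (sg j V * y j) (D i (w (insert j V)))"
          by (simp add: D_other)
      qed simp
      finally show ?thesis .
    qed
    have 2: "kd scale y (\<lambda>U. D i (w U)) V = scale (sg i V * y i) (D i (w U)) + (\<Sum>j\<in>-U. scale (sg j V * y j) (D i (w (insert j V))))"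
      unfolding kd_def c using True V by simp
    have "wedge scale i (\<lambda>U. D i (kd scale y w U)) U - wedge scale i (kd scale y (\<lambda>U. D i (w U))) U
        = scale (sg i U) (D i (kd scale y w V) - kd scale y (\<lambda>U. D i (w U)) V)"
      using True by (simp add: wedge_def V_def scale_right_diff_distrib)
    also have "D i (kd scale y w V) - kd scale y (\<lambda>U. D i (w U)) V = scale (sg i U) (w U - scale (y i) (D i (w U)))"
      unfolding 1 2 using V by (simp add: V_def scale_right_diff_distrib)
    finally have "wedge scale i (\<lambda>U. D i (kd scale y w U)) U - wedge scale i (kd scale y (\<lambda>U. D i (w U))) U
        = w U - scale (y i) (D i (w U))" by simp
    then show ?thesis using True by (simp add: kd_wedge algebra_simps)
  next
    case False
    then show ?thesis by (simp add: kd_wedge_notin) (simp add: wedge_def)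
  qed
  \<comment> \<open>The homotopies for the indices in \<open>A\<close> are applied one after the
    other: \<open>w\<close> is changed by boundaries until all components involving an index of
    \<open>A\<close> vanish.\<close>
  have "\<exists>u\<in>kchains UNIV (Suc q). \<exists>w'. w' \<in> kcycles scale y UNIV q \<and> (\<forall>U. w U = w' U + kd scale y u U) \<and> (\<forall>U. U \<inter> A \<noteq> {} \<longrightarrow> w' U = 0)"
    if "finite A" for A :: "'n set"
    using that
  proof (induction A)
    case empty
    show ?case using w by (intro bexI[of _ "\<lambda>_. 0"] exI[of _ w]) (auto simp: kchains_def)
  next
    case (insert i A)
    then obtain u w' where u: "u \<in> kchains UNIV (Suc q)" and w': "w' \<in> kcycles scale y UNIV q"
      "\<And>U. w U = w' U + kd scale y u U" "\<And>U. U \<inter> A \<noteq> {} \<Longrightarrow> w' U = 0" by blast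
    define h where "h = wedge scale i (\<lambda>U. D i (w' U))"
    define w'' where "w'' U = (if i \<in> U then 0 else w' U - scale (y i) (D i (w' U)))" for U
    have h: "h \<in> kchains UNIV (Suc q)"
    proof -
      have "h U = 0" if "card U \<noteq> Suc q" for U
      proof (cases "i \<in> U")
        case True
        then have "card (U - {i}) \<noteq> q" using that card_Suc_Diff1[of U i] by auto
        then have "w' (U - {i}) = 0" using w'(1) by (auto simp: kcycles_def kchains_def)
        then show ?thesis by (simp add: h_def wedge_def D.zero)
      qed (simp add: h_def wedge_def)
      then show ?thesis by (auto simp: kchains_def)
    qed
    have "(\<lambda>U. kd scale y w' U) = (\<lambda>U. 0)" using w'(1) by (auto simp: kcycles_def)
    then have eq: "w' U = w'' U + kd scale y h U" for U
      using hom[of i w' U] by (cases "i \<in> U") (simp_all add: h_def w''_def wedge_def D.zero)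
    have w'': "w'' U = w' U - kd scale y h U" for U using eq by simp
    have "w'' \<in> kchains UNIV q" using w'(1) by (auto simp: w''_def kcycles_def kchains_def D.zero)
    moreover have "kd scale y w'' U = 0" for U
    proof -
      have "kd scale y w'' U = kd scale y (\<lambda>U. w' U - kd scale y h U) U" using w'' by presburger
      also have "\<dots> = 0" using w'(1) by (simp add: kd_diff kd_kd kcycles_def)
      finally show ?thesis .
    qed
    ultimately have "w'' \<in> kcycles scale y UNIV q" by (simp add: kcycles_def)
    moreover have "(\<lambda>U. h U + u U) \<in> kchains UNIV (Suc q)" using h u by (auto simp: kchains_def)
    moreover have "w U = w'' U + kd scale y (\<lambda>U. h U + u U) U" for U
      using w'(2)[of U] eq[of U] by (simp add: kd_add algebra_simps)
    moreover have "w'' U = 0" if "U \<inter> insert i A \<noteq> {}" for U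
    proof (cases "i \<in> U")
      case False
      then have "w' U = 0" using that w'(3)[of U] by blast
      then show ?thesis by (simp add: w''_def D.zero)
    qed (simp add: w''_def)
    ultimately show ?case by blast
  qed
  from this[of UNIV] obtain u w' where u: "u \<in> kchains UNIV (Suc q)" "w' \<in> kcycles scale y UNIV q"
    "\<And>U. w U = w' U + kd scale y u U" "\<And>U. U \<noteq> {} \<Longrightarrow> w' U = 0" by auto
  \<comment> \<open>With \<open>A = UNIV\<close> only the component at the empty set could survive,
    and it has degree \<open>0 < q\<close>.\<close>
  have "w' U = 0" for U using u(2,4) q by (cases "U = {}") (auto simp: kcycles_def kchains_def)
  then have "w = kd scale y u" using u(3) by auto
  then show ?thesis using u(1) by (auto simp: kboundaries_def)
qed

end

abbreviation "keys \<equiv> Poly_Mapping.keys"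
abbreviation "lookup \<equiv> Poly_Mapping.lookup"

section \<open>The polynomial ring and free modules\<close>

lemma const_add: "const (a + b) = const a + const b" by (simp add: const_def single_add)
lemma const_mult: "const (a * b) = const a * const b" by (simp add: const_def mult_single)
lemma const_one [simp]: "const 1 = 1" by (simp add: const_def)
lemma const_zero [simp]: "const 0 = 0" by (simp add: const_def)
lemma lookup_const_zero [simp]: "lookup (const c) 0 = c" by (simp add: const_def)

lemma vector_space_kscale:
  assumes "module sm" shows "vector_space (kscale sm)"
proof -
  interpret module sm by fact
  show ?thesis
    by unfold_locales (simp_all add: kscale_def const_add const_mult scale_right_distrib scale_left_distrib)
qed

lemma poly_mapping_eq_sum_single: "v = (\<Sum>j\<in>keys v. Poly_Mapping.single j (lookup v j))"
proof (rule poly_mapping_eqI)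
  fix k
  have "(\<Sum>j\<in>keys v. lookup (Poly_Mapping.single j (lookup v j)) k) = (\<Sum>j\<in>keys v. if j = k then lookup v j else 0)"
    by (intro sum.cong) (auto simp: lookup_single when_def)
  also have "\<dots> = lookup v k" by (auto simp: in_keys_iff)
  finally show "lookup v k = lookup (\<Sum>j\<in>keys v. Poly_Mapping.single j (lookup v j)) k"
    by (simp add: lookup_sum)
qed

lemma lookup_single_mult:
  fixes f :: "('n \<Rightarrow>\<^sub>0 nat) \<Rightarrow>\<^sub>0 'k::comm_ring_1"
  shows "lookup (Poly_Mapping.single \<gamma> c * f) (\<gamma> + \<beta>) = c * lookup f \<beta>"
    and "(\<And>\<alpha>. \<beta> \<noteq> \<gamma> + \<alpha>) \<Longrightarrow> lookup (Poly_Mapping.single \<gamma> c * f) \<beta> = 0"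
proof -
  have "Poly_Mapping.single \<gamma> c * f = (\<Sum>\<alpha>\<in>keys f. Poly_Mapping.single (\<gamma> + \<alpha>) (c * lookup f \<alpha>))"
    by (subst (1) poly_mapping_eq_sum_single[of f]) (simp add: sum_distrib_left mult_single)
  then have *: "lookup (Poly_Mapping.single \<gamma> c * f) \<beta> = (\<Sum>\<alpha>\<in>keys f. c * lookup f \<alpha> when \<gamma> + \<alpha> = \<beta>)" for \<beta>
    by (simp add: lookup_sum lookup_single)
  have "(\<Sum>\<alpha>\<in>keys f. c * lookup f \<alpha> when \<gamma> + \<alpha> = \<gamma> + \<beta>) = (\<Sum>\<alpha>\<in>keys f. if \<alpha> = \<beta> then c * lookup f \<alpha> else 0)"
    by (intro sum.cong) (auto simp: when_def)
  also have "\<dots> = c * lookup f \<beta>" by (auto simp: in_keys_iff)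
  finally show "lookup (Poly_Mapping.single \<gamma> c * f) (\<gamma> + \<beta>) = c * lookup f \<beta>" by (simp add: *)
  show "lookup (Poly_Mapping.single \<gamma> c * f) \<beta> = 0" if "\<And>\<alpha>. \<beta> \<noteq> \<gamma> + \<alpha>"
    unfolding * using that by (intro sum.neutral) (metis when_simps(2))
qed

lemma lookup_free_scale [simp]: "lookup (free_scale a v) j = a * lookup v j"
  by (auto simp: free_scale_def Poly_Mapping.map.rep_eq when_def)

lemma module_free_scale: "module free_scale"
  by unfold_locales (auto intro!: poly_mapping_eqI simp: lookup_add algebra_simps)

interpretation free: module free_scale by (rule module_free_scale)

lemma free_scale_single [simp]: "free_scale a (Poly_Mapping.single j b) = Poly_Mapping.single j (a * b)"
  by (rule poly_mapping_eqI) (auto simp: lookup_single when_def)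

lemma module_mult: "module ((*) :: 'r::comm_ring_1 \<Rightarrow> 'r \<Rightarrow> 'r)"
  by unfold_locales (auto simp: algebra_simps)

section \<open>Maps out of free modules and multiples by the maximal graded ideal\<close>

definition lin_ext :: "('r::comm_ring_1 \<Rightarrow> 'm::ab_group_add \<Rightarrow> 'm) \<Rightarrow> ('b \<Rightarrow> 'm) \<Rightarrow> ('b \<Rightarrow>\<^sub>0 'r) \<Rightarrow> 'm" where
  "lin_ext sm g v = (\<Sum>j\<in>keys v. sm (lookup v j) (g j))"

context module
begin

lemma lin_ext_superset:
  assumes "finite A" "keys v \<subseteq> A"
  shows "lin_ext scale g v = (\<Sum>j\<in>A. scale (lookup v j) (g j))"
  unfolding lin_ext_def using assms by (intro sum.mono_neutral_left) (auto simp: in_keys_iff)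

lemma module_hom_lin_ext: "module_hom free_scale scale (lin_ext scale g)"
proof (rule module_hom.intro)
  show "module free_scale" by (rule module_free_scale)
  show "module scale" by unfold_locales
  show "module_hom_axioms free_scale scale (lin_ext scale g)"
  proof
    fix u v :: "'c \<Rightarrow>\<^sub>0 'a" and a
    let ?A = "keys u \<union> keys v"
    have "keys (u + v) \<subseteq> ?A" by (rule Poly_Mapping.keys_add)
    then show "lin_ext scale g (u + v) = lin_ext scale g u + lin_ext scale g v"
      by (simp add: lin_ext_superset[of ?A] lookup_add scale_left_distrib sum.distrib)
    have "keys (free_scale a v) \<subseteq> keys v" by (auto simp: in_keys_iff)
    then show "lin_ext scale g (free_scale a v) = scale a (lin_ext scale g v)"
      by (simp add: lin_ext_superset[of "keys v"] scale_sum_right)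
  qed
qed

lemma lin_ext_single [simp]: "lin_ext scale g (Poly_Mapping.single j a) = scale a (g j)"
  by (cases "a = 0") (auto simp: lin_ext_def)

lemma module_hom_free_eq:
  assumes "module_hom free_scale scale f"
  shows "f v = lin_ext scale (\<lambda>j. f (Poly_Mapping.single j 1)) v"
proof -
  interpret f: module_hom free_scale scale f by fact
  have "f v = (\<Sum>j\<in>keys v. f (Poly_Mapping.single j (lookup v j)))"
    by (subst poly_mapping_eq_sum_single) (rule f.sum)
  also have "\<dots> = (\<Sum>j\<in>keys v. f (free_scale (lookup v j) (Poly_Mapping.single j 1)))" by simp
  finally show ?thesis by (simp only: f.scale lin_ext_def)
qed

lemma range_lin_ext: "range (lin_ext scale g) = span (range g)"
proof -
  interpret f: module_hom free_scale scale "lin_ext scale g" by (rule module_hom_lin_ext)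
  show ?thesis
  proof
    show "range (lin_ext scale g) \<subseteq> span (range g)"
      unfolding lin_ext_def by (intro image_subsetI span_sum span_scale span_base) auto
    have "g j = lin_ext scale g (Poly_Mapping.single j 1)" for j by simp
    then have "range g \<subseteq> range (lin_ext scale g)" by blast
    then show "span (range g) \<subseteq> range (lin_ext scale g)"
      by (intro span_minimal f.subspace_image) auto
  qed
qed

end

text \<open>For a submodule \<open>N\<close> this is its product with the maximal graded ideal,
  since that ideal is generated by the variables.\<close>

definition mmul :: "(('n::finite, 'k::field) mpoly \<Rightarrow> 'm::ab_group_add \<Rightarrow> 'm) \<Rightarrow> 'm set \<Rightarrow> 'm set" where
  "mmul sm N = {\<Sum>i\<in>UNIV. sm (var i) (v i) | v. \<forall>i. v i \<in> N}"

lemma mmulI: "(\<And>i. v i \<in> N) \<Longrightarrow> (\<Sum>i\<in>UNIV. sm (var i) (v i)) \<in> mmul sm N"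
  unfolding mmul_def by blast

lemma mmul_subspace:
  assumes "module sm" "module.subspace sm N"
  shows "module.subspace sm (mmul sm N)"
proof -
  interpret module sm by fact
  note N = assms(2)
  show ?thesis
  proof (rule subspaceI)
    show "0 \<in> mmul sm N" unfolding mmul_def using subspace_0[OF N] by (intro CollectI exI[of _ "\<lambda>_. 0"]) auto
  next
    fix x y assume "x \<in> mmul sm N" "y \<in> mmul sm N"
    then obtain u v where "x = (\<Sum>i\<in>UNIV. sm (var i) (u i))" "y = (\<Sum>i\<in>UNIV. sm (var i) (v i))" "\<And>i. u i \<in> N" "\<And>i. v i \<in> N"
      unfolding mmul_def by blast
    then show "x + y \<in> mmul sm N" unfolding mmul_def
      by (intro CollectI exI[of _ "\<lambda>i. u i + v i"]) (auto simp: scale_right_distrib sum.distrib subspace_add[OF N])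
  next
    fix c x assume "x \<in> mmul sm N"
    then obtain u where "x = (\<Sum>i\<in>UNIV. sm (var i) (u i))" "\<And>i. u i \<in> N"
      unfolding mmul_def by blast
    then show "sm c x \<in> mmul sm N" unfolding mmul_def
      by (intro CollectI exI[of _ "\<lambda>i. sm c (u i)"]) (auto simp: scale_sum_right mult.commute subspace_scale[OF N])
  qed
qed

text \<open>Every monomial other than 1 has a variable as a factor.\<close>

lemma lookup_zero_in_mmul:
  fixes f :: "('n::finite, 'k::field) mpoly"
  assumes "lookup f 0 = 0"
  shows "f \<in> mmul (*) UNIV"
proof -
  interpret m: module "(*) :: ('n, 'k) mpoly \<Rightarrow> _" by (rule module_mult)
  have sub: "m.subspace (mmul (*) UNIV :: ('n, 'k) mpoly set)" by (rule mmul_subspace) (auto simp: module_mult)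
  have "Poly_Mapping.single \<alpha> (lookup f \<alpha>) \<in> mmul (*) UNIV" if "\<alpha> \<in> keys f" for \<alpha>
  proof -
    have "\<alpha> \<noteq> 0" using that assms by (auto simp: in_keys_iff)
    then obtain i where i: "lookup \<alpha> i \<noteq> 0" by (metis poly_mapping_eqI lookup_zero)
    define \<beta> where "\<beta> = \<alpha> - Poly_Mapping.single i 1"
    have "\<alpha> = Poly_Mapping.single i 1 + \<beta>"
      by (rule poly_mapping_eqI) (use i in \<open>auto simp: \<beta>_def lookup_add lookup_minus lookup_single when_def\<close>)
    then have "Poly_Mapping.single \<alpha> (lookup f \<alpha>) = var i * Poly_Mapping.single \<beta> (lookup f \<alpha>)"
      by (simp add: var_def mult_single)
    also have "\<dots> = (\<Sum>j\<in>UNIV. var j * (if j = i then Poly_Mapping.single \<beta> (lookup f \<alpha>) else 0))"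
      by (subst sum.mono_neutral_right[of _ "{i}"]) auto
    also have "\<dots> \<in> mmul (*) UNIV" by (rule mmulI) simp
    finally show ?thesis .
  qed
  then have "(\<Sum>\<alpha>\<in>keys f. Poly_Mapping.single \<alpha> (lookup f \<alpha>)) \<in> mmul (*) UNIV"
    by (rule m.subspace_sum[OF sub])
  then show ?thesis using poly_mapping_eq_sum_single[of f] by simp
qed

lemma mmul_scale:
  assumes "module sm" "module.subspace sm N" "lookup f 0 = 0" "v \<in> N"
  shows "sm f v \<in> mmul sm N"
proof -
  interpret module sm by fact
  obtain g where "f = (\<Sum>i\<in>UNIV. var i * g i)" using lookup_zero_in_mmul[OF assms(3)] unfolding mmul_def by blast
  then have "sm f v = (\<Sum>i\<in>UNIV. sm (var i) (sm (g i) v))" by (simp add: scale_sum_left)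
  also have "\<dots> \<in> mmul sm N" by (rule mmulI) (rule subspace_scale[OF assms(2,4)])
  finally show ?thesis .
qed

text \<open>The quotient on division by \<open>var i\<close>; monomials free of that variable are
  dropped. It is linear over the other variables but not over \<open>var i\<close>, which fits the
  operators \<open>D i\<close> of \<open>koszul_acyclic\<close>.\<close>

definition pdiv :: "'n \<Rightarrow> ('n::finite, 'k::field) mpoly \<Rightarrow> ('n, 'k) mpoly" where
  "pdiv i f = Poly_Mapping.map_key (\<lambda>\<alpha>. Poly_Mapping.single i 1 + \<alpha>) f"

lemma lookup_pdiv: "lookup (pdiv i f) \<alpha> = lookup f (Poly_Mapping.single i 1 + \<alpha>)"
  unfolding pdiv_def by (subst map_key.rep_eq) (auto intro: injI)

lemma pdiv_add: "pdiv i (f + g) = pdiv i f + pdiv i g"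
  by (rule poly_mapping_eqI) (simp add: lookup_pdiv lookup_add)

lemma pdiv_zero [simp]: "pdiv i 0 = 0"
  by (rule poly_mapping_eqI) (simp add: lookup_pdiv)

lemma pdiv_same: "pdiv i (var i * f) = f"
  by (rule poly_mapping_eqI) (simp add: lookup_pdiv var_def lookup_single_mult)

lemma pdiv_other:
  assumes "i \<noteq> j" shows "pdiv i (var j * f) = var j * pdiv i f"
proof (rule poly_mapping_eqI)
  fix \<alpha>
  let ?i = "Poly_Mapping.single i (1::nat)" and ?j = "Poly_Mapping.single j (1::nat)"
  show "lookup (pdiv i (var j * f)) \<alpha> = lookup (var j * pdiv i f) \<alpha>"
  proof (cases "\<exists>\<beta>. \<alpha> = ?j + \<beta>")
    case True
    then obtain \<beta> where b: "\<alpha> = ?j + \<beta>" by blast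
    have e: "?i + \<alpha> = ?j + (?i + \<beta>)" by (simp add: b add_ac)
    have "lookup (var j * f) (?i + \<alpha>) = lookup f (?i + \<beta>)"
      unfolding e var_def lookup_single_mult(1) by simp
    then show ?thesis by (simp add: lookup_pdiv) (simp add: b var_def lookup_single_mult(1) lookup_pdiv)
  next
    case False
    \<comment> \<open>Divisibility by the variable \<open>j\<close> is not affected by a factor in
      the other variable \<open>i\<close>.\<close>
    have "?i + \<alpha> \<noteq> ?j + \<beta>" for \<beta>
    proof
      assume e: "?i + \<alpha> = ?j + \<beta>"
      have "lookup \<alpha> j = lookup (?i + \<alpha>) j" using assms by (simp add: lookup_add lookup_single)
      also have "\<dots> = 1 + lookup \<beta> j" unfolding e by (simp add: lookup_add)
      finally have "\<alpha> = ?j + (\<alpha> - ?j)"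
        by (intro poly_mapping_eqI) (auto simp: lookup_add lookup_minus lookup_single when_def)
      then show False using False by blast
    qed
    then show ?thesis using False by (simp add: lookup_pdiv) (simp add: var_def lookup_single_mult(2))
  qed
qed

lemma lookup_map_pdiv: "lookup (Poly_Mapping.map (pdiv i) v) j = pdiv i (lookup v j)"
  by (auto simp: Poly_Mapping.map.rep_eq when_def)

text \<open>The operators \<open>pdiv i\<close> act on every coordinate of the free module.\<close>

lemma free_koszul_acyclic:
  assumes "w \<in> kcycles free_scale var UNIV q" "q > 0"
  shows "w \<in> kboundaries (free_scale :: ('n::{finite,linorder}, 'k::field) mpoly \<Rightarrow> (nat \<Rightarrow>\<^sub>0 _) \<Rightarrow> _) var UNIV q"
  by (rule free.koszul_acyclic[where D = "\<lambda>i. Poly_Mapping.map (pdiv i)"])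
    (use assms in \<open>auto intro!: poly_mapping_eqI simp: lookup_map_pdiv lookup_add pdiv_add pdiv_same pdiv_other\<close>)

section \<open>Existence of free resolutions\<close>

text \<open>An independent set meets the span of finitely many vectors in a finite set, and
  countably many such spans exhaust the space.\<close>

lemma (in vector_space) countable_spanning_subspace:
  assumes T: "countable T" "span T = UNIV" and K: "subspace K"
  shows "\<exists>B. countable B \<and> B \<subseteq> K \<and> span B = K"
proof -
  obtain B where B: "B \<subseteq> K" "independent B" "K \<subseteq> span B" using maximal_independent_subset by blast
  have "countable B"
  proof (cases "T = {}")
    case True
    then have "UNIV = {0::'b}" using T by simp
    then have "B \<subseteq> {0}" by auto
    then show ?thesis using countable_subset by blast
  next
    case False
    then obtain t :: "nat \<Rightarrow> 'b" where t: "range t = T" using T(1) by (metis range_from_nat_into)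
    have "B \<subseteq> (\<Union>m. B \<inter> span (t ` {..<m}))"
    proof
      fix x assume x: "x \<in> B"
      have "x \<in> span (range t)" using T(2) t by simp
      then obtain F where F: "finite F" "F \<subseteq> range t" "x \<in> span F"
        unfolding span_explicit by (blast intro: span_sum span_scale span_base)
      obtain A where A: "finite A" "F = t ` A" using finite_subset_image[OF F(1,2)] by blast
      then have "A \<subseteq> {..<Suc (Max A)}" by (auto simp: less_Suc_eq_le)
      then have "span F \<subseteq> span (t ` {..<Suc (Max A)})" using A by (intro span_mono) auto
      then show "x \<in> (\<Union>m. B \<inter> span (t ` {..<m}))" using x F(3) by blast
    qed
    moreover have "finite (B \<inter> span (t ` {..<m}))" for m
      using independent_span_bound[of "t ` {..<m}" "B \<inter> span (t ` {..<m})"] independent_mono[OF B(2)] by auto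
    ultimately show ?thesis by (meson countable_UN countable_finite countable_subset countableI_type)
  qed
  moreover have "span B = K" using B span_minimal[OF B(1) K] by auto
  ultimately show ?thesis using B by blast
qed

lemma module_subspace_kscale:
  assumes "module sm" "module.subspace sm N"
  shows "module.subspace (kscale sm) N"
proof -
  interpret module sm by fact
  interpret v: vector_space "kscale sm" by (rule vector_space_kscale[OF assms(1)])
  show ?thesis using assms(2) by (intro v.subspaceI) (auto simp: kscale_def subspace_0 subspace_add subspace_scale)
qed

text \<open>An exponent vector is determined by its graph, a finite subset of a countable set of
  pairs.\<close>

lemma countable_monomials: "countable (UNIV :: ('n::finite \<Rightarrow>\<^sub>0 nat) set)"
proof -
  let ?graph = "\<lambda>\<alpha> :: 'n \<Rightarrow>\<^sub>0 nat. (\<lambda>i. (i, lookup \<alpha> i)) ` UNIV"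
  have "countable (range ?graph)"
    by (rule countable_subset[OF _ countable_Collect_finite]) auto
  moreover have "inj ?graph"
  proof (rule injI)
    fix \<alpha> \<beta> assume "?graph \<alpha> = ?graph \<beta>"
    then have "(i, lookup \<alpha> i) \<in> ?graph \<beta>" for i by blast
    then show "\<alpha> = \<beta>" by (intro poly_mapping_eqI) auto
  qed
  ultimately show ?thesis by (rule countable_image_inj_on)
qed

lemma mpoly_span_monomials:
  fixes f :: "('n::finite, 'k::field) mpoly"
  shows "f = (\<Sum>\<alpha>\<in>keys f. const (lookup f \<alpha>) * Poly_Mapping.single \<alpha> 1)"
  by (subst (1) poly_mapping_eq_sum_single) (simp add: const_def mult_single)

text \<open>Over \<open>k\<close> the free module has a countable basis of monomials times basis
  vectors. So the kernel, as a subspace, is spanned by countably many elements and is an image of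
  the same free module.\<close>

lemma kernel_is_range:
  fixes f :: "(nat \<Rightarrow>\<^sub>0 ('n::finite, 'k::field) mpoly) \<Rightarrow> 'm::ab_group_add"
  assumes f: "module_hom free_scale sm f"
  shows "\<exists>d :: (nat \<Rightarrow>\<^sub>0 ('n, 'k) mpoly) \<Rightarrow> _. module_hom free_scale free_scale d \<and> range d = {v. f v = 0}"
proof -
  interpret f: module_hom free_scale sm f by fact
  interpret v: vector_space "kscale (free_scale :: ('n, 'k) mpoly \<Rightarrow> (nat \<Rightarrow>\<^sub>0 _) \<Rightarrow> _)"
    by (rule vector_space_kscale) (rule module_free_scale)
  let ?K = "{v. f v = 0}"
  define T where "T = range (\<lambda>(j, \<alpha>). Poly_Mapping.single j (Poly_Mapping.single \<alpha> 1) :: nat \<Rightarrow>\<^sub>0 ('n, 'k) mpoly)"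
  have "countable T"
  proof -
    have "countable ((UNIV :: nat set) \<times> (UNIV :: ('n \<Rightarrow>\<^sub>0 nat) set))"
      by (intro countable_SIGMA countable_monomials) simp
    then show ?thesis unfolding T_def by (intro countable_image) simp
  qed
  moreover have "v \<in> v.span T" for v
  proof -
    have "Poly_Mapping.single j (lookup v j) \<in> v.span T" for j
    proof -
      have "Poly_Mapping.single j (lookup v j) = (\<Sum>\<alpha>\<in>keys (lookup v j). kscale free_scale (lookup (lookup v j) \<alpha>) (Poly_Mapping.single j (Poly_Mapping.single \<alpha> 1)))"
        by (rule poly_mapping_eqI)
          (auto simp: lookup_sum lookup_single when_def kscale_def mpoly_span_monomials[symmetric] sum.neutral)
      also have "\<dots> \<in> v.span T" by (intro v.span_sum v.span_scale v.span_base) (auto simp: T_def)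
      finally show ?thesis .
    qed
    then have "(\<Sum>j\<in>keys v. Poly_Mapping.single j (lookup v j)) \<in> v.span T" by (intro v.span_sum)
    then show ?thesis using poly_mapping_eq_sum_single[of v] by simp
  qed
  moreover have "v.subspace ?K"
    by (rule v.subspaceI) (auto simp: f.add f.scale kscale_def)
  ultimately obtain B where B: "countable B" "B \<subseteq> ?K" "v.span B = ?K"
    using v.countable_spanning_subspace[of T ?K] by blast
  \<comment> \<open>Adding \<open>0\<close> makes the set nonempty, so that it can be enumerated by
    all natural numbers.\<close>
  have "countable (insert 0 B)" using B by simp
  then obtain g :: "nat \<Rightarrow> _" where g: "range g = insert 0 B" using range_from_nat_into by (metis insert_not_empty)
  have sub: "free.subspace ?K" by (rule f.subspace_kernel)
  have "free.span (insert 0 B) = ?K"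
  proof
    show "free.span (insert 0 B) \<subseteq> ?K" by (rule free.span_minimal) (use B sub in auto)
    have "v.span B \<subseteq> free.span (insert 0 B)"
      by (intro v.span_minimal module_subspace_kscale module_free_scale free.subspace_span)
        (auto intro: free.span_base)
    then show "?K \<subseteq> free.span (insert 0 B)" using B by simp
  qed
  then have "range (lin_ext free_scale g) = ?K" using free.range_lin_ext g by metis
  then show ?thesis using free.module_hom_lin_ext by blast
qed

text \<open>\<open>tor_dim\<close> takes its resolution from a Hilbert choice, which is meaningful
  only if one exists.\<close>

lemma free_resolution_exists:
  fixes sm :: "('n::finite, 'k::field) mpoly \<Rightarrow> 'm::ab_group_add \<Rightarrow> 'm"
  assumes "module sm" "finitely_generated sm"
  shows "\<exists>d \<epsilon>. free_resolution sm d \<epsilon>"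
proof -
  interpret module sm by fact
  obtain B where B: "finite B" "span B = UNIV" using assms(2) unfolding finitely_generated_def by blast
  have "countable (insert 0 B)" using B by (simp add: countable_finite)
  then obtain g :: "nat \<Rightarrow> _" where g: "range g = insert 0 B" using range_from_nat_into by (metis insert_not_empty)
  define \<epsilon> where "\<epsilon> = lin_ext sm g"
  have "span B \<subseteq> span (insert 0 B)" by (rule span_mono) auto
  then have surj: "range \<epsilon> = UNIV" using B range_lin_ext[of g] g by (auto simp: \<epsilon>_def)
  have eps: "module_hom free_scale sm \<epsilon>" unfolding \<epsilon>_def by (rule module_hom_lin_ext)
  obtain d0 :: "(nat \<Rightarrow>\<^sub>0 ('n, 'k) mpoly) \<Rightarrow> (nat \<Rightarrow>\<^sub>0 ('n, 'k) mpoly)"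
    where d0: "module_hom free_scale free_scale d0" "range d0 = {v. \<epsilon> v = 0}"
    using kernel_is_range[OF eps] by blast
  \<comment> \<open>Exactness at the augmentation is built into the predicate for index 0; every
    later map of the dependent choice is tied to its predecessor.\<close>
  define P where "P i d \<longleftrightarrow> module_hom free_scale free_scale d \<and> (i = 0 \<longrightarrow> range d = {v. \<epsilon> v = 0})" for i :: nat and d :: "(nat \<Rightarrow>\<^sub>0 ('n, 'k) mpoly) \<Rightarrow> (nat \<Rightarrow>\<^sub>0 ('n, 'k) mpoly)"
  have "\<exists>f. \<forall>i. P i (f i) \<and> range (f (Suc i)) = {v. f i v = 0}"
  proof (rule dependent_nat_choice)
    show "\<exists>x. P 0 x" using d0 by (auto simp: P_def)
    fix x i assume "P i x"
    then show "\<exists>y. P (Suc i) y \<and> range y = {v. x v = 0}"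
      using kernel_is_range[of free_scale x] by (auto simp: P_def)
  qed
  then obtain d where d: "\<And>i. P i (d i)" "\<And>i. range (d (Suc i)) = {v. d i v = 0}" by blast
  have "free_resolution sm d \<epsilon>" unfolding free_resolution_def using d eps surj by (auto simp: P_def)
  then show ?thesis by blast
qed

section \<open>Tor by Koszul homology\<close>

definition fscale :: "('k \<Rightarrow> 'm \<Rightarrow> 'm) \<Rightarrow> 'k \<Rightarrow> ('u \<Rightarrow> 'm) \<Rightarrow> 'u \<Rightarrow> 'm" where
  "fscale s c w = (\<lambda>U. s c (w U))"

lemma fscale_apply [simp]: "fscale s c w U = s c (w U)" by (simp add: fscale_def)

lemma vector_space_fscale: "vector_space s \<Longrightarrow> vector_space (fscale s)"
  by (auto simp: vector_space_def fscale_def fun_eq_iff)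

lemma subspace_kchains:
  assumes "vector_space s" "module.subspace s N"
  shows "module.subspace (fscale s) (kchains N q)"
proof -
  interpret v: vector_space s by fact
  interpret f: vector_space "fscale s" by (rule vector_space_fscale[OF assms(1)])
  show ?thesis using assms(2)
    by (intro f.subspaceI) (auto simp: kchains_def v.subspace_0 v.subspace_add v.subspace_scale)
qed

lemma subspace_kcycles:
  assumes "module sm" "module.subspace (kscale sm) N"
  shows "module.subspace (fscale (kscale sm)) (kcycles sm y N q)"
proof -
  interpret module sm by fact
  interpret f: vector_space "fscale (kscale sm)" by (rule vector_space_fscale[OF vector_space_kscale[OF assms(1)]])
  note c = subspace_kchains[OF vector_space_kscale[OF assms(1)] assms(2)]
  have 0: "kd sm y 0 U = 0" for U using kd_zero[of y U] by (simp add: zero_fun_def)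
  have a: "kd sm y (u + w) U = kd sm y u U + kd sm y w U" for u w U
    using kd_add[of y u w U] by (simp add: plus_fun_def)
  have s: "kd sm y (fscale (kscale sm) b w) U = sm (const b) (kd sm y w U)" for b w U
    using kd_scale[of y "const b" w U] by (simp add: fscale_def kscale_def)
  show ?thesis using f.subspace_0[OF c] f.subspace_add[OF c] f.subspace_scale[OF c]
    by (intro f.subspaceI) (auto simp: kcycles_def 0 a s)
qed

lemma kboundariesI: "u \<in> kchains N (Suc q) \<Longrightarrow> (\<And>U. z U = kd sm y u U) \<Longrightarrow> z \<in> kboundaries sm y N q"
  unfolding kboundaries_def by auto

lemma kd_hom:
  assumes "module_hom s1 s2 f"
  shows "f (kd s1 y w U) = kd s2 y (\<lambda>U. f (w U)) U"
proof -
  interpret module_hom s1 s2 f by fact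
  show ?thesis by (simp add: kd_def sum scale)
qed

text \<open>The connecting isomorphism of the exact sequence \<open>0 \<rightarrow> ker \<pi> \<rightarrow> F \<rightarrow> N \<rightarrow> 0\<close> with \<open>F\<close> free.\<close>

lemma koszul_syzygy_shift:
  fixes \<pi> :: "(nat \<Rightarrow>\<^sub>0 ('n::{finite,linorder}, 'k::field) mpoly) \<Rightarrow> 'm::ab_group_add"
  assumes hom: "module_hom free_scale sm \<pi>"
    and n: "qdim (fscale (kscale sm)) (kcycles sm var (range \<pi>) (Suc q)) (kboundaries sm var (range \<pi>) (Suc q)) n"
  shows "qdim (fscale (kscale free_scale)) (kchains {v. \<pi> v = 0} q \<inter> kboundaries free_scale var UNIV q)
           (kboundaries free_scale var {v. \<pi> v = 0} q) n"
proof -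
  interpret p: module_hom free_scale sm \<pi> by fact
  let ?F = "fscale (kscale (free_scale :: ('n, 'k) mpoly \<Rightarrow> (nat \<Rightarrow>\<^sub>0 _) \<Rightarrow> _))"
  let ?N = "{v. \<pi> v = 0}"
  interpret F: vector_space ?F by (rule vector_space_fscale[OF vector_space_kscale[OF module_free_scale]])
  have mod: "module sm" by unfold_locales
  note pk = kd_hom[OF hom, of var]
  have subN: "free.subspace ?N" by (rule p.subspace_kernel)
  have subR: "p.m2.subspace (range \<pi>)" by (rule p.subspace_image) simp
  \<comment> \<open>The connecting relation: lift \<open>z\<close> to the free module and take the
    boundary. Its values have coefficients in the kernel of \<open>\<pi>\<close> and bound in the
    free module. In degree \<open>q > 0\<close> these are all cycles over the kernel; for
    \<open>q = 0\<close> they are the elements of the kernel that are multiples by the maximal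
    ideal.\<close>
  define \<rho> where "\<rho> z' z \<longleftrightarrow> (\<exists>y\<in>kchains UNIV (Suc q). (\<forall>U. \<pi> (y U) = z U) \<and> z' = kd free_scale var y)"
    for z' :: "'n set \<Rightarrow> (nat \<Rightarrow>\<^sub>0 ('n, 'k) mpoly)" and z :: "'n set \<Rightarrow> 'm"
  have lift: "\<exists>u\<in>kchains UNIV m. \<forall>U. \<pi> (u U) = z U" if "z \<in> kchains (range \<pi>) m" for z :: "'n set \<Rightarrow> 'm" and m
  proof -
    \<comment> \<open>Where the degree forces the value 0, the lift is chosen to be 0 as
      well.\<close>
    have "\<forall>U. \<exists>x. \<pi> x = z U \<and> (card U \<noteq> m \<longrightarrow> x = 0)"
    proof
      fix U show "\<exists>x. \<pi> x = z U \<and> (card U \<noteq> m \<longrightarrow> x = 0)"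
      proof (cases "card U = m")
        case True
        moreover have "z U \<in> range \<pi>" using that by (simp add: kchains_def)
        ultimately show ?thesis by auto
      next
        case False
        then have "z U = 0" using that by (simp add: kchains_def)
        then show ?thesis using p.zero by (intro exI[of _ 0]) simp
      qed
    qed
    then obtain u where "\<And>U. \<pi> (u U) = z U" "\<And>U. card U \<noteq> m \<Longrightarrow> u U = 0" by metis
    then show ?thesis by (intro bexI[of _ u]) (auto simp: kchains_def)
  qed
  have Z: "F.subspace (kchains ?N q \<inter> kboundaries free_scale var UNIV q)"
  proof (intro F.subspace_inter)
    show "F.subspace (kchains ?N q)"
      by (intro subspace_kchains vector_space_kscale module_free_scale module_subspace_kscale subN)
    show "F.subspace (kboundaries free_scale var UNIV q)"
    proof (rule F.subspaceI)
      show "0 \<in> kboundaries free_scale var UNIV q"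
        unfolding kboundaries_def by (intro CollectI exI[of _ "\<lambda>_. 0"]) (auto simp: kchains_def fun_eq_iff)
    next
      fix x y :: "'n set \<Rightarrow> (nat \<Rightarrow>\<^sub>0 ('n, 'k) mpoly)" assume "x \<in> kboundaries free_scale var UNIV q" "y \<in> kboundaries free_scale var UNIV q"
      then obtain u v where "x = kd free_scale var u" "y = kd free_scale var v" "u \<in> kchains UNIV (Suc q)" "v \<in> kchains UNIV (Suc q)"
        unfolding kboundaries_def by blast
      then show "x + y \<in> kboundaries free_scale var UNIV q"
        unfolding kboundaries_def by (intro CollectI exI[of _ "\<lambda>U. u U + v U"]) (auto simp: kchains_def fun_eq_iff free.kd_add)
    next
      fix c and x :: "'n set \<Rightarrow> (nat \<Rightarrow>\<^sub>0 ('n, 'k) mpoly)" assume "x \<in> kboundaries free_scale var UNIV q"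
      then obtain u where "x = kd free_scale var u" "u \<in> kchains UNIV (Suc q)"
        unfolding kboundaries_def by blast
      then show "?F c x \<in> kboundaries free_scale var UNIV q"
        unfolding kboundaries_def by (intro CollectI exI[of _ "\<lambda>U. free_scale (const c) (u U)"]) (auto simp: kchains_def fun_eq_iff free.kd_scale kscale_def)
    qed
  qed
  show ?thesis
  proof (rule qdim_transfer[where \<rho> = \<rho>, OF _ _ _ _ _ Z _ _ _ _ n])
    show "vector_space ?F" by unfold_locales
    show "vector_space (fscale (kscale sm))" by (rule vector_space_fscale[OF vector_space_kscale[OF mod]])
    show "\<rho> 0 0" unfolding \<rho>_def by (intro bexI[of _ "\<lambda>_. 0"]) (auto simp: kchains_def fun_eq_iff)
    show "module.subspace (fscale (kscale sm)) (kcycles sm var (range \<pi>) (Suc q))"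
      by (intro subspace_kcycles mod module_subspace_kscale subR)
  next
    fix x x' y y' assume "\<rho> x x'" "\<rho> y y'"
    then obtain u v where "u \<in> kchains UNIV (Suc q)" "v \<in> kchains UNIV (Suc q)"
      "\<forall>U. \<pi> (u U) = x' U" "\<forall>U. \<pi> (v U) = y' U" "x = kd free_scale var u" "y = kd free_scale var v"
      unfolding \<rho>_def by blast
    then show "\<rho> (x + y) (x' + y')" unfolding \<rho>_def
      by (intro bexI[of _ "\<lambda>U. u U + v U"]) (auto simp: kchains_def fun_eq_iff free.kd_add p.add)
  next
    fix c x x' assume "\<rho> x x'"
    then obtain u where "u \<in> kchains UNIV (Suc q)" "\<forall>U. \<pi> (u U) = x' U" "x = kd free_scale var u"
      unfolding \<rho>_def by blast
    then show "\<rho> (?F c x) (fscale (kscale sm) c x')" unfolding \<rho>_def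
      by (intro bexI[of _ "\<lambda>U. free_scale (const c) (u U)"]) (auto simp: kchains_def fun_eq_iff free.kd_scale p.scale kscale_def)
  next
    fix z' assume z': "z' \<in> kchains ?N q \<inter> kboundaries free_scale var UNIV q"
    then obtain y where y: "y \<in> kchains UNIV (Suc q)" "z' = kd free_scale var y" unfolding kboundaries_def by blast
    have "(\<lambda>U. \<pi> (y U)) \<in> kcycles sm var (range \<pi>) (Suc q)"
      using y z' by (auto simp: kcycles_def kchains_def pk[symmetric])
    then show "\<exists>z\<in>kcycles sm var (range \<pi>) (Suc q). \<rho> z' z"
      using y unfolding \<rho>_def by (intro bexI[of _ "\<lambda>U. \<pi> (y U)"] bexI[of _ y]) auto
  next
    fix z assume z: "z \<in> kcycles sm var (range \<pi>) (Suc q)"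
    then obtain y where y: "y \<in> kchains UNIV (Suc q)" "\<And>U. \<pi> (y U) = z U" using lift unfolding kcycles_def by blast
    have "\<pi> (kd free_scale var y U) = 0" for U using z by (simp add: pk y kcycles_def)
    moreover have "kd free_scale var y \<in> kchains UNIV q" by (rule free.kd_kchains[OF _ y(1)]) simp
    ultimately have "kd free_scale var y \<in> kchains ?N q \<inter> kboundaries free_scale var UNIV q"
      using y by (auto simp: kchains_def kboundaries_def)
    then show "\<exists>z'\<in>kchains ?N q \<inter> kboundaries free_scale var UNIV q. \<rho> z' z" using y unfolding \<rho>_def by blast
  next
    fix z' z assume z': "z' \<in> kchains ?N q \<inter> kboundaries free_scale var UNIV q"
      and z: "z \<in> kcycles sm var (range \<pi>) (Suc q)" and "\<rho> z' z"
    then obtain y where y: "y \<in> kchains UNIV (Suc q)" "\<And>U. \<pi> (y U) = z U" "z' = kd free_scale var y" unfolding \<rho>_def by blast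
    show "z' \<in> kboundaries free_scale var ?N q \<longleftrightarrow> z \<in> kboundaries sm var (range \<pi>) (Suc q)"
    proof
      assume "z' \<in> kboundaries free_scale var ?N q"
      then obtain v where v: "v \<in> kchains ?N (Suc q)" "z' = kd free_scale var v" unfolding kboundaries_def by blast
      \<comment> \<open>\<open>y - v\<close> is a cycle over the free module, hence a boundary;
        applying \<open>\<pi>\<close>, which kills \<open>v\<close>, exhibits \<open>z\<close> as a
        boundary.\<close>
      have "(\<lambda>U. y U - v U) \<in> kcycles free_scale var UNIV (Suc q)"
        using y v unfolding kcycles_def kchains_def by (auto simp: free.kd_diff fun_eq_iff)
      then obtain u where u: "u \<in> kchains UNIV (Suc (Suc q))" "(\<lambda>U. y U - v U) = kd free_scale var u"
        using free_koszul_acyclic[of _ "Suc q"] unfolding kboundaries_def by blast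
      have "z U = kd sm var (\<lambda>U. \<pi> (u U)) U" for U
      proof -
        have "kd sm var (\<lambda>U. \<pi> (u U)) U = \<pi> (y U - v U)" by (metis pk u(2))
        also have "\<dots> = z U" using v(1) y by (simp add: p.diff kchains_def)
        finally show ?thesis by simp
      qed
      moreover have "(\<lambda>U. \<pi> (u U)) \<in> kchains (range \<pi>) (Suc (Suc q))" using u by (auto simp: kchains_def)
      ultimately show "z \<in> kboundaries sm var (range \<pi>) (Suc q)" by (intro kboundariesI)
    next
      assume "z \<in> kboundaries sm var (range \<pi>) (Suc q)"
      then obtain u where u: "u \<in> kchains (range \<pi>) (Suc (Suc q))" "z = kd sm var u" unfolding kboundaries_def by blast
      obtain u' where u': "u' \<in> kchains UNIV (Suc (Suc q))" "\<And>U. \<pi> (u' U) = u U" using lift[OF u(1)] by blast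
      \<comment> \<open>Subtracting the boundary of a lift of \<open>u\<close> moves
        \<open>y\<close> into the kernel of \<open>\<pi>\<close> without changing its own boundary
        \<open>z'\<close>.\<close>
      define v where "v U = y U - kd free_scale var u' U" for U
      have "kd free_scale var u' \<in> kchains UNIV (Suc q)" by (rule free.kd_kchains[OF _ u'(1)]) simp
      moreover have "\<pi> (v U) = 0" for U unfolding v_def p.diff pk u'(2) y(2) u(2) by simp
      ultimately have "v \<in> kchains ?N (Suc q)" using y(1) by (auto simp: kchains_def v_def)
      moreover have "kd free_scale var v U = z' U" for U
        unfolding v_def free.kd_diff y(3) free.kd_kd by simp
      ultimately show "z' \<in> kboundaries free_scale var ?N q" by (intro kboundariesI[of v]) simp_all
    qed
  qed
qed

section \<open>Tensoring with the residue field\<close>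

definition theta :: "((nat \<Rightarrow>\<^sub>0 ('n::finite, 'k::field) mpoly) \<times> 'k \<Rightarrow>\<^sub>0 ('n, 'k) mpoly) \<Rightarrow> (nat \<Rightarrow>\<^sub>0 ('n, 'k) mpoly)" where
  "theta = lin_ext free_scale (\<lambda>(x, y). free_scale (const y) x)"

interpretation theta: module_hom free_scale free_scale theta
  unfolding theta_def by (rule free.module_hom_lin_ext)

lemma theta_single [simp]: "theta (Poly_Mapping.single (x, y) a) = free_scale (a * const y) x"
  by (simp add: theta_def)

lemma tensor_map_eq: "tensor_map f = lin_ext free_scale (\<lambda>(x, y). Poly_Mapping.single (f x, y) 1)"
  by (auto simp: tensor_map_def lin_ext_def fun_eq_iff intro!: sum.cong)

lemma module_hom_tensor_map: "module_hom free_scale free_scale (tensor_map f)"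
  unfolding tensor_map_eq by (rule free.module_hom_lin_ext)

lemma theta_tensor_map:
  assumes "module_hom free_scale free_scale f"
  shows "theta (tensor_map f z) = f (theta z)"
proof -
  interpret f: module_hom free_scale free_scale f by fact
  have 1: "module_hom free_scale free_scale (theta \<circ> tensor_map f)"
    by (rule module_hom_compose[OF module_hom_tensor_map theta.module_hom_axioms])
  have 2: "module_hom free_scale free_scale (f \<circ> theta)"
    by (rule module_hom_compose[OF theta.module_hom_axioms assms])
  have "(theta \<circ> tensor_map f) (Poly_Mapping.single p 1) = (f \<circ> theta) (Poly_Mapping.single p 1)" for p
    by (cases p) (simp add: tensor_map_eq f.scale)
  then have "(theta \<circ> tensor_map f) z = (f \<circ> theta) z"
    using free.module_hom_free_eq[OF 1, of z] free.module_hom_free_eq[OF 2, of z] by presburger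
  then show ?thesis by simp
qed

lemma mmul_free_subspace: "free.subspace (mmul free_scale UNIV)"
  by (rule mmul_subspace) (auto simp: module_free_scale)

text \<open>\<open>theta\<close> induces the isomorphism \<open>F \<otimes> k \<cong> F / \<mm>F\<close>: modulo the relations, every \<open>z\<close>
  equals \<open>theta z \<otimes> 1\<close>.\<close>

lemma tensor_relations_iff:
  fixes z :: "(nat \<Rightarrow>\<^sub>0 ('n::finite, 'k::field) mpoly) \<times> 'k \<Rightarrow>\<^sub>0 ('n, 'k) mpoly"
  shows "z \<in> tensor_relations free_scale residue_scale \<longleftrightarrow> theta z \<in> mmul free_scale UNIV"
proof
  define e where "e = (\<lambda>(x :: nat \<Rightarrow>\<^sub>0 ('n, 'k) mpoly) (y::'k). Poly_Mapping.single (x, y) (1 :: ('n, 'k) mpoly))"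
  define gens where "gens = {e (x + x') y - e x y - e x' y | x x' y. True}
     \<union> {e x (y + y') - e x y - e x y' | x y y'. True}
     \<union> {e (free_scale a x) y - free_scale a (e x y) | a x y. True}
     \<union> {e x (residue_scale a y) - free_scale a (e x y) | a x y. True}"
  have TR: "tensor_relations free_scale residue_scale = free.span gens"
    unfolding tensor_relations_def Let_def gens_def e_def by (rule refl)
  have th_e: "theta (e x y) = free_scale (const y) x" for x y by (simp add: e_def)
  {
    assume z: "z \<in> tensor_relations free_scale residue_scale"
    have "gens \<subseteq> {z. theta z \<in> mmul free_scale UNIV}"
    proof
      fix g assume "g \<in> gens"
      then consider x x' y where "g = e (x + x') y - e x y - e x' y"
        | x y y' where "g = e x (y + y') - e x y - e x y'"
        | a x y where "g = e (free_scale a x) y - free_scale a (e x y)"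
        | a x y where "g = e x (residue_scale a y) - free_scale a (e x y)"
        unfolding gens_def by blast
      then have "theta g \<in> mmul free_scale UNIV"
      proof cases
        case 1
        then have "theta g = 0" by (simp add: theta.diff th_e free.scale_right_distrib)
        then show ?thesis using free.subspace_0[OF mmul_free_subspace] by simp
      next
        case 2
        then have "theta g = 0" by (simp add: theta.diff th_e const_add free.scale_left_distrib)
        then show ?thesis using free.subspace_0[OF mmul_free_subspace] by simp
      next
        case 3
        then have "theta g = 0" by (simp add: theta.diff theta.scale th_e mult.commute)
        then show ?thesis using free.subspace_0[OF mmul_free_subspace] by simp
      next
        case 4
        \<comment> \<open>\<open>residue_scale\<close> replaces \<open>a\<close> by its constant
          term, so the image is a multiple by a polynomial without constant term.\<close>
        then have "theta g = free_scale (const (lookup a 0) - a) (free_scale (const y) x)"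
          by (simp add: theta.diff theta.scale th_e residue_scale_def const_mult free.scale_left_diff_distrib left_diff_distrib)
        moreover have "\<dots> \<in> mmul free_scale UNIV"
          by (rule mmul_scale) (auto simp: module_free_scale lookup_minus)
        ultimately show ?thesis by simp
      qed
      then show "g \<in> {z. theta z \<in> mmul free_scale UNIV}" by simp
    qed
    then have "free.span gens \<subseteq> {z. theta z \<in> mmul free_scale UNIV}"
      by (intro free.span_minimal theta.subspace_linear_preimage mmul_free_subspace)
    then show "theta z \<in> mmul free_scale UNIV" using z TR by blast
  }
  define S where "S = free.span gens"
  have S: "free.subspace S" by (simp add: S_def)
  note S0 = free.subspace_0[OF S] and Sadd = free.subspace_add[OF S] and Sdiff = free.subspace_diff[OF S]
    and Ssc = free.subspace_scale[OF S]
  have g1: "e (x + x') y - e x y - e x' y \<in> S" for x x' y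
    unfolding S_def by (rule free.span_base) (unfold gens_def, blast)
  have g2: "e x (y + y') - e x y - e x y' \<in> S" for x y y'
    unfolding S_def by (rule free.span_base) (unfold gens_def, blast)
  have g3: "e (free_scale a x) y - free_scale a (e x y) \<in> S" for a x y
    unfolding S_def by (rule free.span_base) (unfold gens_def, blast)
  have g4: "e x (residue_scale a y) - free_scale a (e x y) \<in> S" for a x y
    unfolding S_def by (rule free.span_base) (unfold gens_def, blast)
  have e0: "e 0 y \<in> S" for y using Sdiff[OF S0 g1[of 0 0 y]] by simp
  have e0': "e x 0 \<in> S" for x using Sdiff[OF S0 g2[of x 0 0]] by simp
  have esum: "e (\<Sum>p\<in>A. v p) y - (\<Sum>p\<in>A. e (v p) y) \<in> S" if "finite A" for A :: "'q set" and v y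
    using that
  proof (induction A)
    case (insert p A)
    have "e (\<Sum>p\<in>insert p A. v p) y - (\<Sum>p\<in>insert p A. e (v p) y)
        = (e (v p + (\<Sum>p\<in>A. v p)) y - e (v p) y - e (\<Sum>p\<in>A. v p) y) + (e (\<Sum>p\<in>A. v p) y - (\<Sum>p\<in>A. e (v p) y))"
      using insert.hyps by simp
    then show ?case using Sadd[OF g1 insert.IH] by metis
  qed (simp add: e0)
  have esc: "e (free_scale (a * const y) x) 1 - free_scale a (e x y) \<in> S" for a x y
  proof -
    have a1: "e (free_scale a (free_scale (const y) x)) 1 - free_scale a (e (free_scale (const y) x) 1) \<in> S" by (rule g3)
    have a2: "free_scale a (e (free_scale (const y) x) 1 - free_scale (const y) (e x 1)) \<in> S" by (intro Ssc g3)
    have a3: "free_scale a (e x (residue_scale (const y :: ('n, 'k) mpoly) 1) - free_scale (const y) (e x 1)) \<in> S" by (intro Ssc g4)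
    from Sdiff[OF Sadd[OF a1 a2] a3]
    show ?thesis by (simp add: residue_scale_def free.scale_right_diff_distrib)
  qed
  have ez: "e (theta z) 1 - z \<in> S"
  proof -
    let ?v = "\<lambda>(x, y). free_scale (lookup z (x, y) * const y) x"
    have th: "theta z = (\<Sum>p\<in>keys z. ?v p)"
      unfolding theta_def lin_ext_def by (intro sum.cong) auto
    have 1: "(\<Sum>p\<in>keys z. e (?v p) 1) - z \<in> S"
    proof -
      have "(\<Sum>p\<in>keys z. e (?v p) 1 - free_scale (lookup z p) (e (fst p) (snd p))) \<in> S"
        by (intro free.subspace_sum[OF S]) (auto intro: esc)
      moreover have "(\<Sum>p\<in>keys z. free_scale (lookup z p) (e (fst p) (snd p))) = z"
        by (subst (3) poly_mapping_eq_sum_single) (simp add: e_def)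
      ultimately show ?thesis by (simp add: sum_subtractf)
    qed
    show ?thesis using Sadd[OF esum[of "keys z" ?v 1] 1] by (simp add: th)
  qed
  assume "theta z \<in> mmul free_scale UNIV"
  then obtain v where v: "theta z = (\<Sum>i\<in>UNIV. free_scale (var i) (v i))" unfolding mmul_def by blast
  \<comment> \<open>In the tensor product
    \<open>x_i v \<otimes> 1 = v \<otimes> x_i 1 = v \<otimes> 0\<close>, as variables act by zero
    on the residue field.\<close>
  have "e (free_scale (var i) (v i)) 1 \<in> S" for i
  proof -
    have "lookup (var i :: ('n, 'k) mpoly) 0 = 0"
      by (simp add: var_def lookup_single when_def) (metis lookup_single_eq lookup_zero nat.distinct(1))
    then have "residue_scale (var i) (1::'k) = 0" by (simp add: residue_scale_def)
    then have "e (v i) 0 - free_scale (var i) (e (v i) 1) \<in> S" using g4[of "v i" "var i" 1] by simp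
    then have "free_scale (var i) (e (v i) 1) \<in> S" using Sdiff[OF e0'[of "v i"]] by fastforce
    then show ?thesis using Sadd[OF g3[of "var i" "v i" 1]] by fastforce
  qed
  then have "(\<Sum>i\<in>UNIV. e (free_scale (var i) (v i)) 1) \<in> S" by (intro free.subspace_sum[OF S])
  then have "e (theta z) 1 \<in> S" unfolding v using Sadd[OF esum[of UNIV "\<lambda>i. free_scale (var i) (v i)" 1]] by fastforce
  then have "z \<in> S" using Sdiff[OF _ ez] by fastforce
  then show "z \<in> tensor_relations free_scale residue_scale" by (simp add: TR S_def)
qed

lemma tor_boundaries_iff:
  fixes d :: "nat \<Rightarrow> (nat \<Rightarrow>\<^sub>0 ('n::finite, 'k::field) mpoly) \<Rightarrow> _"
  assumes d: "module_hom free_scale free_scale (d i)"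
  shows "z \<in> tor_boundaries d residue_scale i \<longleftrightarrow> (\<exists>v. theta z - d i v \<in> mmul free_scale UNIV)"
proof
  assume "z \<in> tor_boundaries d residue_scale i"
  then obtain w u where "z = tensor_map (d i) w + u" "u \<in> tensor_relations free_scale residue_scale"
    unfolding tor_boundaries_def by blast
  then have "theta z - d i (theta w) \<in> mmul free_scale UNIV"
    by (simp add: theta.add theta_tensor_map[OF d] tensor_relations_iff)
  then show "\<exists>v. theta z - d i v \<in> mmul free_scale UNIV" by blast
next
  assume "\<exists>v. theta z - d i v \<in> mmul free_scale UNIV"
  then obtain v where v: "theta z - d i v \<in> mmul free_scale UNIV" by blast
  define w where "w = Poly_Mapping.single (v, 1 :: 'k) (1 :: ('n, 'k) mpoly)"
  have "theta (z - tensor_map (d i) w) = theta z - d i v"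
    by (simp add: theta.diff theta_tensor_map[OF d] w_def)
  then have "z - tensor_map (d i) w \<in> tensor_relations free_scale residue_scale" using v by (simp add: tensor_relations_iff)
  moreover have "z = tensor_map (d i) w + (z - tensor_map (d i) w)" by simp
  ultimately show "z \<in> tor_boundaries d residue_scale i" unfolding tor_boundaries_def by blast
qed

lemma kd_empty: "module sm \<Longrightarrow> kd sm y u {} = (\<Sum>i\<in>UNIV. sm (y i) (u {i}))"
  by (simp add: kd_def sg_def)

lemma kboundaries_0_iff:
  assumes "module sm" "0 \<in> N" and w: "w \<in> kchains UNIV 0"
  shows "w \<in> kboundaries sm var N 0 \<longleftrightarrow> w {} \<in> mmul sm N"
proof
  assume "w \<in> kboundaries sm var N 0"
  then obtain u where "u \<in> kchains N (Suc 0)" "w = kd sm var u" unfolding kboundaries_def by blast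
  then show "w {} \<in> mmul sm N" by (simp add: kd_empty[OF assms(1)]) (auto intro!: mmulI simp: kchains_def)
next
  interpret module sm by fact
  assume "w {} \<in> mmul sm N"
  then obtain v where v: "w {} = (\<Sum>i\<in>UNIV. sm (var i) (v i))" "\<And>i. v i \<in> N" unfolding mmul_def by blast
  define u where "u U = (if card U = 1 then v (the_elem U) else 0)" for U
  have u: "u \<in> kchains N (Suc 0)" using v(2) assms(2) by (auto simp: kchains_def u_def)
  have "kd sm var u U = w U" for U
  proof (cases "U = {}")
    case True
    then show ?thesis using v by (simp add: kd_empty[OF assms(1)]) (simp add: u_def)
  next
    case False
    have "card (insert i U) \<noteq> 1" if "i \<in> - U" for i using that False by auto
    then have "kd sm var u U = 0" unfolding kd_def by (intro sum.neutral) (auto simp: u_def)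
    moreover have "w U = 0" using w False by (auto simp: kchains_def)
    ultimately show ?thesis by simp
  qed
  then have "w = kd sm var u" by auto
  then show "w \<in> kboundaries sm var N 0" unfolding kboundaries_def using u by blast
qed

text \<open>With \<open>K\<close> the image of \<open>d j\<close> and \<open>m\<close> the maximal
  graded ideal, \<open>d j\<close> identifies Tor in degree \<open>j + 1\<close> with the quotient
  of \<open>K \<inter> m F_j\<close> by \<open>m K\<close>; iterated syzygy shifts identify this
  quotient with the Koszul homology of \<open>M\<close> in degree \<open>j + 1\<close>. In degree 0
  both sides are \<open>M / m M\<close>.\<close>

lemma tor_dim_eq_koszul:
  fixes sm :: "('n::{finite,linorder}, 'k::field) mpoly \<Rightarrow> 'm::ab_group_add \<Rightarrow> 'm"
  assumes mod: "module sm" and fg: "finitely_generated sm"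
    and n: "qdim (fscale (kscale sm)) (kcycles sm var UNIV i) (kboundaries sm var UNIV i) n"
  shows "tor_dim sm i = n"
proof -
  interpret module sm by fact
  have mmF: "free.subspace (mmul free_scale (UNIV :: (nat \<Rightarrow>\<^sub>0 ('n, 'k) mpoly) set))"
    by (rule mmul_free_subspace)
  define d where "d = (SOME d. \<exists>\<epsilon>. free_resolution sm d \<epsilon>)"
  have "\<exists>\<epsilon>. free_resolution sm d \<epsilon>" unfolding d_def using someI_ex[OF free_resolution_exists[OF mod fg]] .
  then obtain \<epsilon> where "free_resolution sm d \<epsilon>" by blast
  then have d: "\<And>i. module_hom free_scale free_scale (d i)" and eps: "module_hom free_scale sm \<epsilon>" "range \<epsilon> = UNIV"
    and r0: "range (d 0) = {v. \<epsilon> v = 0}" and rS: "\<And>i. range (d (Suc i)) = {v. d i v = 0}"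
    unfolding free_resolution_def by auto
  interpret eps: module_hom free_scale sm \<epsilon> by fact
  interpret d: module_hom free_scale free_scale "d k" for k by (rule d)
  let ?V = "kscale (free_scale :: ('n, 'k) mpoly \<Rightarrow> ((nat \<Rightarrow>\<^sub>0 ('n, 'k) mpoly) \<times> 'k \<Rightarrow>\<^sub>0 _) \<Rightarrow> _)"
  interpret V: vector_space ?V by (rule vector_space_kscale[OF module_free_scale])
  let ?F = "fscale (kscale (free_scale :: ('n, 'k) mpoly \<Rightarrow> (nat \<Rightarrow>\<^sub>0 ('n, 'k) mpoly) \<Rightarrow> _))
    :: 'k \<Rightarrow> ('n set \<Rightarrow> _) \<Rightarrow> _"
  have vsF: "vector_space ?F" by (rule vector_space_fscale[OF vector_space_kscale[OF module_free_scale]])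
  have th_sc: "theta (?V c z) = free_scale (const c) (theta z)" for c z by (simp add: kscale_def theta.scale)
  \<comment> \<open>\<open>range (d j)\<close> is the syzygy of order \<open>j + 1\<close>, hence
    the degree \<open>Suc q + j\<close> on the side of \<open>M\<close>.\<close>
  have shift: "qdim ?F (kchains (range (d j)) q \<inter> kboundaries free_scale var UNIV q) (kboundaries free_scale var (range (d j)) q) n"
    if "qdim (fscale (kscale sm)) (kcycles sm var UNIV (Suc q + j)) (kboundaries sm var UNIV (Suc q + j)) n" for j q
    using that
  proof (induction j arbitrary: q)
    case 0
    then have "qdim (fscale (kscale sm)) (kcycles sm var UNIV (Suc q)) (kboundaries sm var UNIV (Suc q)) n"
      by (simp only: add_0_right)
    then show ?case unfolding r0 by (rule koszul_syzygy_shift[OF eps(1), unfolded eps(2)])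
  next
    case (Suc j)
    have "qdim ?F (kchains (range (d j)) (Suc q) \<inter> kboundaries free_scale var UNIV (Suc q)) (kboundaries free_scale var (range (d j)) (Suc q)) n"
      by (rule Suc.IH) (use Suc.prems in \<open>simp only: add_Suc add_Suc_right\<close>)
    \<comment> \<open>In positive degree a cycle over the syzygy bounds in the free module, so the
      space produced by one shift is the full space of cycles from which the next one
      starts.\<close>
    moreover have "kchains (range (d j)) (Suc q) \<inter> kboundaries free_scale var UNIV (Suc q) = kcycles free_scale var (range (d j)) (Suc q)"
    proof -
      have "kcycles free_scale var (range (d j)) (Suc q) \<subseteq> kcycles free_scale var UNIV (Suc q)"
        by (auto simp: kcycles_def kchains_def)
      then have "kcycles free_scale var (range (d j)) (Suc q) \<subseteq> kboundaries free_scale var UNIV (Suc q)"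
        using free_koszul_acyclic by blast
      moreover have "kboundaries free_scale var UNIV (Suc q) \<subseteq> kcycles free_scale var UNIV (Suc q)"
        by (rule free.kboundaries_subset_kcycles) simp
      ultimately show ?thesis by (auto simp: kcycles_def)
    qed
    ultimately show ?case unfolding rS by (intro koszul_syzygy_shift[OF d[of j]]) (simp only:)
  qed
  have sub_chains: "module.subspace ?F (kchains (range (d j)) q)" for j q
    by (intro subspace_kchains vector_space_kscale module_free_scale module_subspace_kscale d.subspace_image) simp
  have subW: "V.subspace (tor_boundaries d residue_scale i)" for i
  proof (rule V.subspaceI)
    show "0 \<in> tor_boundaries d residue_scale i"
      unfolding tor_boundaries_iff[OF d] using free.subspace_0[OF mmF] by (intro exI[of _ 0]) simp
  next
    fix x y assume "x \<in> tor_boundaries d residue_scale i" "y \<in> tor_boundaries d residue_scale i"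
    then obtain u v where "theta x - d i u \<in> mmul free_scale UNIV" "theta y - d i v \<in> mmul free_scale UNIV"
      unfolding tor_boundaries_iff[OF d] by blast
    then have "theta (x + y) - d i (u + v) \<in> mmul free_scale UNIV"
      using free.subspace_add[OF mmF] by (fastforce simp: theta.add d.add add_diff_add)
    then show "x + y \<in> tor_boundaries d residue_scale i" unfolding tor_boundaries_iff[OF d] by blast
  next
    fix c x assume "x \<in> tor_boundaries d residue_scale i"
    then obtain u where "theta x - d i u \<in> mmul free_scale UNIV"
      unfolding tor_boundaries_iff[OF d] by blast
    then have "free_scale (const c) (theta x - d i u) \<in> mmul free_scale UNIV"
      by (rule free.subspace_scale[OF mmF])
    then have "theta (?V c x) - d i (free_scale (const c) u) \<in> mmul free_scale UNIV"
      by (simp add: th_sc d.scale free.scale_right_diff_distrib)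
    then show "?V c x \<in> tor_boundaries d residue_scale i" unfolding tor_boundaries_iff[OF d] by blast
  qed
  have sub_pre: "V.subspace {z. d j (theta z) \<in> mmul free_scale UNIV}" for j
    using free.subspace_0[OF mmF] free.subspace_add[OF mmF] free.subspace_scale[OF mmF]
    by (intro V.subspaceI) (auto simp: theta.add d.add th_sc d.scale)
  have cyc_S: "tor_cycles d residue_scale (Suc j) = {z. d j (theta z) \<in> mmul free_scale UNIV}" for j
    by (auto simp: tensor_relations_iff theta_tensor_map[OF d])
  have subZ: "V.subspace (tor_cycles d residue_scale i)"
    by (cases i) (simp_all only: cyc_S sub_pre tor_cycles.simps(1) V.subspace_UNIV)
  have hom_mmul: "f v \<in> mmul s2 (range f)" if f: "module_hom s1 s2 f" and v: "v \<in> mmul s1 UNIV" for f s1 and s2 and v :: "'w :: ab_group_add"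
  proof -
    interpret f: module_hom s1 s2 f by (rule f)
    obtain u where "v = (\<Sum>i\<in>UNIV. s1 (var i) (u i))" using v unfolding mmul_def by blast
    then have "f v = (\<Sum>i\<in>UNIV. s2 (var i) (f (u i)))" by (simp add: f.sum f.scale)
    also have "\<dots> \<in> mmul s2 (range f)" by (rule mmulI) simp
    finally show ?thesis .
  qed
  have mmul_lift: "\<exists>u\<in>mmul s1 UNIV. f u = w" if f: "module_hom s1 s2 f" and v: "w \<in> mmul s2 (range f)" for f s1 and s2 and w :: "'w :: ab_group_add"
  proof -
    interpret f: module_hom s1 s2 f by (rule f)
    obtain u where u: "w = (\<Sum>i\<in>UNIV. s2 (var i) (u i))" "\<And>i. u i \<in> range f" using v unfolding mmul_def by blast
    then obtain u' where u': "\<And>i. u i = f (u' i)" unfolding image_iff by metis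
    have "f (\<Sum>i\<in>UNIV. s1 (var i) (u' i)) = w" by (simp add: f.sum f.scale u(1) u')
    then show ?thesis using mmulI[of u' UNIV s1] by blast
  qed
  have mmul_UNIV: "mmul s N \<subseteq> mmul s UNIV" for s :: "('n, 'k) mpoly \<Rightarrow> 'w::ab_group_add \<Rightarrow> 'w" and N
    unfolding mmul_def by blast
  have kch0: "(\<lambda>U. if U = {} then v else 0) \<in> kchains N 0" if "v \<in> N" "0 \<in> N" for v :: "'w::zero" and N
    using that by (auto simp: kchains_def)
  have WZ: "tor_boundaries d residue_scale i \<subseteq> tor_cycles d residue_scale i"
  proof (cases i)
    case (Suc j)
    show ?thesis
    proof
      fix z assume "z \<in> tor_boundaries d residue_scale i"
      then obtain v where v: "theta z - d (Suc j) v \<in> mmul free_scale UNIV" unfolding Suc tor_boundaries_iff[OF d] by blast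
      have "d j (d (Suc j) v) = 0" using rS[of j] by blast
      then have "d j (theta z) = d j (theta z - d (Suc j) v)" by (simp add: d.diff)
      also have "\<dots> \<in> mmul free_scale UNIV" using hom_mmul[OF d v] mmul_UNIV by blast
      finally show "z \<in> tor_cycles d residue_scale i" unfolding Suc cyc_S by simp
    qed
  qed simp
  have "qdim ?V (tor_cycles d residue_scale i) (tor_boundaries d residue_scale i) n"
  proof (cases i)
    case 0
    define \<rho> where "\<rho> z w \<longleftrightarrow> w {} = \<epsilon> (theta z)" for z and w :: "'n set \<Rightarrow> 'm"
    have k0: "kcycles sm var UNIV 0 = (kchains UNIV 0 :: ('n set \<Rightarrow> 'm) set)"
      by (auto simp: kcycles_def kchains_def kd_def intro!: sum.neutral)
    have n0: "qdim (fscale (kscale sm)) (kcycles sm var UNIV 0) (kboundaries sm var UNIV 0) n" using n unfolding 0 .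
    have sub0: "module.subspace (fscale (kscale sm)) (kcycles sm var UNIV 0)"
      by (intro subspace_kcycles mod module_subspace_kscale subspace_UNIV)
    show ?thesis unfolding 0
    proof (rule qdim_transfer[where \<rho> = \<rho>, OF _ _ _ _ _ _ sub0 _ _ _ n0])
      show "vector_space ?V" by unfold_locales
      show "vector_space (fscale (kscale sm))" by (rule vector_space_fscale[OF vector_space_kscale[OF mod]])
      show "V.subspace (tor_cycles d residue_scale 0)" by simp
    next
      fix z show "\<exists>z'\<in>kcycles sm var UNIV 0. \<rho> z z'"
        unfolding k0 \<rho>_def using kch0[of "\<epsilon> (theta z)" UNIV] by (intro bexI) auto
    next
      fix z' :: "'n set \<Rightarrow> 'm"
      obtain v where "z' {} = \<epsilon> v" using eps(2) by (metis rangeE UNIV_I)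
      then show "\<exists>z\<in>tor_cycles d residue_scale 0. \<rho> z z'"
        unfolding \<rho>_def by (intro bexI[of _ "Poly_Mapping.single (v, 1) 1"]) auto
    next
      fix z z' assume z': "z' \<in> kcycles sm var UNIV 0" and r: "\<rho> z z'"
      have "z' \<in> kboundaries sm var UNIV 0 \<longleftrightarrow> \<epsilon> (theta z) \<in> mmul sm UNIV"
        using kboundaries_0_iff[OF mod _ z'[unfolded k0], of UNIV] r by (simp add: \<rho>_def)
      also have "\<dots> \<longleftrightarrow> (\<exists>v. theta z - d 0 v \<in> mmul free_scale UNIV)"
      proof
        assume "\<epsilon> (theta z) \<in> mmul sm UNIV"
        then obtain u where u: "u \<in> mmul free_scale UNIV" "\<epsilon> u = \<epsilon> (theta z)"
          using mmul_lift[OF eps(1)] eps(2) by metis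
        then have "theta z - u \<in> range (d 0)" unfolding r0 by (simp add: eps.diff)
        then obtain v where "theta z - u = d 0 v" by blast
        then have "theta z - d 0 v = u" by (simp add: algebra_simps)
        then show "\<exists>v. theta z - d 0 v \<in> mmul free_scale UNIV" using u(1) by metis
      next
        assume "\<exists>v. theta z - d 0 v \<in> mmul free_scale UNIV"
        then obtain v where v: "theta z - d 0 v \<in> mmul free_scale UNIV" by blast
        have "\<epsilon> (d 0 v) = 0" using r0 by blast
        then show "\<epsilon> (theta z) \<in> mmul sm UNIV" using hom_mmul[OF eps(1) v] by (simp add: eps.diff eps(2))
      qed
      finally show "z \<in> tor_boundaries d residue_scale 0 \<longleftrightarrow> z' \<in> kboundaries sm var UNIV 0"
        unfolding tor_boundaries_iff[OF d] by simp
    qed (auto simp: \<rho>_def theta.add eps.add th_sc eps.scale kscale_def[of sm])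
  next
    case (Suc j)
    define \<rho> where "\<rho> z w \<longleftrightarrow> w {} = d j (theta z)" for z and w :: "'n set \<Rightarrow> (nat \<Rightarrow>\<^sub>0 ('n, 'k) mpoly)"
    let ?Z = "kchains (range (d j)) 0 \<inter> kboundaries free_scale var UNIV 0 :: ('n set \<Rightarrow> (nat \<Rightarrow>\<^sub>0 ('n, 'k) mpoly)) set"
    have q: "qdim ?F ?Z (kboundaries free_scale var (range (d j)) 0) n" by (rule shift) (use n Suc in \<open>simp only: add_Suc add_0\<close>)
    have r00: "0 \<in> range (d j)" using d.zero by (metis rangeI)
    have memZ: "w \<in> ?Z \<longleftrightarrow> w \<in> kchains (range (d j)) 0 \<and> w {} \<in> mmul free_scale UNIV" for w
      using kboundaries_0_iff[OF module_free_scale, of UNIV w] by (auto simp: kchains_def)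
    interpret F: vector_space ?F by (rule vsF)
    have Zsub: "F.subspace ?Z"
    proof (rule F.subspaceI)
      show "0 \<in> ?Z" unfolding memZ using F.subspace_0[OF sub_chains] free.subspace_0[OF mmF] by simp
      show "x + y \<in> ?Z" if "x \<in> ?Z" "y \<in> ?Z" for x y
        using that unfolding memZ using F.subspace_add[OF sub_chains] free.subspace_add[OF mmF] by simp
      show "?F c x \<in> ?Z" if "x \<in> ?Z" for c x
        using that unfolding memZ using F.subspace_scale[OF sub_chains] free.subspace_scale[OF mmF] by (simp add: kscale_def)
    qed
    show ?thesis unfolding Suc
    proof (rule qdim_transfer[where \<rho> = \<rho>, OF _ vsF _ _ _ _ Zsub _ _ _ q])
      show "vector_space ?V" by unfold_locales
      show "V.subspace (tor_cycles d residue_scale (Suc j))" using subZ Suc by simp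
      fix z assume z: "z \<in> tor_cycles d residue_scale (Suc j)"
      then have "d j (theta z) \<in> mmul free_scale UNIV" by (simp only: cyc_S mem_Collect_eq)
      then have "(\<lambda>U. if U = {} then d j (theta z) else 0) \<in> ?Z"
        unfolding memZ using kch0[of "d j (theta z)" "range (d j)"] r00 by simp
      then show "\<exists>z'\<in>?Z. \<rho> z z'" by (rule bexI[rotated]) (simp add: \<rho>_def)
    next
      fix z' assume z': "z' \<in> ?Z"
      then obtain v where v: "z' {} = d j v" by (auto simp: kchains_def)
      then show "\<exists>z\<in>tor_cycles d residue_scale (Suc j). \<rho> z z'"
        using z' unfolding \<rho>_def memZ cyc_S by (intro bexI[of _ "Poly_Mapping.single (v, 1) 1"]) auto
    next
      fix z z' assume z': "z' \<in> ?Z" and r: "\<rho> z z'"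
      have "z' \<in> kchains UNIV 0" using z' by (auto simp: kchains_def)
      then have "z' \<in> kboundaries free_scale var (range (d j)) 0 \<longleftrightarrow> d j (theta z) \<in> mmul free_scale (range (d j))"
        using kboundaries_0_iff[OF module_free_scale r00] r by (simp add: \<rho>_def)
      also have "\<dots> \<longleftrightarrow> (\<exists>v. theta z - d (Suc j) v \<in> mmul free_scale UNIV)"
      proof
        assume "d j (theta z) \<in> mmul free_scale (range (d j))"
        then obtain u where u: "u \<in> mmul free_scale UNIV" "d j u = d j (theta z)"
          using mmul_lift[OF d] by metis
        then have "theta z - u \<in> range (d (Suc j))" unfolding rS by (simp add: d.diff)
        then obtain v where "theta z - u = d (Suc j) v" by blast
        then have "theta z - d (Suc j) v = u" by (simp add: algebra_simps)
        then show "\<exists>v. theta z - d (Suc j) v \<in> mmul free_scale UNIV" using u(1) by metis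
      next
        assume "\<exists>v. theta z - d (Suc j) v \<in> mmul free_scale UNIV"
        then obtain v where v: "theta z - d (Suc j) v \<in> mmul free_scale UNIV" by blast
        have "d j (d (Suc j) v) = 0" using rS by blast
        then show "d j (theta z) \<in> mmul free_scale (range (d j))" using hom_mmul[OF d[of j] v] by (simp add: d.diff)
      qed
      finally show "z \<in> tor_boundaries d residue_scale (Suc j) \<longleftrightarrow> z' \<in> kboundaries free_scale var (range (d j)) 0"
        unfolding tor_boundaries_iff[OF d] by simp
    qed (auto simp: \<rho>_def theta.add d.add theta.scale d.scale kscale_def)
  qed
  then have "quotient_dim ?V (tor_cycles d residue_scale i) (tor_boundaries d residue_scale i) = n"
    by (rule V.quotient_dim_eq[OF subZ subW WZ])
  then show ?thesis unfolding tor_dim_def Let_def d_def .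
qed

section \<open>From local cohomology to Koszul homology\<close>

lemma homogeneous_var: "homogeneous 1 (var i)"
  unfolding homogeneous_def var_def
  by (auto simp: lookup_single when_def split: if_splits)

locale graded =
  fixes sm :: "('n::{finite,linorder}, 'k::field) mpoly \<Rightarrow> 'm::ab_group_add \<Rightarrow> 'm"
    and G :: "int \<Rightarrow> 'm set"
  assumes gr: "graded_module sm G"
begin

sublocale module sm using gr by (simp add: graded_module_def)

lemma G_zero [simp]: "0 \<in> G t" and G_diff: "x \<in> G t \<Longrightarrow> y \<in> G t \<Longrightarrow> x - y \<in> G t"
  using gr by (auto simp: graded_module_def)

lemma G_minus: "x \<in> G t \<Longrightarrow> - x \<in> G t" using G_diff[of 0 t x] by simp

lemma G_add: "x \<in> G t \<Longrightarrow> y \<in> G t \<Longrightarrow> x + y \<in> G t" using G_diff[OF _ G_minus] by fastforce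

lemma G_sum: "(\<And>i. i \<in> A \<Longrightarrow> f i \<in> G t) \<Longrightarrow> sum f A \<in> G t"
  by (induction A rule: infinite_finite_induct) (auto simp: G_add)

lemma G_homogeneous: "homogeneous e f \<Longrightarrow> x \<in> G t \<Longrightarrow> sm f x \<in> G (t + int e)"
  using gr by (auto simp: graded_module_def)

lemma G_var: "x \<in> G t \<Longrightarrow> sm (var i) x \<in> G (t + 1)"
  using G_homogeneous[OF homogeneous_var] by fastforce

lemma G_sg: "x \<in> G t \<Longrightarrow> sm (sg i U) x \<in> G t"
  using sg_scale_cases[of i U x] G_minus by metis

lemma G_var_power: "x \<in> G t \<Longrightarrow> sm (var i ^ a) x \<in> G (t + int a)"
proof (induction a)
  case (Suc a)
  then have "sm (var i) (sm (var i ^ a) x) \<in> G (t + int a + 1)" by (intro G_var) simp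
  then show ?case by (simp add: algebra_simps)
qed simp

lemma G_var_prod: "x \<in> G t \<Longrightarrow> sm (var_prod S) x \<in> G (t + int (card S))"
proof (induction S rule: finite_induct[OF finite])
  case (2 i S)
  then have "sm (var i) (sm (var_prod S) x) \<in> G (t + int (card S) + 1)" by (intro G_var) simp
  then show ?case using 2 by (simp add: var_prod_def algebra_simps)
qed (simp add: var_prod_def)

lemma G_var_prod_power: "x \<in> G t \<Longrightarrow> sm (var_prod S ^ a) x \<in> G (t + int a * int (card S))"
proof (induction a)
  case (Suc a)
  then have "sm (var_prod S) (sm (var_prod S ^ a) x) \<in> G (t + int a * int (card S) + int (card S))" by (intro G_var_prod) simp
  then show ?case by (simp add: algebra_simps)
qed simp

lemma G_kd: "(\<And>U. w U \<in> G t) \<Longrightarrow> kd sm var w U \<in> G (t + 1)"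
  unfolding kd_def by (intro G_sum) (simp only: scale_scale[symmetric], intro G_sg G_var)

lemma G_cd: "(\<And>U. w U \<in> G t) \<Longrightarrow> cd sm (\<lambda>i. var i ^ a) w U \<in> G (t + int a)"
  unfolding cd_def by (intro G_sum) (simp only: scale_scale[symmetric], intro G_sg G_var_power)

end

section \<open>Fractions and numerators over a common denominator\<close>

lemma var_prod_empty [simp]: "var_prod {} = 1" by (simp add: var_prod_def)

context module
begin

text \<open>The relation between pairs is transitive (\<open>tr\<close>), so fractions are its full
  classes and agree as soon as representatives are related.\<close>

lemma fraction_eq_iff:
  "fraction scale f m a = fraction scale f m' b \<longleftrightarrow> (\<exists>c. scale (f ^ (c + b)) m = scale (f ^ (c + a)) m')"
proof
  assume "fraction scale f m a = fraction scale f m' b"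
  moreover have "(m', b) \<in> fraction scale f m' b" by (auto simp: fraction_def)
  ultimately have "(m', b) \<in> fraction scale f m a" by simp
  then show "\<exists>c. scale (f ^ (c + b)) m = scale (f ^ (c + a)) m'" by (auto simp: fraction_def power_add)
next
  have tr: "\<exists>c. scale (f ^ (c + e)) m = scale (f ^ (c + a)) m''"
    if "scale (f ^ (c + b)) m = scale (f ^ (c + a)) m'" "scale (f ^ (c' + e)) m' = scale (f ^ (c' + b)) m''" for m m' m'' a b e c c'
  proof -
    have "scale (f ^ ((c + c' + b) + e)) m = scale (f ^ (c' + e)) (scale (f ^ (c + b)) m)"
      by (simp add: power_add[symmetric] add_ac)
    also have "\<dots> = scale (f ^ (c + a)) (scale (f ^ (c' + e)) m')"
      unfolding that(1) by (simp add: mult.commute)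
    also have "\<dots> = scale (f ^ ((c + c' + b) + a)) m''"
      unfolding that(2) by (simp add: power_add[symmetric] add_ac)
    finally show ?thesis by blast
  qed
  assume "\<exists>c. scale (f ^ (c + b)) m = scale (f ^ (c + a)) m'"
  then obtain c where c: "scale (f ^ (c + b)) m = scale (f ^ (c + a)) m'" by blast
  have "(m'', e) \<in> fraction scale f m a \<longleftrightarrow> (m'', e) \<in> fraction scale f m' b" for m'' e
    unfolding fraction_def using tr[OF c] tr[OF c[symmetric]] by (auto simp: power_add[symmetric])
  then show "fraction scale f m a = fraction scale f m' b" by auto
qed

end

context graded
begin

lemma var_prod_split: "i \<in> T \<Longrightarrow> (var_prod T :: ('n, 'k) mpoly) = var i * var_prod (T - {i})"
  unfolding var_prod_def by (rule prod.remove) auto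

text \<open>Passing from the exponent \<open>a\<close> to \<open>a + e\<close> multiplies a
  numerator at \<open>S\<close> by \<open>var_prod S ^ e\<close>. At \<open>T\<close> the missing
  variable contributes the extra \<open>var i ^ e\<close>, so the passage commutes with the Cech
  differential.\<close>

lemma phi_cd: "sm (var_prod T ^ e) (cd sm (\<lambda>i. var i ^ a) m T) = cd sm (\<lambda>i. var i ^ (a + e)) (\<lambda>S. sm (var_prod S ^ e) (m S)) T"
proof -
  have e1: "var_prod T ^ e * (sg i T * var i ^ a) = (sg i T * var i ^ (a + e) * var_prod (T - {i}) ^ e :: ('n, 'k) mpoly)" if "i \<in> T" for i
    using var_prod_split[OF that] by (simp add: power_mult_distrib power_add mult_ac)
  show ?thesis unfolding cd_def scale_sum_right by (intro sum.cong) (simp_all only: scale_scale e1)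
qed

text \<open>Justifies the definite description in \<open>cech_diff\<close>, where representatives
  and their common exponent are arbitrary. The sum \<open>C\<close> of the powers that equate the
  single numerators works for all of them at once.\<close>

lemma cech_diff_well_defined:
  assumes "\<And>i. i \<in> T \<Longrightarrow> fraction sm (var_prod (T - {i})) (m i) a = fraction sm (var_prod (T - {i})) (m' i) b"
  shows "fraction sm (var_prod T) (\<Sum>i\<in>T. sm (s i * var i ^ a) (m i)) a = fraction sm (var_prod T) (\<Sum>i\<in>T. sm (s i * var i ^ b) (m' i)) b"
proof -
  have "\<forall>i. \<exists>c. i \<in> T \<longrightarrow> sm (var_prod (T - {i}) ^ (c + b)) (m i) = sm (var_prod (T - {i}) ^ (c + a)) (m' i)"
    using assms unfolding fraction_eq_iff by blast
  then obtain c where c: "\<And>i. i \<in> T \<Longrightarrow> sm (var_prod (T - {i}) ^ (c i + b)) (m i) = sm (var_prod (T - {i}) ^ (c i + a)) (m' i)"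
    by metis
  define C where "C = (\<Sum>i\<in>T. c i)"
  have C: "sm (var_prod (T - {i}) ^ (C + b)) (m i) = sm (var_prod (T - {i}) ^ (C + a)) (m' i)" if "i \<in> T" for i
  proof -
    have "c i \<le> C" unfolding C_def using that by (intro member_le_sum) auto
    then obtain k where k: "C = k + c i" by (metis add.commute le_Suc_ex)
    have "sm (var_prod (T - {i}) ^ k) (sm (var_prod (T - {i}) ^ (c i + b)) (m i)) = sm (var_prod (T - {i}) ^ k) (sm (var_prod (T - {i}) ^ (c i + a)) (m' i))"
      by (simp only: c[OF that])
    then show ?thesis by (simp add: power_add[symmetric] k add.assoc)
  qed
  have "sm (var_prod T ^ (C + b)) (\<Sum>i\<in>T. sm (s i * var i ^ a) (m i)) = sm (var_prod T ^ (C + a)) (\<Sum>i\<in>T. sm (s i * var i ^ b) (m' i))"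
    unfolding scale_sum_right
  proof (rule sum.cong)
    fix i assume i: "i \<in> T"
    have "sm (var_prod T ^ (C + b)) (sm (s i * var i ^ a) (m i)) = sm (s i * var i ^ (C + a + b)) (sm (var_prod (T - {i}) ^ (C + b)) (m i))"
      using var_prod_split[OF i] by (simp add: power_mult_distrib power_add mult_ac)
    also have "\<dots> = sm (var_prod T ^ (C + a)) (sm (s i * var i ^ b) (m' i))"
      unfolding C[OF i] using var_prod_split[OF i] by (simp add: power_mult_distrib power_add mult_ac)
    finally show "sm (var_prod T ^ (C + b)) (sm (s i * var i ^ a) (m i)) = sm (var_prod T ^ (C + a)) (sm (s i * var i ^ b) (m' i))" .
  qed simp
  then show ?thesis unfolding fraction_eq_iff by blast
qed

lemma cech_diff_fraction:
  assumes T: "card T = Suc p" and c: "\<And>i. i \<in> T \<Longrightarrow> c (T - {i}) = fraction sm (var_prod (T - {i})) (m (T - {i})) a"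
  shows "cech_diff sm p c T = fraction sm (var_prod T) (cd sm (\<lambda>i. var i ^ a) m T) a"
proof -
  let ?z = "\<lambda>m a. fraction sm (var_prod T) (\<Sum>i\<in>T. sm ((-1) ^ card {j\<in>T. j < i} * var i ^ a) (m i)) a"
  have "(THE z. \<exists>m a. (\<forall>i\<in>T. c (T - {i}) = fraction sm (var_prod (T - {i})) (m i) a) \<and> z = ?z m a)
      = ?z (\<lambda>i. m (T - {i})) a"
  proof (rule the_equality)
    show "\<exists>m' a'. (\<forall>i\<in>T. c (T - {i}) = fraction sm (var_prod (T - {i})) (m' i) a') \<and> ?z (\<lambda>i. m (T - {i})) a = ?z m' a'"
      using c by (intro exI[of _ "\<lambda>i. m (T - {i})"] exI[of _ a]) blast
  next
    fix z assume "\<exists>m a. (\<forall>i\<in>T. c (T - {i}) = fraction sm (var_prod (T - {i})) (m i) a) \<and> z = ?z m a"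
    then obtain m' a' where m': "\<And>i. i \<in> T \<Longrightarrow> c (T - {i}) = fraction sm (var_prod (T - {i})) (m' i) a'" "z = ?z m' a'" by blast
    show "z = ?z (\<lambda>i. m (T - {i})) a" unfolding m'(2)
      by (rule cech_diff_well_defined) (use m' c in metis)
  qed
  then show ?thesis using T by (simp add: cech_diff_def cd_def sg_def)
qed

text \<open>Restates vanishing of local cohomology for numerators: a cocycle over the exponent
  \<open>a\<close> becomes a coboundary once the exponent is enlarged to \<open>b\<close>. A
  fraction of degree \<open>t\<close> over \<open>var_prod S ^ b\<close> with
  \<open>card S = p - 1\<close> has a numerator of degree \<open>t + b (p - 1)\<close>.\<close>

lemma vanishing_representatives:
  assumes van: "local_cohomology_vanishes sm G p t"
    and m: "\<And>S. card S = p \<Longrightarrow> m S \<in> G (t + int a * int p)"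
    and cyc: "\<And>T. card T = Suc p \<Longrightarrow> cd sm (\<lambda>i. var i ^ a) m T = 0"
  shows "\<exists>b\<ge>a. \<exists>m'. (\<forall>S. m' S \<in> G (t + int b * (int p - 1)) \<and> (Suc (card S) \<noteq> p \<longrightarrow> m' S = 0))
     \<and> (\<forall>S. card S = p \<longrightarrow> sm (var_prod S ^ (b - a)) (m S) = cd sm (\<lambda>i. var i ^ b) m' S)"
proof -
  define c where "c = (\<lambda>S\<in>{S. card S = p}. fraction sm (var_prod S) (m S) a)"
  have "c \<in> cech_cochains sm G p t"
    unfolding cech_cochains_def c_def using m by auto
  moreover have "cech_diff sm p c = cech_zero sm (Suc p)"
  proof
    fix T
    show "cech_diff sm p c T = cech_zero sm (Suc p) T"
    proof (cases "card T = Suc p")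
      case True
      have "c (T - {i}) = fraction sm (var_prod (T - {i})) (m (T - {i})) a" if "i \<in> T" for i
        using that True by (simp add: c_def)
      then have "cech_diff sm p c T = fraction sm (var_prod T) 0 a"
        using cech_diff_fraction[OF True, of c m a] cyc[OF True] by simp
      also have "\<dots> = fraction sm (var_prod T) 0 0" unfolding fraction_eq_iff by simp
      finally show ?thesis using True by (simp add: cech_zero_def)
    qed (simp add: cech_diff_def cech_zero_def)
  qed
  ultimately have "c \<in> cech_cocycles sm G p t" by (simp add: cech_cocycles_def)
  then have cb: "c \<in> cech_coboundaries sm G p t" using van by (simp add: local_cohomology_vanishes_def)
  show ?thesis
  proof (cases p)
    \<comment> \<open>There are no cochains below \<open>p = 0\<close>, and vanishing over the
      denominator \<open>var_prod {} = 1\<close> means that the numerator itself is zero.\<close>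
    case 0
    then have "c {} = cech_zero sm 0 {}" using cb by simp
    then have "fraction sm (var_prod {}) (m {}) a = fraction sm (var_prod {}) 0 0"
      using 0 by (simp add: c_def cech_zero_def)
    then have "m {} = 0" unfolding fraction_eq_iff by simp
    then show ?thesis using 0 by (intro exI[of _ a] conjI exI[of _ "\<lambda>_. 0"]) auto
  next
    case (Suc q)
    then obtain c' where c': "c' \<in> cech_cochains sm G q t" "c = cech_diff sm q c'" using cb by auto
    have "\<forall>S. \<exists>m a. card S = q \<longrightarrow> c' S = fraction sm (var_prod S) m a \<and> m \<in> G (t + int a * int q)"
    proof
      fix S
      show "\<exists>m a. card S = q \<longrightarrow> c' S = fraction sm (var_prod S) m a \<and> m \<in> G (t + int a * int q)"
      proof (cases "card S = q")
        case True
        then have "c' S \<in> {fraction sm (var_prod S) m a | m a. m \<in> G (t + int a * int q)}"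
          using c'(1) unfolding cech_cochains_def by (auto simp: PiE_def Pi_def)
        then show ?thesis by blast
      qed auto
    qed
    then obtain m1 a1 where m1: "\<And>S. card S = q \<Longrightarrow> c' S = fraction sm (var_prod S) (m1 S) (a1 S)"
      "\<And>S. card S = q \<Longrightarrow> m1 S \<in> G (t + int (a1 S) * int q)" by metis
    \<comment> \<open>The sum over the finitely many \<open>S\<close> is a common upper bound of the
      exponents; \<open>C\<close> below plays this role for the powers that clear the equalities of
      fractions.\<close>
    define A where "A = (\<Sum>S\<in>UNIV. a1 S)"
    have A: "a1 S \<le> A" for S unfolding A_def by (intro member_le_sum) auto
    define m2 where "m2 S = (if card S = q then sm (var_prod S ^ (A - a1 S)) (m1 S) else 0)" for S
    have m2: "c' S = fraction sm (var_prod S) (m2 S) A" if "card S = q" for S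
      unfolding m1(1)[OF that] fraction_eq_iff
      by (rule exI[of _ 0]) (use that A[of S] in \<open>simp add: m2_def power_add[symmetric]\<close>)
    have m2G: "m2 S \<in> G (t + int A * int q)" for S
    proof (cases "card S = q")
      case True
      then have "m2 S \<in> G (t + int (a1 S) * int q + int (A - a1 S) * int (card S))"
        unfolding m2_def if_P[OF True] by (intro G_var_prod_power m1(2))
      also have "t + int (a1 S) * int q + int (A - a1 S) * int (card S) = t + int A * int q"
        using A[of S] True by (simp add: of_nat_diff algebra_simps)
      finally show ?thesis .
    qed (simp add: m2_def)
    have "\<forall>T. \<exists>e. card T = p \<longrightarrow> sm (var_prod T ^ (e + A)) (m T) = sm (var_prod T ^ (e + a)) (cd sm (\<lambda>i. var i ^ A) m2 T)"
    proof
      fix T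
      show "\<exists>e. card T = p \<longrightarrow> sm (var_prod T ^ (e + A)) (m T) = sm (var_prod T ^ (e + a)) (cd sm (\<lambda>i. var i ^ A) m2 T)"
      proof (cases "card T = p")
        case True
        have "c' (T - {i}) = fraction sm (var_prod (T - {i})) (m2 (T - {i})) A" if "i \<in> T" for i
          by (rule m2) (use that True Suc in auto)
        then have "cech_diff sm q c' T = fraction sm (var_prod T) (cd sm (\<lambda>i. var i ^ A) m2 T) A"
          using True Suc by (intro cech_diff_fraction) auto
        moreover have "c T = fraction sm (var_prod T) (m T) a" using True by (simp add: c_def)
        ultimately show ?thesis using c'(2) by (metis fraction_eq_iff)
      qed auto
    qed
    then obtain e where e: "\<And>T. card T = p \<Longrightarrow> sm (var_prod T ^ (e T + A)) (m T) = sm (var_prod T ^ (e T + a)) (cd sm (\<lambda>i. var i ^ A) m2 T)"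
      by metis
    define C where "C = (\<Sum>T\<in>UNIV. e T)"
    \<comment> \<open>\<open>A\<close> is the exponent of \<open>m2\<close>; the additional
      \<open>C + a\<close> comes from the clearing power and from multiplying crosswise by the
      exponent \<open>a\<close> of \<open>m\<close>.\<close>
    define b where "b = A + (C + a)"
    define m' where "m' S = (if card S = q then sm (var_prod S ^ (C + a)) (m2 S) else 0)" for S
    have eq: "sm (var_prod T ^ (b - a)) (m T) = cd sm (\<lambda>i. var i ^ b) m' T" if T: "card T = p" for T
    proof -
      have "e T \<le> C" unfolding C_def by (intro member_le_sum) auto
      then obtain k where k: "C = k + e T" by (metis add.commute le_Suc_ex)
      have "b - a = k + (e T + A)" by (simp add: b_def k)
      then have "sm (var_prod T ^ (b - a)) (m T) = sm (var_prod T ^ k) (sm (var_prod T ^ (e T + A)) (m T))"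
        by (simp only: scale_scale power_add[symmetric])
      also have "\<dots> = sm (var_prod T ^ (C + a)) (cd sm (\<lambda>i. var i ^ A) m2 T)"
        unfolding e[OF T] scale_scale power_add[symmetric] k by (simp add: add.assoc)
      also have "\<dots> = cd sm (\<lambda>i. var i ^ b) (\<lambda>S. sm (var_prod S ^ (C + a)) (m2 S)) T"
        unfolding phi_cd b_def ..
      also have "\<dots> = cd sm (\<lambda>i. var i ^ b) m' T"
        unfolding cd_def using T Suc by (intro sum.cong) (auto simp: m'_def)
      finally show ?thesis .
    qed
    have "m' S \<in> G (t + int b * (int p - 1))" for S
    proof (cases "card S = q")
      case True
      then have "m' S \<in> G (t + int A * int q + int (C + a) * int (card S))"
        unfolding m'_def if_P[OF True] by (intro G_var_prod_power m2G)
      also have "t + int A * int q + int (C + a) * int (card S) = t + int b * (int p - 1)"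
        using True Suc by (simp add: b_def algebra_simps)
      finally show ?thesis .
    qed (simp add: m'_def)
    moreover have "m' S = 0" if "Suc (card S) \<noteq> p" for S using that Suc by (simp add: m'_def)
    moreover have "b \<ge> a" by (simp add: b_def)
    ultimately show ?thesis using eq by blast
  qed
qed

text \<open>The double complex of the Cech and the Koszul complex. Its elements are given by
  representatives \<open>w S U\<close> with common denominator exponent \<open>a\<close>; the rows are exact at all
  nonempty \<open>S\<close> because some variable is invertible there, and the columns are exact in the
  degrees at hand by the vanishing of local cohomology.\<close>

lemma cech_koszul_chase:
  assumes van: "\<And>p t. r < int p + t \<Longrightarrow> local_cohomology_vanishes sm G p t"
  shows "CARD('n) < l + k \<Longrightarrow> r < int q + t \<Longrightarrow>
    (\<And>S U. w S U \<in> G (t + int a * int q)) \<Longrightarrow>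
    (\<And>S U. card S \<noteq> q \<or> card U \<noteq> l \<Longrightarrow> w S U = 0) \<Longrightarrow>
    (\<And>S U. kd sm var (\<lambda>U. cd sm (\<lambda>i. var i ^ a) (\<lambda>S. w S U) S) U = 0) \<Longrightarrow>
    \<exists>b\<ge>a. \<exists>u v. (\<forall>S U. u S U \<in> G (t + int b * (int q - 1)) \<and> (Suc (card S) \<noteq> q \<longrightarrow> u S U = 0))
      \<and> (\<forall>S U. v S U \<in> G (t - 1 + int b * int q) \<and> (card S \<noteq> q \<longrightarrow> v S U = 0))
      \<and> (\<forall>S U. sm (var_prod S ^ (b - a)) (w S U) = kd sm var (v S) U + cd sm (\<lambda>i. var i ^ b) (\<lambda>S. u S U) S)"
\<comment> \<open>\<open>k\<close> measures how far the Koszul degree \<open>l\<close> can still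
  rise before it exceeds the number of variables. Each step raises \<open>q\<close> and
  \<open>l\<close> by one and lowers \<open>t\<close> by one, which keeps \<open>q + t\<close> above
  \<open>r\<close>.\<close>
proof (induction k arbitrary: l q t w a)
  case 0
  have "w S U = 0" for S U
  proof -
    have "card U \<le> CARD('n)" by (rule card_mono) auto
    then show ?thesis using 0 by auto
  qed
  then show ?case by (intro exI[of _ a] conjI exI[of _ "\<lambda>_ _. 0"]) auto
next
  case (Suc k)
  note wG = Suc.prems(3) and w0 = Suc.prems(4) and wc = Suc.prems(5)
  define X where "X S U = cd sm (\<lambda>i. var i ^ a) (\<lambda>S. w S U) S" for S U
  have kdX: "kd sm var (X S) U = 0" for S U using wc[of S U] by (simp add: X_def[abs_def])
  have X0: "X S U = 0" if "card S \<noteq> Suc q \<or> card U \<noteq> l" for S U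
  proof -
    have "w (S - {i}) U = 0" if i: "i \<in> S" for i
      using \<open>card S \<noteq> Suc q \<or> card U \<noteq> l\<close> card_Suc_Diff1[OF finite i] by (intro w0) auto
    then show ?thesis unfolding X_def cd_def by (intro sum.neutral) auto
  qed
  have XG: "X S U \<in> G (t + int a * int q + int a)" for S U
    unfolding X_def by (intro G_cd wG)
  \<comment> \<open>At a nonempty \<open>S\<close> the variable \<open>x_s\<close> with
    \<open>s = Min S\<close> is invertible, and \<open>X\<close> is the Koszul boundary of
    \<open>e_s \<and> X / x_s\<close>. Over the exponent \<open>a + 1\<close> the numerator of this
    fraction carries the factor \<open>var_prod (S - {Min S})\<close>.\<close>
  define w' where "w' S U = (if card S = Suc q then sm (var_prod (S - {Min S})) (wedge sm (Min S) (X S) U) else 0)" for S U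
  have kdw': "kd sm var (w' S) U = sm (var_prod S) (X S U)" for S U
  proof (cases "card S = Suc q")
    case True
    then have "Min S \<in> S" by (intro Min_in) auto
    have "kd sm var (w' S) U = sm (var_prod (S - {Min S})) (kd sm var (wedge sm (Min S) (X S)) U)"
      using True kd_scale[of var "var_prod (S - {Min S})" "wedge sm (Min S) (X S)" U] by (simp add: w'_def[abs_def])
    also have "\<dots> = sm (var_prod S) (X S U)"
      using var_prod_split[OF \<open>Min S \<in> S\<close>] by (simp add: kd_wedge wedge_def[of _ _ "kd sm var (X S)"] kdX mult.commute)
    finally show ?thesis .
  qed (simp add: w'_def[abs_def] X0)
  have w'G: "w' S U \<in> G (t - 1 + int (a + 1) * int (Suc q))" for S U
  proof (cases "card S = Suc q")
    case True
    then have "Min S \<in> S" by (intro Min_in) auto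
    then have c: "card (S - {Min S}) = q" using True card_Suc_Diff1[OF finite \<open>Min S \<in> S\<close>] by simp
    have "wedge sm (Min S) (X S) U \<in> G (t + int a * int q + int a)"
      unfolding wedge_def using XG by (auto intro: G_sg)
    then have "w' S U \<in> G (t + int a * int q + int a + int (card (S - {Min S})))"
      using True by (simp add: w'_def del: card_Diff_insert) (rule G_var_prod)
    also have "t + int a * int q + int a + int (card (S - {Min S})) = t - 1 + int (a + 1) * int (Suc q)"
      unfolding c by (simp add: algebra_simps)
    finally show ?thesis .
  qed (simp add: w'_def)
  have w'0: "w' S U = 0" if "card S \<noteq> Suc q \<or> card U \<noteq> Suc l" for S U
  proof (cases "card S = Suc q \<and> Min S \<in> U")
    case True
    then have "card (U - {Min S}) \<noteq> l" using that card_Suc_Diff1[of U "Min S"] by auto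
    then show ?thesis using True by (simp add: w'_def wedge_def X0 del: card_Diff_insert)
  qed (auto simp: w'_def wedge_def)
  have w'c: "kd sm var (\<lambda>U. cd sm (\<lambda>i. var i ^ (a + 1)) (\<lambda>S. w' S U) S) U = 0" for S U
  proof -
    have "kd sm var (\<lambda>U. cd sm (\<lambda>i. var i ^ (a + 1)) (\<lambda>S. w' S U) S) U = cd sm (\<lambda>i. var i ^ (a + 1)) (\<lambda>S. sm (var_prod S ^ 1) (X S U)) S"
      unfolding kd_cd kdw' by simp
    also have "\<dots> = sm (var_prod S ^ 1) (cd sm (\<lambda>i. var i ^ a) (\<lambda>S. X S U) S)" by (rule phi_cd[symmetric])
    also have "\<dots> = 0" unfolding X_def cd_cd by simp
    finally show ?thesis .
  qed
  have "\<exists>b\<ge>a + 1. \<exists>u v. (\<forall>S U. u S U \<in> G (t - 1 + int b * (int (Suc q) - 1)) \<and> (Suc (card S) \<noteq> Suc q \<longrightarrow> u S U = 0))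
      \<and> (\<forall>S U. v S U \<in> G (t - 1 - 1 + int b * int (Suc q)) \<and> (card S \<noteq> Suc q \<longrightarrow> v S U = 0))
      \<and> (\<forall>S U. sm (var_prod S ^ (b - (a + 1))) (w' S U) = kd sm var (v S) U + cd sm (\<lambda>i. var i ^ b) (\<lambda>S. u S U) S)"
  proof (rule Suc.IH)
    show "CARD('n) < Suc l + k" using Suc.prems(1) by simp
    show "r < int (Suc q) + (t - 1)" using Suc.prems(2) by simp
    show "w' S U \<in> G (t - 1 + int (a + 1) * int (Suc q))" for S U by (rule w'G)
    show "w' S U = 0" if "card S \<noteq> Suc q \<or> card U \<noteq> Suc l" for S U using that by (rule w'0)
    show "kd sm var (\<lambda>U. cd sm (\<lambda>i. var i ^ (a + 1)) (\<lambda>S. w' S U) S) U = 0" for S U by (rule w'c)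
  qed
  then obtain b u' v' where b: "b \<ge> a + 1"
    and u': "\<forall>S U. u' S U \<in> G (t - 1 + int b * (int (Suc q) - 1)) \<and> (Suc (card S) \<noteq> Suc q \<longrightarrow> u' S U = 0)"
    and eq': "\<forall>S U. sm (var_prod S ^ (b - (a + 1))) (w' S U) = kd sm var (v' S) U + cd sm (\<lambda>i. var i ^ b) (\<lambda>S. u' S U) S"
    by blast
  have u'G: "u' S U \<in> G (t - 1 + int b * int q)" for S U using u' by simp
  have u'0: "u' S U = 0" if "card S \<noteq> q" for S U using u' that by simp
  note eq = eq'[rule_format]
  \<comment> \<open>Applying the Koszul differential to the decomposition of \<open>w'\<close> shows
    that the Koszul boundary of \<open>u'\<close> and \<open>w\<close>, over the exponent
    \<open>b\<close>, have the same Cech differential. Their difference \<open>y\<close> is a Cech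
    cocycle, so vanishing makes it a coboundary.\<close>
  define y where "y S U = sm (var_prod S ^ (b - a)) (w S U) - kd sm var (u' S) U" for S U
  have yc: "cd sm (\<lambda>i. var i ^ b) (\<lambda>S. y S U) T = 0" for T U
  proof -
    have ba: "b = a + (b - a)" "b - a = (b - (a + 1)) + 1" using b by auto
    have pw: "var_prod T ^ (b - a) = (var_prod T ^ (b - (a + 1)) * var_prod T :: ('n, 'k) mpoly)"
      using ba(2) by (metis power_add power_one_right)
    have "cd sm (\<lambda>i. var i ^ b) (\<lambda>S. kd sm var (u' S) U) T = kd sm var (\<lambda>U. kd sm var (v' T) U + cd sm (\<lambda>i. var i ^ b) (\<lambda>S. u' S U) T) U"
      by (simp add: kd_add kd_kd kd_cd)
    also have "\<dots> = sm (var_prod T ^ (b - (a + 1))) (sm (var_prod T) (X T U))"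
      unfolding eq[symmetric] kd_scale kdw' ..
    also have "\<dots> = sm (var_prod T ^ (b - a)) (X T U)"
      unfolding scale_scale pw ..
    also have "\<dots> = cd sm (\<lambda>i. var i ^ b) (\<lambda>S. sm (var_prod S ^ (b - a)) (w S U)) T"
      unfolding X_def phi_cd using ba(1) by simp
    finally show ?thesis unfolding y_def cd_diff by simp
  qed
  have yG: "y S U \<in> G (t + int b * int q)" for S U
  proof (cases "card S = q")
    case True
    have "sm (var_prod S ^ (b - a)) (w S U) \<in> G (t + int a * int q + int (b - a) * int (card S))"
      by (intro G_var_prod_power wG)
    also have "t + int a * int q + int (b - a) * int (card S) = t + int b * int q"
      using b True by (simp add: of_nat_diff algebra_simps)
    finally have 1: "sm (var_prod S ^ (b - a)) (w S U) \<in> G (t + int b * int q)" .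
    have "kd sm var (u' S) U \<in> G (t - 1 + int b * int q + 1)" by (intro G_kd u'G)
    then show ?thesis unfolding y_def using 1 by (intro G_diff) (simp_all add: algebra_simps)
  qed (simp add: y_def w0 u'0 kd_def)
  have "\<forall>U. \<exists>b' m'. b' \<ge> b \<and> (\<forall>S. m' S \<in> G (t + int b' * (int q - 1)) \<and> (Suc (card S) \<noteq> q \<longrightarrow> m' S = 0))
     \<and> (\<forall>S. card S = q \<longrightarrow> sm (var_prod S ^ (b' - b)) (y S U) = cd sm (\<lambda>i. var i ^ b') m' S)"
  proof
    fix U
    show "\<exists>b' m'. b' \<ge> b \<and> (\<forall>S. m' S \<in> G (t + int b' * (int q - 1)) \<and> (Suc (card S) \<noteq> q \<longrightarrow> m' S = 0))
     \<and> (\<forall>S. card S = q \<longrightarrow> sm (var_prod S ^ (b' - b)) (y S U) = cd sm (\<lambda>i. var i ^ b') m' S)"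
      using vanishing_representatives[OF van[OF Suc.prems(2)], of "\<lambda>S. y S U" b, OF yG yc] by metis
  qed
  from choice[OF this] obtain b' where "\<forall>U. \<exists>m'. b' U \<ge> b \<and> (\<forall>S. m' S \<in> G (t + int (b' U) * (int q - 1)) \<and> (Suc (card S) \<noteq> q \<longrightarrow> m' S = 0))
     \<and> (\<forall>S. card S = q \<longrightarrow> sm (var_prod S ^ (b' U - b)) (y S U) = cd sm (\<lambda>i. var i ^ b' U) m' S)" ..
  from choice[OF this] obtain m' where m': "\<forall>U. b' U \<ge> b \<and> (\<forall>S. m' U S \<in> G (t + int (b' U) * (int q - 1)) \<and> (Suc (card S) \<noteq> q \<longrightarrow> m' U S = 0))
     \<and> (\<forall>S. card S = q \<longrightarrow> sm (var_prod S ^ (b' U - b)) (y S U) = cd sm (\<lambda>i. var i ^ b' U) (m' U) S)" ..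
  have b': "b' U \<ge> b" and m'G: "m' U S \<in> G (t + int (b' U) * (int q - 1))"
    and m'0: "Suc (card S) \<noteq> q \<Longrightarrow> m' U S = 0"
    and m'eq: "card S = q \<Longrightarrow> sm (var_prod S ^ (b' U - b)) (y S U) = cd sm (\<lambda>i. var i ^ b' U) (m' U) S" for U S
    using m' by simp_all
  \<comment> \<open>The exponents found for the different \<open>U\<close> are made uniform by their
    sum.\<close>
  define B where "B = (\<Sum>U\<in>UNIV. b' U)"
  have B: "b' U \<le> B" for U unfolding B_def by (intro member_le_sum) auto
  have bB: "b \<le> B" using b' B order_trans by blast
  define u where "u S U = sm (var_prod S ^ (B - b' U)) (m' U S)" for S U
  define v where "v S U = sm (var_prod S ^ (B - b)) (u' S U)" for S U
  have "u S U \<in> G (t + int B * (int q - 1))" for S U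
  proof (cases "Suc (card S) = q")
    case True
    have "u S U \<in> G (t + int (b' U) * (int q - 1) + int (B - b' U) * int (card S))"
      unfolding u_def by (intro G_var_prod_power m'G)
    also have "t + int (b' U) * (int q - 1) + int (B - b' U) * int (card S) = t + int B * (int q - 1)"
      using B[of U] True by (auto simp: of_nat_diff algebra_simps)
    finally show ?thesis .
  qed (simp add: u_def m'0)
  moreover have "u S U = 0" if "Suc (card S) \<noteq> q" for S U using that by (simp add: u_def m'0)
  moreover have "v S U \<in> G (t - 1 + int B * int q)" for S U
  proof (cases "card S = q")
    case True
    have "v S U \<in> G (t - 1 + int b * int q + int (B - b) * int (card S))"
      unfolding v_def by (intro G_var_prod_power u'G)
    also have "t - 1 + int b * int q + int (B - b) * int (card S) = t - 1 + int B * int q"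
      using bB True by (auto simp: of_nat_diff algebra_simps)
    finally show ?thesis .
  qed (simp add: v_def u'0)
  moreover have "v S U = 0" if "card S \<noteq> q" for S U using that by (simp add: v_def u'0)
  moreover have "sm (var_prod S ^ (B - a)) (w S U) = kd sm var (v S) U + cd sm (\<lambda>i. var i ^ B) (\<lambda>S. u S U) S" for S U
  proof -
    have "B - a = (B - b) + (b - a)" using b bB by simp
    then have "sm (var_prod S ^ (B - a)) (w S U) = sm (var_prod S ^ (B - b)) (y S U + kd sm var (u' S) U)"
      unfolding y_def by (simp add: power_add)
    also have "\<dots> = sm (var_prod S ^ (B - b)) (y S U) + kd sm var (v S) U"
      using kd_scale[of var "var_prod S ^ (B - b)" "u' S" U] by (simp add: scale_right_distrib v_def[abs_def])
    also have "sm (var_prod S ^ (B - b)) (y S U) = cd sm (\<lambda>i. var i ^ B) (\<lambda>S. u S U) S"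
    proof (cases "card S = q")
      case True
      have "B - b = (B - b' U) + (b' U - b)" using B[of U] b'[of U] by simp
      then have "sm (var_prod S ^ (B - b)) (y S U) = sm (var_prod S ^ (B - b' U)) (sm (var_prod S ^ (b' U - b)) (y S U))"
        by (simp add: power_add)
      also have "\<dots> = cd sm (\<lambda>i. var i ^ (b' U + (B - b' U))) (\<lambda>S. u S U) S"
        unfolding m'eq[OF True] phi_cd u_def ..
      finally show ?thesis using B[of U] by simp
    next
      case False
      have "u (S - {i}) U = 0" if "i \<in> S" for i
        unfolding u_def using False card_Suc_Diff1[OF finite that] by (subst m'0) auto
      then have "cd sm (\<lambda>i. var i ^ B) (\<lambda>S. u S U) S = 0" unfolding cd_def by (intro sum.neutral) auto
      moreover have "y S U = 0" using False by (simp add: y_def w0 u'0 kd_def)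
      ultimately show ?thesis by simp
    qed
    finally show ?thesis by simp
  qed
  moreover have "B \<ge> a" using b bB by simp
  ultimately show ?case by blast
qed

text \<open>The chase is started in Cech degree 0 with exponent 0. At the empty set the Cech
  differential is an empty sum and the denominator is 1, so the decomposition there exhibits
  \<open>z\<close> as the boundary of \<open>v {}\<close>.\<close>

lemma koszul_exact:
  assumes van: "\<And>p t. r < int p + t \<Longrightarrow> local_cohomology_vanishes sm G p t"
    and j: "r < j" and z: "z \<in> kcycles sm var (G j) i"
  shows "z \<in> {kd sm var u | u. u \<in> kchains (G (j - 1)) (Suc i)}"
proof -
  define w where "w S U = (if S = {} then z U else 0)" for S :: "'n set" and U
  have zz: "\<And>U. z U \<in> G j" "\<And>U. card U \<noteq> i \<Longrightarrow> z U = 0" "\<And>U. kd sm var z U = 0"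
    using z by (auto simp: kcycles_def kchains_def)
  have kw: "kd sm var (w S) U = 0" for S U
    using zz(3) by (cases "S = {}") (simp_all add: w_def[abs_def])
  have "\<exists>b\<ge>0. \<exists>u v. (\<forall>S U. u S U \<in> G (j + int b * (int 0 - 1)) \<and> (Suc (card S) \<noteq> 0 \<longrightarrow> u S U = 0))
      \<and> (\<forall>S U. v S U \<in> G (j - 1 + int b * int 0) \<and> (card S \<noteq> 0 \<longrightarrow> v S U = 0))
      \<and> (\<forall>S U. sm (var_prod S ^ (b - 0)) (w S U) = kd sm var (v S) U + cd sm (\<lambda>i. var i ^ b) (\<lambda>S. u S U) S)"
    by (rule cech_koszul_chase[OF van, where l = i and k = "Suc CARD('n)"])
      (use j zz in \<open>auto simp: w_def kd_cd kw[unfolded w_def[abs_def]]\<close>)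
  then obtain b u v where v: "\<forall>S U. v S U \<in> G (j - 1 + int b * int 0) \<and> (card S \<noteq> 0 \<longrightarrow> v S U = 0)"
    and eq: "\<forall>S U. sm (var_prod S ^ (b - 0)) (w S U) = kd sm var (v S) U + cd sm (\<lambda>i. var i ^ b) (\<lambda>S. u S U) S"
    by blast
  have eq': "z U = kd sm var (v {}) U" for U using eq[rule_format, of "{}" U] by (simp add: w_def cd_def)
  \<comment> \<open>The chase does not record the Koszul degree of \<open>v\<close>; cutting off the
    components of other degrees does not change the part of the boundary in degree
    \<open>i\<close>.\<close>
  define x where "x U = (if card U = Suc i then v {} U else 0)" for U
  have "x \<in> kchains (G (j - 1)) (Suc i)" using v by (auto simp: kchains_def x_def)
  moreover have "kd sm var x U = z U" for U
  proof (cases "card U = i")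
    case True
    then have "kd sm var x U = kd sm var (v {}) U" unfolding kd_def by (intro sum.cong) (auto simp: x_def)
    then show ?thesis using eq' by simp
  next
    case False
    then have "kd sm var x U = 0" unfolding kd_def by (intro sum.neutral) (auto simp: x_def)
    then show ?thesis using zz(2)[OF False] by simp
  qed
  then have "z = kd sm var x" by auto
  ultimately show ?thesis by blast
qed

end

section \<open>Homogeneous components\<close>

definition mdeg :: "('n::finite \<Rightarrow>\<^sub>0 nat) \<Rightarrow> nat" where
  "mdeg \<alpha> = (\<Sum>i\<in>UNIV. lookup \<alpha> i)"

lemma mdeg_add: "mdeg (\<alpha> + \<beta>) = mdeg \<alpha> + mdeg \<beta>"
  by (simp add: mdeg_def lookup_add sum.distrib)

lemma mdeg_zero [simp]: "mdeg 0 = 0" by (simp add: mdeg_def)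

lemma homogeneous_iff: "homogeneous e f \<longleftrightarrow> (\<forall>\<alpha>. lookup f \<alpha> \<noteq> 0 \<longrightarrow> mdeg \<alpha> = e)"
  by (auto simp: homogeneous_def mdeg_def in_keys_iff)

lemma homogeneous_zero [simp]: "homogeneous e 0"
  by (simp add: homogeneous_iff)

lemma homogeneous_add: "homogeneous e f \<Longrightarrow> homogeneous e g \<Longrightarrow> homogeneous e (f + g)"
  by (auto simp: homogeneous_iff lookup_add) (metis add.right_neutral)

lemma homogeneous_single: "homogeneous (mdeg \<alpha>) (Poly_Mapping.single \<alpha> c)"
  by (auto simp: homogeneous_iff lookup_single when_def)

lemma homogeneous_const: "homogeneous 0 (const c)"
  using homogeneous_single[of 0 c] by (simp add: const_def)

lemma homogeneous_sum: "(\<And>i. i \<in> A \<Longrightarrow> homogeneous e (f i)) \<Longrightarrow> homogeneous e (sum f A)"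
  by (induction A rule: infinite_finite_induct) (auto intro: homogeneous_add)

lemma homogeneous_mult:
  assumes "homogeneous d f" "homogeneous e g"
  shows "homogeneous (d + e) (f * g)"
proof -
  have "f * g = (\<Sum>\<alpha>\<in>keys f. \<Sum>\<beta>\<in>keys g. Poly_Mapping.single (\<alpha> + \<beta>) (lookup f \<alpha> * lookup g \<beta>))"
    by (subst (1) poly_mapping_eq_sum_single[of f], subst (1) poly_mapping_eq_sum_single[of g])
      (simp add: sum_product mult_single)
  also have "homogeneous (d + e) \<dots>"
  proof (intro homogeneous_sum)
    fix \<alpha> \<beta> assume "\<alpha> \<in> keys f" "\<beta> \<in> keys g"
    then have "d + e = mdeg (\<alpha> + \<beta>)" using assms by (auto simp: homogeneous_iff in_keys_iff mdeg_add)
    then show "homogeneous (d + e) (Poly_Mapping.single (\<alpha> + \<beta>) (lookup f \<alpha> * lookup g \<beta>))"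
      using homogeneous_single by metis
  qed
  finally show ?thesis .
qed

definition hc :: "nat \<Rightarrow> ('n::finite, 'k::field) mpoly \<Rightarrow> ('n, 'k) mpoly" where
  "hc e f = (\<Sum>\<alpha>\<in>{\<alpha>\<in>keys f. mdeg \<alpha> = e}. Poly_Mapping.single \<alpha> (lookup f \<alpha>))"

lemma lookup_hc: "lookup (hc e f) \<alpha> = (if mdeg \<alpha> = e then lookup f \<alpha> else 0)"
proof -
  have "lookup (hc e f) \<alpha> = (\<Sum>\<beta>\<in>{\<beta>\<in>keys f. mdeg \<beta> = e}. if \<beta> = \<alpha> then lookup f \<alpha> else 0)"
    unfolding hc_def lookup_sum by (intro sum.cong) (auto simp: lookup_single when_def)
  also have "\<dots> = (if mdeg \<alpha> = e then lookup f \<alpha> else 0)" by (auto simp: in_keys_iff)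
  finally show ?thesis .
qed

lemma homogeneous_hc: "homogeneous e (hc e f)"
  by (simp add: homogeneous_iff lookup_hc)

lemma hc_add: "hc e (f + g) = hc e f + hc e g"
  by (rule poly_mapping_eqI) (simp add: lookup_hc lookup_add)

lemma hc_zero [simp]: "hc e 0 = 0"
  by (rule poly_mapping_eqI) (simp add: lookup_hc)

lemma hc_homogeneous: "homogeneous d f \<Longrightarrow> hc e f = (if e = d then f else 0)"
  by (rule poly_mapping_eqI) (auto simp: lookup_hc homogeneous_iff)

lemma hc_sum: "hc e (sum f A) = (\<Sum>i\<in>A. hc e (f i))"
  by (induction A rule: infinite_finite_induct) (auto simp: hc_add)

lemma sum_hc:
  assumes "finite E" "mdeg ` keys f \<subseteq> E"
  shows "f = (\<Sum>e\<in>E. hc e f)"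
proof (rule poly_mapping_eqI)
  fix \<alpha>
  have "lookup (\<Sum>e\<in>E. hc e f) \<alpha> = (\<Sum>e\<in>E. if e = mdeg \<alpha> then lookup f \<alpha> else 0)"
    unfolding lookup_sum by (intro sum.cong) (auto simp: lookup_hc)
  also have "\<dots> = (if mdeg \<alpha> \<in> E then lookup f \<alpha> else 0)" using assms(1) by simp
  also have "\<dots> = lookup f \<alpha>"
  proof (cases "\<alpha> \<in> keys f")
    case True
    then have "mdeg \<alpha> \<in> E" using assms(2) by blast
    then show ?thesis by simp
  qed (simp add: in_keys_iff)
  finally show "lookup f \<alpha> = lookup (\<Sum>e\<in>E. hc e f) \<alpha>" by simp
qed

lemma finite_mdeg: "finite {\<alpha> :: 'n::finite \<Rightarrow>\<^sub>0 nat. mdeg \<alpha> = t}"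
proof -
  have "lookup \<alpha> \<in> Pi\<^sub>E UNIV (\<lambda>_. {..t})" if "mdeg \<alpha> = t" for \<alpha> :: "'n \<Rightarrow>\<^sub>0 nat"
    using that member_le_sum[of _ UNIV "lookup \<alpha>"] by (auto simp: mdeg_def PiE_UNIV_domain)
  then have "lookup ` {\<alpha> :: 'n \<Rightarrow>\<^sub>0 nat. mdeg \<alpha> = t} \<subseteq> Pi\<^sub>E UNIV (\<lambda>_. {..t})" by blast
  then have "finite (lookup ` {\<alpha> :: 'n \<Rightarrow>\<^sub>0 nat. mdeg \<alpha> = t})"
    by (rule finite_subset) (intro finite_PiE, auto)
  then show ?thesis by (rule finite_imageD) (rule inj_onI, simp only: poly_mapping_eq_iff[symmetric])
qed

lemma homogeneous_sum_monomials:
  assumes "homogeneous t f"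
  shows "f = (\<Sum>\<alpha>\<in>{\<alpha>. mdeg \<alpha> = t}. const (lookup f \<alpha>) * Poly_Mapping.single \<alpha> 1)"
proof -
  have "f = (\<Sum>\<alpha>\<in>keys f. const (lookup f \<alpha>) * Poly_Mapping.single \<alpha> 1)" by (rule mpoly_span_monomials)
  also have "\<dots> = (\<Sum>\<alpha>\<in>{\<alpha>. mdeg \<alpha> = t}. const (lookup f \<alpha>) * Poly_Mapping.single \<alpha> 1)"
    using assms by (intro sum.mono_neutral_left) (auto simp: finite_mdeg homogeneous_iff in_keys_iff)
  finally show ?thesis .
qed

section \<open>Projections onto the graded components of a module\<close>

context graded
begin

definition dec :: "'m \<Rightarrow> int \<Rightarrow>\<^sub>0 'm" where
  "dec x = (THE c. (\<forall>t. lookup c t \<in> G t) \<and> x = (\<Sum>t\<in>keys c. lookup c t))"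

definition comp :: "int \<Rightarrow> 'm \<Rightarrow> 'm" where
  "comp t x = lookup (dec x) t"

lemma dec_ex1: "\<exists>!c. (\<forall>t. lookup c t \<in> G t) \<and> x = (\<Sum>t\<in>keys c. lookup c t)"
  using gr unfolding graded_module_def by blast

lemma dec_props: "(\<forall>t. lookup (dec x) t \<in> G t) \<and> x = (\<Sum>t\<in>keys (dec x). lookup (dec x) t)"
  unfolding dec_def by (rule theI'[OF dec_ex1])

lemma dec_eqI: "(\<And>t. lookup c t \<in> G t) \<Longrightarrow> x = (\<Sum>t\<in>keys c. lookup c t) \<Longrightarrow> dec x = c"
  using dec_ex1[of x] dec_props[of x] by blast

lemma comp_in [simp]: "comp t x \<in> G t"
  using dec_props by (simp add: comp_def)

lemma sum_comp:
  assumes "finite T" "keys (dec x) \<subseteq> T"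
  shows "x = (\<Sum>t\<in>T. comp t x)"
proof -
  have "x = (\<Sum>t\<in>keys (dec x). comp t x)" using dec_props by (simp add: comp_def)
  also have "\<dots> = (\<Sum>t\<in>T. comp t x)"
    using assms by (intro sum.mono_neutral_left) (auto simp: comp_def in_keys_iff)
  finally show ?thesis .
qed

lemma comp_add: "comp t (x + y) = comp t x + comp t y"
proof -
  let ?T = "keys (dec x) \<union> keys (dec y)" and ?c = "dec x + dec y"
  have "(\<Sum>t\<in>keys ?c. lookup ?c t) = (\<Sum>t\<in>?T. lookup ?c t)"
    using Poly_Mapping.keys_add[of "dec x" "dec y"] by (intro sum.mono_neutral_left) (auto simp: in_keys_iff)
  also have "\<dots> = (\<Sum>t\<in>?T. comp t x) + (\<Sum>t\<in>?T. comp t y)"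
    by (simp add: comp_def lookup_add sum.distrib)
  also have "\<dots> = x + y" using sum_comp[of ?T x] sum_comp[of ?T y] by simp
  finally have "dec (x + y) = ?c" using dec_props by (intro dec_eqI) (auto simp: lookup_add G_add)
  then show ?thesis by (simp add: comp_def lookup_add)
qed

lemma comp_homogeneous: "x \<in> G s \<Longrightarrow> comp t x = (if t = s then x else 0)"
proof -
  assume x: "x \<in> G s"
  have "dec x = Poly_Mapping.single s x"
    by (rule dec_eqI) (use x in \<open>auto simp: lookup_single when_def\<close>)
  then show ?thesis by (auto simp: comp_def lookup_single when_def)
qed

lemma comp_zero [simp]: "comp t 0 = 0" using comp_homogeneous[of 0 t t] by simp

sublocale comp: additive "comp t" for t by unfold_locales (rule comp_add)

lemma comp_scale:
  assumes "homogeneous e f"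
  shows "comp (t + int e) (sm f x) = sm f (comp t x)"
proof -
  let ?T = "insert t (keys (dec x))"
  have x: "x = (\<Sum>s\<in>?T. comp s x)" by (rule sum_comp) auto
  have "comp (t + int e) (sm f x) = (\<Sum>s\<in>?T. comp (t + int e) (sm f (comp s x)))"
    by (subst x) (simp only: scale_sum_right comp.sum)
  also have "\<dots> = (\<Sum>s\<in>?T. if s = t then sm f (comp t x) else 0)"
    using comp_homogeneous[OF G_homogeneous[OF assms comp_in]] by (intro sum.cong) auto
  also have "\<dots> = sm f (comp t x)" by simp
  finally show ?thesis .
qed

lemma comp_kd: "kd sm var (\<lambda>U. comp t (w U)) U = comp (t + 1) (kd sm var w U)"
proof -
  have "comp (t + 1) (sm (sg i U * var i) x) = sm (sg i U * var i) (comp t x)" for i x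
  proof -
    have "homogeneous (0 + 1) (sg i U * var i :: ('n, 'k) mpoly)"
    proof (rule homogeneous_mult)
      have "homogeneous 0 (const (sg i U) :: ('n, 'k) mpoly)" by (rule homogeneous_const)
      moreover have "const (sg i U) = (sg i U :: ('n, 'k) mpoly)"
      proof -
        have "const (-1) = (-1 :: ('n, 'k) mpoly)" unfolding const_def by (simp add: single_uminus)
        then show ?thesis unfolding sg_def by (induction "card {j\<in>U. j < i}") (auto simp: const_mult minus_one_power_iff)
      qed
      ultimately show "homogeneous 0 (sg i U :: ('n, 'k) mpoly)" by simp
    qed (rule homogeneous_var)
    then show ?thesis using comp_scale[of 1 "sg i U * var i" t x] by simp
  qed
  then show ?thesis by (simp add: kd_def comp.sum)
qed

lemma comp_scale_general:
  assumes "g \<in> G a"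
  shows "comp t (sm f g) = sm (if a \<le> t then hc (nat (t - a)) f else 0) g"
proof -
  let ?E = "insert (nat (t - a)) (mdeg ` keys f)"
  have f: "f = (\<Sum>e\<in>?E. hc e f)" by (rule sum_hc) auto
  have "comp t (sm f g) = (\<Sum>e\<in>?E. comp t (sm (hc e f) g))"
    by (subst f) (simp only: scale_sum_left comp.sum)
  also have "\<dots> = (\<Sum>e\<in>?E. if e = nat (t - a) then sm (if a \<le> t then hc e f else 0) g else 0)"
    using comp_homogeneous[OF G_homogeneous[OF homogeneous_hc assms]] by (intro sum.cong) auto
  also have "\<dots> = sm (if a \<le> t then hc (nat (t - a)) f else 0) g" by simp
  finally show ?thesis .
qed

text \<open>The homogeneous components of finitely many generators generate, and projecting a
  representation of \<open>x\<close> to degree \<open>t\<close> makes the coefficients homogeneous.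
  For \<open>t < a\<close> the number \<open>nat (t - a)\<close> is 0 and would admit constants,
  hence the separate clause.\<close>

lemma homogeneous_generators:
  assumes "finitely_generated sm"
  shows "\<exists>J. finite J \<and> (\<forall>(a, g)\<in>J. g \<in> G a) \<and> (\<forall>t. \<forall>x\<in>G t. \<exists>f.
     (\<forall>(a, g)\<in>J. homogeneous (nat (t - a)) (f (a, g)) \<and> (t < a \<longrightarrow> f (a, g) = 0)) \<and> x = (\<Sum>(a, g)\<in>J. sm (f (a, g)) g))"
proof -
  obtain B where B: "finite B" "span B = UNIV" using assms unfolding finitely_generated_def by blast
  \<comment> \<open>Pairing each component with its degree makes the indexing injective, as the
    reindexing of the sum below demands.\<close>
  define J where "J = (\<Union>b\<in>B. (\<lambda>s. (s, comp s b)) ` keys (dec b))"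
  have J: "finite J" "\<And>j. j \<in> J \<Longrightarrow> snd j \<in> G (fst j)" using B(1) by (auto simp: J_def)
  define L where "L = {\<Sum>j\<in>J. sm (f j) (snd j) | f. True}"
  have "subspace L"
  proof (rule subspaceI)
    show "0 \<in> L" unfolding L_def by (intro CollectI exI[of _ "\<lambda>_. 0"]) simp
  next
    fix x y assume "x \<in> L" "y \<in> L"
    then obtain f g where "x = (\<Sum>j\<in>J. sm (f j) (snd j))" "y = (\<Sum>j\<in>J. sm (g j) (snd j))" unfolding L_def by blast
    then show "x + y \<in> L" unfolding L_def
      by (intro CollectI exI[of _ "\<lambda>j. f j + g j"]) (simp add: scale_left_distrib sum.distrib)
  next
    fix c x assume "x \<in> L"
    then obtain f where "x = (\<Sum>j\<in>J. sm (f j) (snd j))" unfolding L_def by blast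
    then show "sm c x \<in> L" unfolding L_def
      by (intro CollectI exI[of _ "\<lambda>j. c * f j"]) (simp add: scale_sum_right)
  qed
  moreover have "B \<subseteq> L"
  proof
    fix b assume b: "b \<in> B"
    let ?h = "\<lambda>s. (s, comp s b)"
    have "b = (\<Sum>s\<in>keys (dec b). comp s b)" by (rule sum_comp) auto
    also have "\<dots> = (\<Sum>j\<in>?h ` keys (dec b). snd j)" by (subst sum.reindex) (auto intro: inj_onI)
    also have "\<dots> = (\<Sum>j\<in>J. sm (if j \<in> ?h ` keys (dec b) then 1 else 0) (snd j))"
      using b J(1) by (intro sum.mono_neutral_cong_left) (auto simp: J_def)
    finally show "b \<in> L" unfolding L_def by (intro CollectI exI conjI TrueI)
  qed
  ultimately have L: "L = UNIV" using span_minimal[of B L] B by auto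
  have "\<exists>f. (\<forall>(a, g)\<in>J. homogeneous (nat (t - a)) (f (a, g)) \<and> (t < a \<longrightarrow> f (a, g) = 0)) \<and> x = (\<Sum>(a, g)\<in>J. sm (f (a, g)) g)"
    if x: "x \<in> G t" for t x
  proof -
    obtain f where f: "x = (\<Sum>j\<in>J. sm (f j) (snd j))" using L unfolding L_def by blast
    define f' where "f' j = (if fst j \<le> t then hc (nat (t - fst j)) (f j) else 0)" for j
    have "x = comp t x" using comp_homogeneous[OF x] by simp
    also have "\<dots> = (\<Sum>j\<in>J. comp t (sm (f j) (snd j)))" by (subst f) (rule comp.sum)
    also have "\<dots> = (\<Sum>j\<in>J. sm (f' j) (snd j))"
      by (intro sum.cong) (auto simp: f'_def comp_scale_general[OF J(2)])
    finally have x': "x = (\<Sum>(a, g)\<in>J. sm (f' (a, g)) g)" by (simp add: case_prod_unfold)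
    show ?thesis
      by (rule exI[of _ f'], rule conjI[OF _ x']) (auto simp: f'_def homogeneous_hc)
  qed
  then show ?thesis using J by (intro exI[of _ J]) fastforce
qed

sublocale k: vector_space "kscale sm" by (rule vector_space_kscale) unfold_locales

lemma subspace_G: "k.subspace (G t)"
  by (rule k.subspaceI) (use G_homogeneous[OF homogeneous_const, of _ t] in \<open>auto simp: G_add kscale_def\<close>)

text \<open>Monomials of the right degree times homogeneous generators span \<open>G t\<close>, so
  it is finite-dimensional and \<open>dim\<close> has its intended value.\<close>

lemma qdim_hilbert_function:
  assumes "finitely_generated sm"
  shows "qdim (kscale sm) (G t) {0} (hilbert_function sm G t)"
proof -
  obtain J where J: "finite J" "\<And>x. x \<in> G t \<Longrightarrow> \<exists>f.
     (\<forall>(a, g)\<in>J. homogeneous (nat (t - a)) (f (a, g))) \<and> x = (\<Sum>(a, g)\<in>J. sm (f (a, g)) g)"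
    using homogeneous_generators[OF assms] by (fastforce simp: case_prod_unfold)
  define T where "T = (\<Union>(a, g)\<in>J. (\<lambda>\<alpha>. sm (Poly_Mapping.single \<alpha> 1) g) ` {\<alpha>. mdeg \<alpha> = nat (t - a)})"
  have T: "finite T" unfolding T_def using J(1) finite_mdeg by (auto simp: case_prod_unfold)
  have "G t \<subseteq> k.span T"
  proof
    fix x assume "x \<in> G t"
    then obtain f where f: "\<And>a g. (a, g) \<in> J \<Longrightarrow> homogeneous (nat (t - a)) (f (a, g))" "x = (\<Sum>(a, g)\<in>J. sm (f (a, g)) g)"
      using J(2) by blast
    have "sm (f (a, g)) g \<in> k.span T" if ag: "(a, g) \<in> J" for a g
    proof -
      have "sm (f (a, g)) g = (\<Sum>\<alpha>\<in>{\<alpha>. mdeg \<alpha> = nat (t - a)}. kscale sm (lookup (f (a, g)) \<alpha>) (sm (Poly_Mapping.single \<alpha> 1) g))"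
        by (subst homogeneous_sum_monomials[OF f(1)[OF ag]]) (simp add: scale_sum_left kscale_def)
      also have "\<dots> \<in> k.span T"
        using ag by (intro k.span_sum k.span_scale k.span_base) (auto simp: T_def)
      finally show ?thesis .
    qed
    then show "x \<in> k.span T" unfolding f(2) by (intro k.span_sum) auto
  qed
  then obtain n where "qdim (kscale sm) (G t) {0} n"
    using k.qdim_exists[OF subspace_G k.subspace_single_0 T] by blast
  then show ?thesis using k.qdim_dim[OF subspace_G] unfolding hilbert_function_def by metis
qed

section \<open>The Betti numbers\<close>

sublocale fk: vector_space "fscale (kscale sm) :: 'k \<Rightarrow> ('n set \<Rightarrow> 'm) \<Rightarrow> _"
  by (rule vector_space_fscale) unfold_locales

text \<open>Removing one index \<open>V\<close> from the support splits off one copy of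
  \<open>N\<close>, given by evaluation at \<open>V\<close>.\<close>

lemma qdim_supported:
  assumes N: "k.subspace N" and h: "qdim (kscale sm) N {0} h" and A: "finite A"
  shows "qdim (fscale (kscale sm)) {w :: 'n set \<Rightarrow> 'm. \<forall>U. w U \<in> N \<and> (U \<notin> A \<longrightarrow> w U = 0)} {0} (card A * h)"
  using A
proof (induction A)
  case empty
  have e: "{w :: 'n set \<Rightarrow> 'm. \<forall>U. w U \<in> N \<and> (U \<notin> {} \<longrightarrow> w U = 0)} = {0}"
    using k.subspace_0[OF N] by (auto simp: fun_eq_iff)
  show ?case unfolding e card.empty mult_0 by (rule fk.qdim_self[OF fk.subspace_single_0])
next
  case (insert V A)
  let ?C = "\<lambda>A. {w :: 'n set \<Rightarrow> 'm. \<forall>U. w U \<in> N \<and> (U \<notin> A \<longrightarrow> w U = 0)}"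
  have sub: "fk.subspace (?C A)" for A
    by (rule fk.subspaceI) (auto simp: k.subspace_0[OF N] k.subspace_add[OF N] k.subspace_scale[OF N])
  have q: "qdim (fscale (kscale sm)) (?C (insert V A)) (?C A) h"
  proof (rule qdim_transfer[where \<rho> = "\<lambda>w v. w V = v", OF _ _ _ _ _ sub N _ _ _ h])
    fix z assume "z \<in> N"
    then show "\<exists>w\<in>?C (insert V A). w V = z"
      by (intro bexI[of _ "\<lambda>U. if U = V then z else 0"]) (auto simp: k.subspace_0[OF N])
  next
    show "vector_space (fscale (kscale sm) :: 'k \<Rightarrow> ('n set \<Rightarrow> 'm) \<Rightarrow> _)" "vector_space (kscale sm)" by unfold_locales
  next
    fix z z' assume "z \<in> ?C (insert V A)" "z V = z'"
    then show "z \<in> ?C A \<longleftrightarrow> z' \<in> {0}" using insert.hyps by auto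
  qed auto
  have "qdim (fscale (kscale sm)) (?C (insert V A)) {0} (h + card A * h)"
    by (rule fk.qdim_add[OF sub _ _ q insert.IH]) (auto simp: k.subspace_0[OF N])
  moreover have "card (insert V A) * h = h + card A * h" using insert.hyps by simp
  ultimately show ?case by (simp only:)
qed

lemma qdim_kchains:
  assumes "finitely_generated sm"
  shows "qdim (fscale (kscale sm)) (kchains (G t) q :: ('n set \<Rightarrow> 'm) set) {0} ((CARD('n) choose q) * hilbert_function sm G t)"
proof -
  have "card {U :: 'n set. card U = q} = CARD('n) choose q"
    using n_subsets[of "UNIV :: 'n set" q] by simp
  moreover have "kchains (G t) q = {w :: 'n set \<Rightarrow> 'm. \<forall>U. w U \<in> G t \<and> (U \<notin> {U. card U = q} \<longrightarrow> w U = 0)}"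
    by (simp add: kchains_def)
  moreover have "qdim (fscale (kscale sm)) {w :: 'n set \<Rightarrow> 'm. \<forall>U. w U \<in> G t \<and> (U \<notin> {U. card U = q} \<longrightarrow> w U = 0)} {0}
      (card {U :: 'n set. card U = q} * hilbert_function sm G t)"
    by (rule qdim_supported[OF subspace_G qdim_hilbert_function[OF assms]]) simp
  ultimately show ?thesis by (simp only:)
qed

lemma subspace_kchains_G: "fk.subspace (kchains (G t) q)"
  by (rule subspace_kchains[OF _ subspace_G]) unfold_locales

lemma subspace_kcycles_G: "fk.subspace (kcycles sm var (G t) q)"
  by (rule subspace_kcycles[OF _ subspace_G]) unfold_locales

text \<open>For \<open>j \<ge> r\<close> the differential maps the chains of degree
  \<open>i + 1\<close> over \<open>G j\<close> onto the cycles of degree \<open>i\<close> over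
  \<open>G (j + 1)\<close>, by exactness in coefficient degree \<open>j + 1 > r\<close>; its kernel
  consists of the cycles over \<open>G j\<close>. Unrolling this recursion for dimensions gives the
  alternating sum.\<close>

lemma qdim_kcycles:
  assumes fg: "finitely_generated sm"
    and van: "\<And>p t. r < int p + t \<Longrightarrow> local_cohomology_vanishes sm G p t"
    and j: "r \<le> j"
  shows "\<exists>b. qdim (fscale (kscale sm)) (kcycles sm var (G j) i) {0} b
    \<and> int b = (\<Sum>q\<le>i. (-1) ^ q * int (CARD('n) choose (i - q)) * int (hilbert_function sm G (j + int q)))"
  using j
proof (induction i arbitrary: j)
  case 0
  have e: "kcycles sm var (G j) 0 = kchains (G j) 0"
    by (auto simp: kcycles_def kchains_def kd_def intro!: sum.neutral)
  have "qdim (fscale (kscale sm)) (kcycles sm var (G j) 0) {0} (hilbert_function sm G j)"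
    unfolding e using qdim_kchains[OF fg, of j 0] by (simp only: binomial_n_0 mult_1)
  moreover have "int (hilbert_function sm G j) =
      (\<Sum>q\<le>0. (-1) ^ q * int (CARD('n) choose (0 - q)) * int (hilbert_function sm G (j + int q)))" by simp
  ultimately show ?case by blast
next
  case (Suc i)
  let ?C = "kchains (G j) (Suc i) :: ('n set \<Rightarrow> 'm) set" and ?Z = "kcycles sm var (G j) (Suc i)"
  obtain b' where b': "qdim (fscale (kscale sm)) (kcycles sm var (G (j + 1)) i) {0} b'"
    "int b' = (\<Sum>q\<le>i. (-1) ^ q * int (CARD('n) choose (i - q)) * int (hilbert_function sm G (j + 1 + int q)))"
  proof -
    have "r \<le> j + 1" using Suc.prems by simp
    from Suc.IH[OF this] show ?thesis using that by blast
  qed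
  have ZC: "?Z \<subseteq> ?C" by (auto simp: kcycles_def)
  have "qdim (fscale (kscale sm)) ?C ?Z b'"
  proof (rule qdim_transfer[where \<rho> = "\<lambda>w z. z = kd sm var w", OF _ _ _ _ _ subspace_kchains_G subspace_kcycles_G _ _ _ b'(1)])
    show "vector_space (fscale (kscale sm) :: 'k \<Rightarrow> ('n set \<Rightarrow> 'm) \<Rightarrow> _)" "vector_space (fscale (kscale sm) :: 'k \<Rightarrow> ('n set \<Rightarrow> 'm) \<Rightarrow> _)" by unfold_locales
    show "0 = kd sm var (0 :: 'n set \<Rightarrow> 'm)" using kd_zero[of var] by (auto simp: fun_eq_iff zero_fun_def)
    fix x x' y y' :: "'n set \<Rightarrow> 'm" assume "x' = kd sm var x" "y' = kd sm var y"
    then show "x' + y' = kd sm var (x + y)" using kd_add[of var x y] by (auto simp: fun_eq_iff plus_fun_def)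
  next
    fix c and x x' :: "'n set \<Rightarrow> 'm" assume "x' = kd sm var x"
    then show "fscale (kscale sm) c x' = kd sm var (fscale (kscale sm) c x)"
      using kd_scale[of var "const c" x] by (auto simp: fun_eq_iff fscale_def kscale_def)
  next
    fix z assume z: "z \<in> ?C"
    have "kd sm var z U \<in> G (j + 1)" for U using z by (intro G_kd) (auto simp: kchains_def)
    moreover have "kd sm var z U = 0" if "card U \<noteq> i" for U
      unfolding kd_def using that z by (intro sum.neutral) (auto simp: kchains_def)
    ultimately have "kd sm var z \<in> kcycles sm var (G (j + 1)) i" by (auto simp: kcycles_def kchains_def kd_kd)
    then show "\<exists>z'\<in>kcycles sm var (G (j + 1)) i. z' = kd sm var z" by blast
  next
    fix z' assume "z' \<in> kcycles sm var (G (j + 1)) i"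
    then show "\<exists>z\<in>?C. z' = kd sm var z"
      using koszul_exact[where r = r and j = "j + 1" and z = z' and i = i, OF van] Suc.prems by auto
  next
    fix z z' :: "'n set \<Rightarrow> 'm" assume "z \<in> ?C" "z' = kd sm var z"
    then show "z \<in> ?Z \<longleftrightarrow> z' \<in> {0}" by (auto simp: kcycles_def fun_eq_iff)
  qed
  moreover obtain b where b: "qdim (fscale (kscale sm)) ?Z {0} b"
  proof -
    have "\<exists>B. finite B \<and> card B = (CARD('n) choose (Suc i)) * hilbert_function sm G j \<and> B \<subseteq> ?C \<and> fk.independent B \<and> fk.span B \<inter> {0} = {0} \<and> fk.span (B \<union> {0}) = ?C"
      by (rule fk.qdim_imp_set_basis[OF subspace_kchains_G _ _ qdim_kchains[OF fg]])
        (use fk.subspace_0[OF subspace_kchains_G] in auto)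
    then obtain B where B: "finite B" "fk.span (B \<union> {0}) = ?C" by blast
    then have "finite (B \<union> {0})" "?Z \<subseteq> fk.span (B \<union> {0})" using ZC by simp_all
    from fk.qdim_exists[OF subspace_kcycles_G fk.subspace_single_0 this] show ?thesis using that by blast
  qed
  ultimately have "qdim (fscale (kscale sm)) ?C {0} (b' + b)"
    using fk.subspace_0[OF subspace_kcycles_G] by (intro fk.qdim_add[OF subspace_kcycles_G _ ZC]) simp_all
  then have eq: "b' + b = (CARD('n) choose Suc i) * hilbert_function sm G j"
    by (rule fk.qdim_unique[OF fk.subspace_single_0 _ qdim_kchains[OF fg]])
  \<comment> \<open>The summand \<open>q = 0\<close> is the dimension of the chain space; the others
    form the negative of the sum for \<open>j + 1\<close>.\<close>
  have "(\<Sum>q\<le>Suc i. (-1) ^ q * int (CARD('n) choose (Suc i - q)) * int (hilbert_function sm G (j + int q)))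
      = int (CARD('n) choose Suc i) * int (hilbert_function sm G j) - int b'"
    unfolding b'(2) sum.atMost_Suc_shift by (simp add: sum_negf add_ac)
  also have "\<dots> = int b" using eq by (simp flip: of_nat_mult of_nat_add)
  finally show ?case using b by metis
qed

text \<open>In coefficient degree \<open>r\<close> nothing nonzero bounds because
  \<open>G (r - 1)\<close> is zero, above \<open>r\<close> every cycle bounds, and below
  \<open>r\<close> all chains are zero. So the projection to degree \<open>r\<close> identifies
  homology with a space of cycles.\<close>

lemma qdim_koszul_homology:
  assumes van: "\<And>p t. r < int p + t \<Longrightarrow> local_cohomology_vanishes sm G p t"
    and low: "\<And>t. t < r \<Longrightarrow> G t = {0}"
    and b: "qdim (fscale (kscale sm)) (kcycles sm var (G r) i) {0} b"
  shows "qdim (fscale (kscale sm)) (kcycles sm var UNIV i) (kboundaries sm var UNIV i) b"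
proof (rule qdim_transfer[where \<rho> = "\<lambda>z z'. z' = (\<lambda>U. comp r (z U))", OF _ _ _ _ _ _ subspace_kcycles_G _ _ _ b])
  show "vector_space (fscale (kscale sm) :: 'k \<Rightarrow> ('n set \<Rightarrow> 'm) \<Rightarrow> _)" "vector_space (fscale (kscale sm) :: 'k \<Rightarrow> ('n set \<Rightarrow> 'm) \<Rightarrow> _)" by unfold_locales
  show "0 = (\<lambda>U. comp r ((0 :: 'n set \<Rightarrow> 'm) U))" by (auto simp: fun_eq_iff)
  show "fk.subspace (kcycles sm var UNIV i)" by (rule subspace_kcycles) (unfold_locales, simp)
  fix x x' y y' :: "'n set \<Rightarrow> 'm" assume "x' = (\<lambda>U. comp r (x U))" "y' = (\<lambda>U. comp r (y U))"
  then show "x' + y' = (\<lambda>U. comp r ((x + y) U))" by (auto simp: fun_eq_iff comp_add)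
next
  fix c and x x' :: "'n set \<Rightarrow> 'm" assume "x' = (\<lambda>U. comp r (x U))"
  then show "fscale (kscale sm) c x' = (\<lambda>U. comp r (fscale (kscale sm) c x U))"
    using comp_scale[OF homogeneous_const, of r] by (auto simp: fun_eq_iff kscale_def)
next
  have cyc: "(\<lambda>U. comp t (z U)) \<in> kcycles sm var (G t) i" if "z \<in> kcycles sm var UNIV i" for z :: "'n set \<Rightarrow> 'm" and t
    using that by (auto simp: kcycles_def kchains_def comp_kd)
  fix z :: "'n set \<Rightarrow> 'm" assume z: "z \<in> kcycles sm var UNIV i"
  then show "\<exists>z'\<in>kcycles sm var (G r) i. z' = (\<lambda>U. comp r (z U))" using cyc by blast
  fix z' assume z': "z' = (\<lambda>U. comp r (z U))"
  show "z \<in> kboundaries sm var UNIV i \<longleftrightarrow> z' \<in> {0}"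
  proof
    assume "z \<in> kboundaries sm var UNIV i"
    then obtain u where u: "z = kd sm var u" unfolding kboundaries_def by blast
    have "z' U = 0" for U
    proof -
      have "z' U = kd sm var (\<lambda>U. comp (r - 1) (u U)) U" using comp_kd[of "r - 1" u U] by (simp add: z' u)
      moreover have "comp (r - 1) (u U) = 0" for U using comp_in[of "r - 1" "u U"] low[of "r - 1"] by simp
      ultimately show ?thesis by simp
    qed
    then show "z' \<in> {0}" by (auto simp: fun_eq_iff)
  next
    assume "z' \<in> {0}"
    then have zr: "comp r (z U) = 0" for U using z' by (auto simp: fun_eq_iff)
    \<comment> \<open>A preimage is found for each component of \<open>z\<close> separately; these
      are added up over the finite set \<open>T\<close> of degrees that occur.\<close>
    have "\<forall>t. \<exists>u. u \<in> kchains UNIV (Suc i) \<and> (\<forall>U. comp t (z U) = kd sm var u U)"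
    proof
      fix t
      consider "t < r" | "t = r" | "r < t" by linarith
      then show "\<exists>u. u \<in> kchains UNIV (Suc i) \<and> (\<forall>U. comp t (z U) = kd sm var u U)"
      proof cases
        case 1
        then have "comp t (z U) = 0" for U using comp_in[of t "z U"] low[of t] by simp
        then show ?thesis by (intro exI[of _ "\<lambda>_. 0"]) (auto simp: kchains_def)
      next
        case 2
        then show ?thesis using zr by (intro exI[of _ "\<lambda>_. 0"]) (auto simp: kchains_def)
      next
        case 3
        then obtain u where "u \<in> kchains (G (t - 1)) (Suc i)" "(\<lambda>U. comp t (z U)) = kd sm var u"
          using koszul_exact[OF van 3 cyc[OF z, of t]] by blast
        then show ?thesis by (intro exI[of _ u]) (auto simp: kchains_def fun_eq_iff)
      qed
    qed
    then obtain u where u: "\<And>t. u t \<in> kchains UNIV (Suc i)" "\<And>t U. comp t (z U) = kd sm var (u t) U" by metis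
    define T where "T = (\<Union>U. keys (dec (z U)))"
    have T: "finite T" by (simp add: T_def)
    show "z \<in> kboundaries sm var UNIV i"
    proof (rule kboundariesI)
      show "(\<lambda>U. \<Sum>t\<in>T. u t U) \<in> kchains UNIV (Suc i)" using u(1) by (auto simp: kchains_def)
      fix U
      have "z U = (\<Sum>t\<in>T. comp t (z U))" by (rule sum_comp[OF T]) (auto simp: T_def)
      also have "\<dots> = kd sm var (\<lambda>U. \<Sum>t\<in>T. u t U) U"
        unfolding u(2) kd_def scale_sum_right by (rule sum.swap)
      finally show "z U = kd sm var (\<lambda>U. \<Sum>t\<in>T. u t U) U" .
    qed
  qed
next
  fix z' assume z': "z' \<in> kcycles sm var (G r) i"
  then have "z' \<in> kcycles sm var UNIV i" "z' = (\<lambda>U. comp r (z' U))"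
    using comp_homogeneous[of _ r r] by (auto simp: kcycles_def kchains_def fun_eq_iff)
  then show "\<exists>z\<in>kcycles sm var UNIV i. z' = (\<lambda>U. comp r (z U))" by blast
qed

text \<open>A top chain has a single coefficient, at \<open>UNIV\<close>, and it is a cycle only if
  all variables kill that coefficient, which is then a cocycle in Cech degree 0. Above the top there
  are no subsets.\<close>

lemma kcycles_top:
  assumes H0: "local_cohomology_vanishes sm G 0 j" and i: "i \<ge> CARD('n)"
  shows "kcycles sm var (G j) i = ({0} :: ('n set \<Rightarrow> 'm) set)"
proof
  show "{0} \<subseteq> kcycles sm var (G j) i" using fk.subspace_0[OF subspace_kcycles_G] by simp
  show "kcycles sm var (G j) i \<subseteq> {0}"
  proof
    fix z :: "'n set \<Rightarrow> 'm" assume z: "z \<in> kcycles sm var (G j) i"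
    have "z U = 0" for U
    proof (cases "card U = i")
      case False
      then show ?thesis using z by (auto simp: kcycles_def kchains_def)
    next
      case True
      have "card U \<le> CARD('n)" by (rule card_mono) auto
      then have U: "U = UNIV" using True i by (intro card_subset_eq) auto
      have v: "sm (var s) (z UNIV) = 0" for s
      proof -
        have "kd sm var z (UNIV - {s}) = sm (sg s (UNIV - {s}) * var s) (z UNIV)"
          unfolding kd_def by (simp add: Compl_eq_Diff_UNIV Diff_Diff_Int insert_absorb)
        then have "sm (sg s (UNIV - {s})) (sm (sg s (UNIV - {s}) * var s) (z UNIV)) = 0"
          using z by (simp add: kcycles_def)
        then show ?thesis by (simp del: sg_remove_self)
      qed
      define m where "m = (\<lambda>_ :: 'n set. z UNIV)"
      \<comment> \<open>With the exponent 1 the cocycle condition involves just the variables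
        themselves.\<close>
      have "\<exists>b\<ge>1. \<exists>m'. (\<forall>S. m' S \<in> G (j + int b * (int 0 - 1)) \<and> (Suc (card S) \<noteq> 0 \<longrightarrow> m' S = 0))
        \<and> (\<forall>S. card S = 0 \<longrightarrow> sm (var_prod S ^ (b - 1)) (m S) = cd sm (\<lambda>i. var i ^ b) m' S)"
      proof (rule vanishing_representatives[OF H0])
        show "m S \<in> G (j + int 1 * int 0)" for S using z by (auto simp: m_def kcycles_def kchains_def)
        show "cd sm (\<lambda>i. var i ^ 1) m T = 0" for T
          unfolding cd_def m_def using v by (intro sum.neutral) (simp add: scale_scale[symmetric] del: scale_scale)
      qed
      then obtain b m' where "\<forall>S. card S = 0 \<longrightarrow> sm (var_prod S ^ (b - 1)) (m S) = cd sm (\<lambda>i. var i ^ b) m' S" by blast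
      then have "m {} = 0" by (auto simp: cd_def dest: spec[of _ "{}"])
      then show ?thesis by (simp add: U m_def)
    qed
    then show "z \<in> {0}" by (auto simp: fun_eq_iff)
  qed
qed

end

section \<open>Binomial sums and the Hilbert polynomial\<close>

text \<open>In generating functions: \<open>(1 + x)^n\<close> times the series
  \<open>(-x)^l / (1 + x)^(l + 1)\<close>, whose coefficients are
  \<open>(-1)^q (q choose l)\<close>, equals \<open>(-x)^l (1 + x)^(n - l - 1)\<close>. The
  induction on \<open>l\<close> lowers \<open>n\<close> by one each time.\<close>

lemma alternating_binomial_sum:
  assumes "l < n"
  shows "(\<Sum>q\<le>i. (-1) ^ q * of_nat (n choose (i - q)) * of_nat (q choose l))
     = (if l \<le> i then (-1) ^ l * of_nat ((n - l - 1) choose (i - l)) else (0::rat))"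
  using assms
proof (induction l arbitrary: n i)
  case 0
  then obtain m where n: "n = Suc m" by (cases n) auto
  have "(\<Sum>q\<le>i. (-1) ^ q * of_nat (Suc m choose (i - q))) = (of_nat (m choose i) :: rat)"
  proof (induction i)
    case (Suc i)
    have "(\<Sum>q\<le>Suc i. (-1) ^ q * of_nat (Suc m choose (Suc i - q))) = (of_nat (Suc m choose Suc i) - of_nat (m choose i) :: rat)"
      unfolding sum.atMost_Suc_shift using Suc by (simp add: sum_negf)
    then show ?case by simp
  qed simp
  then show ?case by (simp add: n)
next
  case (Suc l)
  then obtain m where n: "n = Suc m" "l < m" by (cases n) auto
  show ?case
  proof (cases i)
    case 0
    then show ?thesis by simp
  next
    case (Suc j)
    let ?T = "\<lambda>k. (\<Sum>q\<le>j. (-1) ^ q * of_nat (m choose (j - q)) * of_nat (k q)) :: rat"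
    have pascal: "Suc m choose (j - q) = (m choose (j - q)) + (if q < j then m choose (j - q - 1) else 0)" if "q \<le> j" for q
    proof (cases "q < j")
      case True
      then obtain e where "j - q = Suc e" by (metis Suc_diff_Suc)
      then show ?thesis using True by simp
    qed (use that in simp)
    \<comment> \<open>Shifting \<open>q\<close> by one turns the second half of the Pascal rule for
      \<open>Suc m\<close> into the negative of the sum with \<open>q choose Suc l\<close>, which
      cancels against the Pascal expansion of \<open>Suc q choose Suc l\<close>.\<close>
    have second: "(\<Sum>q\<le>j. (-1) ^ q * of_nat (if q < j then m choose (j - q - 1) else 0) * of_nat (Suc q choose Suc l)) = - ?T (\<lambda>q. q choose Suc l)"
    proof (cases j)
      case (Suc k)
      have "(\<Sum>q\<le>j. (-1) ^ q * of_nat (if q < j then m choose (j - q - 1) else 0) * of_nat (Suc q choose Suc l))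
          = (\<Sum>q\<le>k. (-1) ^ q * of_nat (m choose (k - q)) * (of_nat (Suc q choose Suc l) :: rat))"
        unfolding Suc sum.atMost_Suc by (auto intro!: sum.cong simp del: binomial_Suc_Suc)
      also have "\<dots> = - ?T (\<lambda>q. q choose Suc l)"
        unfolding Suc sum.atMost_Suc_shift by (simp add: sum_negf del: binomial_Suc_Suc)
      finally show ?thesis .
    qed simp
    have "(\<Sum>q\<le>i. (-1) ^ q * of_nat (n choose (i - q)) * of_nat (q choose Suc l))
       = - (\<Sum>q\<le>j. (-1) ^ q * of_nat (Suc m choose (j - q)) * (of_nat (Suc q choose Suc l) :: rat))"
      unfolding Suc n(1) sum.atMost_Suc_shift by (simp add: sum_negf del: binomial_Suc_Suc)
    also have "(\<Sum>q\<le>j. (-1) ^ q * of_nat (Suc m choose (j - q)) * (of_nat (Suc q choose Suc l) :: rat))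
       = ?T (\<lambda>q. Suc q choose Suc l) + (\<Sum>q\<le>j. (-1) ^ q * of_nat (if q < j then m choose (j - q - 1) else 0) * of_nat (Suc q choose Suc l))"
      unfolding sum.distrib[symmetric]
      by (rule sum.cong) (simp_all only: atMost_iff pascal of_nat_add distrib_left distrib_right)
    also have "\<dots> = ?T (\<lambda>q. q choose l)"
      unfolding second by (simp add: distrib_left sum.distrib)
    also have "\<dots> = (if l \<le> j then (-1) ^ l * of_nat ((m - l - 1) choose (j - l)) else 0)"
      by (rule Suc.IH[OF n(2)])
    finally show ?thesis by (auto simp: Suc n(1))
  qed
qed

section \<open>Finite differences and Newton expansion\<close>

definition fd :: "(nat \<Rightarrow> rat) \<Rightarrow> nat \<Rightarrow> rat" where
  "fd f = (\<lambda>q. f (Suc q) - f q)"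

lemma newton_expansion: "f q = (\<Sum>l\<le>q. of_nat (q choose l) * (fd ^^ l) f 0)"
proof (induction q arbitrary: f)
  case (Suc q)
  have 1: "f q = f 0 + (\<Sum>l\<le>q. of_nat (q choose Suc l) * (fd ^^ Suc l) f 0)"
  proof -
    have "f q = (\<Sum>l\<le>Suc q. of_nat (q choose l) * (fd ^^ l) f 0)" using Suc.IH[of f] by simp
    then show ?thesis unfolding sum.atMost_Suc_shift by simp
  qed
  have 2: "fd f q = (\<Sum>l\<le>q. of_nat (q choose l) * (fd ^^ Suc l) f 0)"
    using Suc.IH[of "fd f"] by (simp add: funpow_swap1)
  have "f (Suc q) = f q + fd f q" by (simp add: fd_def)
  also have "\<dots> = f 0 + (\<Sum>l\<le>q. of_nat (Suc q choose Suc l) * (fd ^^ Suc l) f 0)"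
    unfolding 2 by (subst 1) (simp add: sum.distrib distrib_right)
  also have "\<dots> = (\<Sum>l\<le>Suc q. of_nat (Suc q choose l) * (fd ^^ l) f 0)"
    unfolding sum.atMost_Suc_shift by simp
  finally show ?case .
qed simp

text \<open>Up to sign this is the Betti number formula in degree \<open>i + n\<close>, so vanishing
  of Betti numbers from \<open>n\<close> on is vanishing of the \<open>n\<close>-th difference. The
  induction is the Pascal rule.\<close>

lemma fd_power_eq:
  "(fd ^^ n) f i = (-1) ^ (i + n) * (\<Sum>q\<le>i + n. (-1) ^ q * of_nat (n choose (i + n - q)) * f q)"
proof (induction n arbitrary: i)
  case 0
  have "(\<Sum>q\<le>i. (-1) ^ q * of_nat (0 choose (i - q)) * f q) = (\<Sum>q\<in>{i}. (-1) ^ q * of_nat (0 choose (i - q)) * f q)"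
    by (rule sum.mono_neutral_right) (auto simp: binomial_eq_0)
  then show ?case by (simp flip: power_add mult.assoc)
next
  case (Suc n)
  let ?b = "\<lambda>n k. \<Sum>q\<le>k. (-1) ^ q * of_nat (n choose (k - q)) * f q"
  have p: "?b (Suc n) (Suc k) = ?b n (Suc k) + ?b n k" for k
  proof -
    have "(\<Sum>q\<le>k. (-1) ^ q * of_nat (Suc n choose (Suc k - q)) * f q) = (\<Sum>q\<le>k. (-1) ^ q * of_nat (n choose (Suc k - q)) * f q) + ?b n k"
      unfolding sum.distrib[symmetric]
      by (rule sum.cong) (simp_all add: Suc_diff_le algebra_simps)
    then show ?thesis by simp
  qed
  have "(fd ^^ Suc n) f i = (fd ^^ n) f (Suc i) - (fd ^^ n) f i" by (simp add: fd_def)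
  also have "\<dots> = (-1) ^ (i + Suc n) * (?b n (Suc (i + n)) + ?b n (i + n))"
    unfolding Suc.IH by (simp add: algebra_simps)
  finally show ?case using p[of "i + n"] by simp
qed

lemma fd_zero: "(fd ^^ k) (\<lambda>q. 0) = (\<lambda>q. 0)"
  by (induction k) (auto simp: fd_def)

text \<open>Vanishing from \<open>n\<close> on cuts the Newton expansion of \<open>H\<close> off at
  \<open>n\<close>. Inserting the expansion into the sum for \<open>b\<close> and exchanging the
  sums leaves the binomial sums evaluated above; \<open>m\<close> is a bound on the orders of the
  nonzero differences at 0.\<close>

lemma betti_numeric:
  fixes H :: "nat \<Rightarrow> rat"
  assumes b: "\<And>i. b i = (\<Sum>q\<le>i. (-1) ^ q * of_nat (n choose (i - q)) * H q)"
    and top: "\<And>i. i \<ge> n \<Longrightarrow> b i = 0"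
  shows "H q = (\<Sum>l<n. of_nat (q choose l) * (fd ^^ l) H 0)"
    and "(\<And>l. l > m \<Longrightarrow> (fd ^^ l) H 0 = 0) \<Longrightarrow>
      b i = (\<Sum>l = 0..min i m. (-1) ^ l * of_nat ((n - l - 1) choose (i - l)) * (fd ^^ l) H 0)"
proof -
  have "(fd ^^ n) H = (\<lambda>q. 0)"
  proof
    fix i
    have "(fd ^^ n) H i = (-1) ^ (i + n) * b (i + n)" unfolding fd_power_eq b ..
    then show "(fd ^^ n) H i = 0" by (simp add: top)
  qed
  then have high: "(fd ^^ l) H 0 = 0" if "l \<ge> n" for l
    using funpow_add[of "l - n" n fd] fd_zero[of "l - n"] that by simp
  show newton: "H q = (\<Sum>l<n. of_nat (q choose l) * (fd ^^ l) H 0)" for q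
  proof -
    have "H q = (\<Sum>l\<le>q. of_nat (q choose l) * (fd ^^ l) H 0)" by (rule newton_expansion)
    \<comment> \<open>The range up to \<open>n + Suc q\<close> contains both truncations and serves
      to compare them.\<close>
    also have "\<dots> = (\<Sum>l<n + Suc q. of_nat (q choose l) * (fd ^^ l) H 0)"
      by (rule sum.mono_neutral_left) (auto simp: binomial_eq_0)
    also have "\<dots> = (\<Sum>l<n. of_nat (q choose l) * (fd ^^ l) H 0)"
      by (rule sum.mono_neutral_right) (auto simp: high)
    finally show ?thesis .
  qed
  assume m: "\<And>l. l > m \<Longrightarrow> (fd ^^ l) H 0 = 0"
  let ?c = "\<lambda>l. (fd ^^ l) H 0"
  have "b i = (\<Sum>q\<le>i. \<Sum>l<n. ?c l * ((-1) ^ q * of_nat (n choose (i - q)) * of_nat (q choose l)))"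
    unfolding b by (subst newton) (simp add: sum_distrib_left mult_ac)
  also have "\<dots> = (\<Sum>l<n. ?c l * (\<Sum>q\<le>i. (-1) ^ q * of_nat (n choose (i - q)) * of_nat (q choose l)))"
    unfolding sum_distrib_left by (rule sum.swap)
  also have "\<dots> = (\<Sum>l<n. ?c l * (if l \<le> i then (-1) ^ l * of_nat ((n - l - 1) choose (i - l)) else 0))"
    by (intro sum.cong refl) (simp add: alternating_binomial_sum)
  also have "\<dots> = (\<Sum>l\<in>{..<n} \<inter> {0..min i m}. (-1) ^ l * of_nat ((n - l - 1) choose (i - l)) * ?c l)"
    by (rule sum.mono_neutral_cong_right) (auto simp: m, metis m not_le_imp_less)
  also have "\<dots> = (\<Sum>l = 0..min i m. (-1) ^ l * of_nat ((n - l - 1) choose (i - l)) * ?c l)"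
    by (rule sum.mono_neutral_left) (auto simp: high, metis high leI)
  finally show "b i = (\<Sum>l = 0..min i m. (-1) ^ l * of_nat ((n - l - 1) choose (i - l)) * (fd ^^ l) H 0)" .
qed

lemma newton_polynomial_exists:
  fixes c :: "nat \<Rightarrow> rat"
  shows "\<exists>P. \<forall>q. poly P (of_int (r + int q)) = (\<Sum>l<n. of_nat (q choose l) * c l)"
proof -
  \<comment> \<open>\<open>q choose l\<close> is a polynomial of degree \<open>l\<close> in
    \<open>t = r + q\<close>, with roots \<open>r, ..., r + l - 1\<close>.\<close>
  define P where "P = (\<Sum>l<n. smult (c l / fact l) (\<Prod>j = 0..<l. [:- (of_int r + of_nat j), 1:]))"
  have "poly P (of_int (r + int q)) = (\<Sum>l<n. of_nat (q choose l) * c l)" for q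
  proof -
    have "poly (smult (c l / fact l) (\<Prod>j = 0..<l. [:- (of_int r + of_nat j), 1:])) (of_int (r + int q)) = of_nat (q choose l) * c l" for l
    proof -
      have "poly (\<Prod>j = 0..<l. [:- (of_int r + of_nat j), 1:]) (of_int (r + int q)) = (\<Prod>j = 0..<l. of_nat q - (of_nat j :: rat))"
        unfolding poly_prod by (intro prod.cong) (auto simp: algebra_simps)
      moreover have "(of_nat (q choose l) :: rat) = (\<Prod>j = 0..<l. of_nat q - of_nat j) / fact l"
        unfolding binomial_gbinomial gbinomial_prod_rev ..
      ultimately show ?thesis by simp
    qed
    then show ?thesis unfolding P_def poly_sum by simp
  qed
  then show ?thesis by blast
qed

section \<open>Backward differences and uniqueness of the Hilbert polynomial\<close>

lemma poly_backward_diff: "poly (backward_diff P) x = poly P x - poly P (x - 1)"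
  by (simp add: backward_diff_def poly_pcompose)

text \<open>The \<open>l\<close>-th backward difference at \<open>r + l\<close> looks back exactly
  to \<open>r\<close>, which makes it a forward difference based at \<open>r\<close>.\<close>

lemma backward_diff_power_eq:
  assumes "\<And>q. poly P (of_int (r + int q)) = H q"
  shows "poly ((backward_diff ^^ l) P) (of_int (r + int l + int q)) = (fd ^^ l) H q"
proof (induction l arbitrary: q)
  case (Suc l)
  have "(of_int (r + int (Suc l) + int q) :: rat) = of_int (r + int l + int (Suc q))"
    "(of_int (r + int (Suc l) + int q) - 1 :: rat) = of_int (r + int l + int q)" by simp_all
  then show ?case using Suc.IH[of q] Suc.IH[of "Suc q"] by (simp only: funpow.simps comp_apply poly_backward_diff fd_def)
qed (use assms in simp)

text \<open>Translation preserves degree and leading coefficient, so the top coefficients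
  cancel.\<close>

lemma degree_backward_diff: "backward_diff P = 0 \<or> degree (backward_diff (P :: rat poly)) < degree P"
proof (cases "degree P = 0")
  case True
  then obtain a where "P = [:a:]" by (rule degree_eq_zeroE)
  then show ?thesis by (simp add: backward_diff_def)
next
  case False
  have d: "degree (pcompose P [:-1, 1:]) = degree P" by (simp add: degree_pcompose)
  have "lead_coeff (pcompose P [:-1, 1:]) = lead_coeff P * lead_coeff [:-1, 1:] ^ degree P"
    by (rule lead_coeff_comp) simp
  then have "coeff (backward_diff P) (degree P) = 0" by (simp add: backward_diff_def d)
  moreover have "degree (backward_diff P) \<le> degree P" unfolding backward_diff_def by (rule degree_diff_le) (simp_all add: d)
  ultimately show ?thesis
    by (metis False coeff_0_reflect_poly_0_iff leading_coeff_0_iff le_neq_implies_less)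
qed

lemma backward_diff_power_zero:
  fixes P :: "rat poly"
  assumes "P = 0 \<or> degree P < l"
  shows "(backward_diff ^^ l) P = 0"
  using assms
proof (induction l arbitrary: P)
  case (Suc l)
  have "backward_diff P = 0 \<or> degree (backward_diff P) < l"
    using degree_backward_diff[of P] Suc.prems by (auto simp: backward_diff_def)
  then have "(backward_diff ^^ l) (backward_diff P) = 0" by (rule Suc.IH)
  then show ?case by (simp add: funpow_swap1)
qed simp

text \<open>Two polynomials that agree at all large integers have a difference with infinitely many
  roots.\<close>

lemma hilbert_poly_eq:
  assumes P: "\<And>t. t \<ge> r \<Longrightarrow> poly P (of_int t) = of_nat (hilbert_function sm G t)"
  shows "hilbert_poly sm G = P"
  unfolding hilbert_poly_def
proof (rule the_equality)
  show "\<forall>\<^sub>F t in at_top. poly P (of_int t) = of_nat (hilbert_function sm G t)"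
    using eventually_ge_at_top[of r] by eventually_elim (rule P)
next
  fix Q :: "rat poly" assume "\<forall>\<^sub>F t in at_top. poly Q (of_int t) = of_nat (hilbert_function sm G t)"
  then obtain N where N: "\<And>t. t \<ge> N \<Longrightarrow> poly Q (of_int t) = of_nat (hilbert_function sm G t)"
    unfolding eventually_at_top_linorder by blast
  show "Q = P"
  proof (rule ccontr)
    assume "Q \<noteq> P"
    then have "finite {x. poly (Q - P) x = 0}" by (intro poly_roots_finite) simp
    moreover have "of_int ` {max N r..} \<subseteq> {x. poly (Q - P) x = 0}" using N P by auto
    ultimately have "finite (of_int ` {max N r..} :: rat set)" by (rule finite_subset[rotated])
    then have "finite {max N r..}" by (rule finite_imageD) (auto intro: inj_onI)
    then show False using infinite_Ici by blast
  qed
qed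

section \<open>Homogeneous ideals\<close>

interpretation rng: module "(*) :: 'r::comm_ring_1 \<Rightarrow> 'r \<Rightarrow> 'r" by (rule module_mult)

declare rng.scale_scale [simp del] \<comment> \<open>loops with associativity of multiplication\<close>

interpretation kv: vector_space "kscale ((*) :: ('n::finite, 'k::field) mpoly \<Rightarrow> _)"
  by (rule vector_space_kscale[OF module_mult])

definition hom_ideal :: "('n::finite, 'k::field) mpoly set \<Rightarrow> bool" where
  "hom_ideal I \<longleftrightarrow> rng.subspace I \<and> (\<forall>f\<in>I. \<forall>e. hc e f \<in> I)"

lemma hom_ideal_hc: "hom_ideal I \<Longrightarrow> f \<in> I \<Longrightarrow> hc e f \<in> I"
  by (simp add: hom_ideal_def)

lemma hom_ideal_mult: "hom_ideal I \<Longrightarrow> f \<in> I \<Longrightarrow> g * f \<in> I" "hom_ideal I \<Longrightarrow> f \<in> I \<Longrightarrow> f * g \<in> I"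
  using rng.subspace_scale[of I f g] by (auto simp: hom_ideal_def mult.commute)

lemma hom_idealD:
  assumes "hom_ideal I"
  shows "0 \<in> I" "f \<in> I \<Longrightarrow> g \<in> I \<Longrightarrow> f + g \<in> I" "f \<in> I \<Longrightarrow> g \<in> I \<Longrightarrow> f - g \<in> I"
    "(\<And>i. i \<in> A \<Longrightarrow> u i \<in> I) \<Longrightarrow> sum u A \<in> I"
  using assms rng.subspace_0 rng.subspace_add rng.subspace_diff rng.subspace_sum unfolding hom_ideal_def by blast+

lemma hom_ideal_iff_hc: "hom_ideal I \<Longrightarrow> f \<in> I \<longleftrightarrow> (\<forall>e. hc e f \<in> I)"
proof
  assume I: "hom_ideal I" and "\<forall>e. hc e f \<in> I"
  then have "(\<Sum>e\<in>mdeg ` keys f. hc e f) \<in> I" by (intro hom_idealD(4)) auto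
  then show "f \<in> I" using sum_hc[of "mdeg ` keys f" f] by simp
qed (simp add: hom_ideal_hc)

lemma hc_mult_homogeneous:
  assumes "homogeneous a f"
  shows "hc e (g * f) = (if a \<le> e then hc (e - a) g * f else 0)"
proof -
  let ?E = "insert (e - a) (mdeg ` keys g)"
  have g: "g = (\<Sum>d\<in>?E. hc d g)" by (rule sum_hc) auto
  have "hc e (g * f) = (\<Sum>d\<in>?E. hc e (hc d g * f))"
    by (subst g) (simp only: sum_distrib_right hc_sum)
  also have "\<dots> = (\<Sum>d\<in>?E. if d = e - a then (if a \<le> e then hc (e - a) g * f else 0) else 0)"
    by (intro sum.cong refl) (auto simp: hc_homogeneous[OF homogeneous_mult[OF homogeneous_hc assms]])
  also have "\<dots> = (if a \<le> e then hc (e - a) g * f else 0)" by simp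
  finally show ?thesis .
qed

section \<open>Leading exponents and the ascending chain condition\<close>

definition lead_exponents :: "('n::{finite,linorder}, 'k::field) mpoly set \<Rightarrow> ('n \<Rightarrow>\<^sub>0 nat) set" where
  "lead_exponents I = {\<alpha>. \<exists>f\<in>I. homogeneous (mdeg \<alpha>) f \<and> f \<noteq> 0 \<and> Max (keys f) = \<alpha>}"

lemma keys_nonempty: "f \<noteq> 0 \<Longrightarrow> keys f \<noteq> {}"
  by (metis keys_eq_empty)

text \<open>Adding a fixed exponent preserves the order, so multiplication by a monomial shifts
  leading exponents: they form an ideal in the monoid of exponents.\<close>

lemma lead_exponents_add:
  assumes I: "hom_ideal I" and \<alpha>: "\<alpha> \<in> lead_exponents I"
  shows "\<alpha> + \<beta> \<in> lead_exponents I"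
proof -
  obtain f where f: "f \<in> I" "homogeneous (mdeg \<alpha>) f" "f \<noteq> 0" "Max (keys f) = \<alpha>"
    using \<alpha> unfolding lead_exponents_def by blast
  define g where "g = Poly_Mapping.single \<beta> 1 * f"
  have \<alpha>f: "\<alpha> \<in> keys f" using f(4) Max_in[OF finite_keys keys_nonempty[OF f(3)]] by simp
  have "\<beta> + \<alpha> \<in> keys g" using \<alpha>f by (simp add: g_def in_keys_iff lookup_single_mult)
  moreover have "\<gamma> \<le> \<beta> + \<alpha>" if \<gamma>: "\<gamma> \<in> keys g" for \<gamma>
  proof -
    obtain \<delta> where \<delta>: "\<gamma> = \<beta> + \<delta>" using \<gamma> lookup_single_mult(2)[of \<gamma> \<beta> 1 f] by (auto simp: g_def in_keys_iff)
    then have "\<delta> \<in> keys f" using \<gamma> by (simp add: g_def in_keys_iff lookup_single_mult)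
    then have "\<delta> \<le> \<alpha>" using f(4) by auto
    then show ?thesis unfolding \<delta> by (rule add_left_mono)
  qed
  ultimately have "Max (keys g) = \<beta> + \<alpha>" "g \<noteq> 0" by (auto intro: Max_eqI)
  moreover have "homogeneous (mdeg (\<alpha> + \<beta>)) g"
    using homogeneous_mult[OF homogeneous_single[of \<beta> 1] f(2)] by (simp add: g_def mdeg_add add.commute)
  moreover have "g \<in> I" unfolding g_def using f(1) by (intro hom_ideal_mult I)
  ultimately show ?thesis unfolding lead_exponents_def by (auto simp: add.commute)
qed

text \<open>The order on exponents is the lexicographic one; inside a fixed degree it is finite, so no
  well-foundedness is needed.\<close>

lemma lead_exponents_psubset:
  fixes I J :: "('n::{finite,linorder}, 'k::field) mpoly set"
  assumes I: "hom_ideal I" and J: "hom_ideal J" and IJ: "I \<subset> J"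
  shows "\<exists>\<alpha>. \<alpha> \<in> lead_exponents J \<and> \<alpha> \<notin> lead_exponents I"
proof -
  obtain f0 where f0: "f0 \<in> J" "f0 \<notin> I" using IJ by blast
  then obtain t where t: "hc t f0 \<notin> I" using hom_ideal_iff_hc[OF I] by blast
  define S where "S = {f. f \<in> J \<and> f \<notin> I \<and> homogeneous t f}"
  have S0: "f \<noteq> 0" if "f \<in> S" for f using that hom_idealD(1)[OF I] by (auto simp: S_def)
  have SM: "Max (keys f) \<in> keys f" if "f \<in> S" for f using S0[OF that] by (intro Max_in keys_nonempty) auto
  have Sdeg: "mdeg (Max (keys f)) = t" if "f \<in> S" for f
    using SM[OF that] that by (auto simp: S_def homogeneous_iff in_keys_iff)
  let ?M = "(\<lambda>f. Max (keys f)) ` S"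
  have "finite ?M" by (rule finite_subset[OF _ finite_mdeg[of t]]) (use Sdeg in auto)
  moreover have "?M \<noteq> {}" using t f0 hom_ideal_hc[OF J] homogeneous_hc[of t f0] by (auto simp: S_def)
  ultimately have "Min ?M \<in> ?M" and mn: "\<And>f. f \<in> S \<Longrightarrow> Min ?M \<le> Max (keys f)" by auto
  \<comment> \<open>Among the homogeneous elements of degree \<open>t\<close> in \<open>J\<close>
    outside \<open>I\<close>, one with the smallest leading exponent is taken.\<close>
  then obtain f where f: "f \<in> S" "Min ?M = Max (keys f)" by blast
  define \<alpha> where "\<alpha> = Max (keys f)"
  have "\<alpha> \<in> lead_exponents J"
    unfolding lead_exponents_def using f(1) S0[OF f(1)] Sdeg[OF f(1)] by (auto simp: \<alpha>_def S_def)
  moreover have "\<alpha> \<notin> lead_exponents I"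
  proof
    assume "\<alpha> \<in> lead_exponents I"
    then obtain g where g: "g \<in> I" "homogeneous (mdeg \<alpha>) g" "g \<noteq> 0" "Max (keys g) = \<alpha>"
      unfolding lead_exponents_def by blast
    have ga: "lookup g \<alpha> \<noteq> 0" using g(4) Max_in[OF finite_keys keys_nonempty[OF g(3)]] by (simp add: in_keys_iff)
    \<comment> \<open>If \<open>I\<close> had the same leading exponent, cancelling the leading
      terms would give an element of \<open>S\<close> with a smaller one.\<close>
    define h where "h = f - const (lookup f \<alpha> / lookup g \<alpha>) * g"
    have lh: "lookup h \<beta> = lookup f \<beta> - lookup f \<alpha> / lookup g \<alpha> * lookup g \<beta>" for \<beta>
      unfolding h_def lookup_minus const_def using lookup_single_mult(1)[of 0 "lookup f \<alpha> / lookup g \<alpha>" g \<beta>] by simp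
    have cg: "const (lookup f \<alpha> / lookup g \<alpha>) * g \<in> I" by (rule hom_ideal_mult(1)[OF I g(1)])
    have "h \<in> J" using f(1) cg IJ hom_idealD(3)[OF J] by (auto simp: h_def S_def)
    moreover have "h \<notin> I"
    proof
      assume "h \<in> I"
      then have "h + const (lookup f \<alpha> / lookup g \<alpha>) * g \<in> I" using cg hom_idealD(2)[OF I] by blast
      then show False using f(1) by (simp add: h_def S_def)
    qed
    moreover have "homogeneous t h"
      unfolding homogeneous_iff
    proof (intro allI impI)
      fix \<gamma> assume "lookup h \<gamma> \<noteq> 0"
      then have "lookup f \<gamma> \<noteq> 0 \<or> lookup g \<gamma> \<noteq> 0" by (auto simp: lh)
      then show "mdeg \<gamma> = t" using f(1) g(2) Sdeg[OF f(1)] by (auto simp: S_def homogeneous_iff \<alpha>_def)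
    qed
    ultimately have h: "h \<in> S" by (simp add: S_def)
    have "\<gamma> < \<alpha>" if "\<gamma> \<in> keys h" for \<gamma>
    proof -
      have "\<gamma> \<in> keys f \<or> \<gamma> \<in> keys g" using that by (auto simp: in_keys_iff lh)
      then have "\<gamma> \<le> \<alpha>" using g(4) \<alpha>_def Max_ge[OF finite_keys] by metis
      moreover have "\<gamma> \<noteq> \<alpha>" using that ga by (auto simp: in_keys_iff lh)
      ultimately show ?thesis by simp
    qed
    then have "Max (keys h) < \<alpha>" using SM[OF h] by blast
    then show False using mn[OF h] f(2) by (simp add: \<alpha>_def)
  qed
  ultimately show ?thesis by blast
qed

lemma nat_incseq_subseq:
  fixes f :: "nat \<Rightarrow> nat"
  shows "\<exists>\<psi> :: nat \<Rightarrow> nat. strict_mono \<psi> \<and> (\<forall>i j. i \<le> j \<longrightarrow> f (\<psi> i) \<le> f (\<psi> j))"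
proof -
  obtain \<psi> :: "nat \<Rightarrow> nat" where \<psi>: "strict_mono \<psi>" "monoseq (\<lambda>n. f (\<psi> n))" using seq_monosub[of f] by blast
  show ?thesis
  proof (cases "\<forall>m n. m \<le> n \<longrightarrow> f (\<psi> m) \<le> f (\<psi> n)")
    case False
    then have dec: "\<And>m n. m \<le> n \<Longrightarrow> f (\<psi> n) \<le> f (\<psi> m)" using \<psi>(2) unfolding monoseq_def by blast
    \<comment> \<open>A non-increasing sequence of natural numbers is constant once it has reached
      its minimum.\<close>
    obtain N where N: "\<And>n. f (\<psi> N) \<le> f (\<psi> n)" using ex_has_least_nat[of "\<lambda>_. True" 0 "\<lambda>n. f (\<psi> n)"] by blast
    have "f (\<psi> (N + n)) = f (\<psi> N)" for n using N[of "N + n"] dec[of N "N + n"] by simp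
    moreover have "strict_mono (\<lambda>n. \<psi> (N + n))" using \<psi>(1) by (simp add: strict_mono_def)
    ultimately show ?thesis by (intro exI[of _ "\<lambda>n. \<psi> (N + n)"]) simp
  qed (use \<psi> in blast)
qed

text \<open>Passing to subsequences for one variable after the other makes all exponents
  non-decreasing, and then a later monomial is a multiple of an earlier one.\<close>

lemma dickson:
  fixes \<alpha> :: "nat \<Rightarrow> 'n::finite \<Rightarrow>\<^sub>0 nat"
  shows "\<exists>i j \<beta>. i < j \<and> \<alpha> j = \<alpha> i + \<beta>"
proof -
  have "\<exists>\<phi> :: nat \<Rightarrow> nat. strict_mono \<phi> \<and> (\<forall>k\<in>A. \<forall>i j. i \<le> j \<longrightarrow> lookup (\<alpha> (\<phi> i)) k \<le> lookup (\<alpha> (\<phi> j)) k)"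
    if "finite A" for A :: "'n set"
    using that
  proof (induction A)
    case empty
    then show ?case by (intro exI[of _ id]) (auto simp: strict_mono_def)
  next
    case (insert a A)
    then obtain \<phi> :: "nat \<Rightarrow> nat" where \<phi>: "strict_mono \<phi>" "\<And>k i j. k \<in> A \<Longrightarrow> i \<le> j \<Longrightarrow> lookup (\<alpha> (\<phi> i)) k \<le> lookup (\<alpha> (\<phi> j)) k" by blast
    obtain \<psi> :: "nat \<Rightarrow> nat" where \<psi>: "strict_mono \<psi>" "\<And>i j. i \<le> j \<Longrightarrow> lookup (\<alpha> (\<phi> (\<psi> i))) a \<le> lookup (\<alpha> (\<phi> (\<psi> j))) a"
      using nat_incseq_subseq[of "\<lambda>i. lookup (\<alpha> (\<phi> i)) a"] by blast
    have "\<psi> i \<le> \<psi> j" if "i \<le> j" for i j using that \<psi>(1) by (simp add: strict_mono_less_eq)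
    then show ?case using \<phi> \<psi> by (intro exI[of _ "\<phi> \<circ> \<psi>"]) (auto simp: strict_mono_def)
  qed
  from this[of UNIV] obtain \<phi> :: "nat \<Rightarrow> nat" where \<phi>: "strict_mono \<phi>" "\<And>k. lookup (\<alpha> (\<phi> 0)) k \<le> lookup (\<alpha> (\<phi> 1)) k" by auto
  have "\<alpha> (\<phi> 1) = \<alpha> (\<phi> 0) + (\<alpha> (\<phi> 1) - \<alpha> (\<phi> 0))"
    by (rule poly_mapping_eqI) (use \<phi>(2) in \<open>simp add: lookup_add lookup_minus\<close>)
  moreover have "\<phi> 0 < \<phi> 1" using \<phi>(1) by (simp add: strict_mono_def)
  ultimately show ?thesis by blast
qed

text \<open>In an infinite ascending chain each step brings a leading exponent not present before.
  By \<open>dickson\<close> one of them is a multiple of an earlier one and hence already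
  present.\<close>

lemma hom_ideal_acc:
  "wf {(J, I). hom_ideal (I :: ('n::{finite,linorder}, 'k::field) mpoly set) \<and> hom_ideal J \<and> I \<subset> J}"
  unfolding wf_iff_no_infinite_down_chain
proof
  assume "\<exists>F. \<forall>i. (F (Suc i), F i) \<in> {(J, I :: ('n, 'k) mpoly set). hom_ideal I \<and> hom_ideal J \<and> I \<subset> J}"
  then obtain F :: "nat \<Rightarrow> ('n, 'k) mpoly set"
    where F': "\<forall>i. (F (Suc i), F i) \<in> {(J, I). hom_ideal I \<and> hom_ideal J \<and> I \<subset> J}" by blast
  have F: "hom_ideal (F i)" "F i \<subset> F (Suc i)" for i using F' by simp_all
  have mono: "F i \<subseteq> F j" if "i \<le> j" for i j
    using lift_Suc_mono_le[of F i j] F(2) that by blast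
  have "\<forall>i. \<exists>\<alpha>. \<alpha> \<in> lead_exponents (F (Suc i)) \<and> \<alpha> \<notin> lead_exponents (F i)"
    by (intro allI lead_exponents_psubset F)
  from choice[OF this] obtain \<alpha> where \<alpha>': "\<forall>i. \<alpha> i \<in> lead_exponents (F (Suc i)) \<and> \<alpha> i \<notin> lead_exponents (F i)" ..
  have \<alpha>: "\<alpha> i \<in> lead_exponents (F (Suc i))" "\<alpha> i \<notin> lead_exponents (F i)" for i using \<alpha>' by simp_all
  obtain i j \<beta> where ij: "i < j" "\<alpha> j = \<alpha> i + \<beta>" using dickson[of \<alpha>] by blast
  have "\<alpha> i + \<beta> \<in> lead_exponents (F (Suc i))" by (rule lead_exponents_add[OF F(1) \<alpha>(1)])
  moreover have "lead_exponents (F (Suc i)) \<subseteq> lead_exponents (F j)"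
    using mono[of "Suc i" j] ij(1) unfolding lead_exponents_def by auto
  ultimately show False using \<alpha>(2)[of j] ij(2) by auto
qed

section \<open>Growth of Hilbert functions\<close>

text \<open>A nonzero polynomial stays below a multiple of \<open>growth e\<close> iff its degree is less than \<open>e\<close>;
  for \<open>e = 0\<close> this forces the bound \<open>0\<close>.\<close>

definition growth :: "nat \<Rightarrow> nat \<Rightarrow> nat" where
  "growth e t = (case e of 0 \<Rightarrow> 0 | Suc e' \<Rightarrow> (t + 1) ^ e')"

definition bounded_growth :: "nat \<Rightarrow> (nat \<Rightarrow> nat) \<Rightarrow> bool" where
  "bounded_growth e h \<longleftrightarrow> (\<exists>C N. \<forall>t\<ge>N. h t \<le> C * growth e t)"

lemma growth_mono: "s \<le> t \<Longrightarrow> growth e s \<le> growth e t"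
  by (auto simp: growth_def split: nat.split intro: power_mono)

lemma bounded_growth_mono: "bounded_growth e h \<Longrightarrow> (\<And>t. t \<ge> N \<Longrightarrow> h' t \<le> h t) \<Longrightarrow> bounded_growth e h'"
  unfolding bounded_growth_def by (meson max.bounded_iff order_trans)

lemma bounded_growth_zero: "(\<And>t. t \<ge> N \<Longrightarrow> h t = 0) \<Longrightarrow> bounded_growth e h"
  unfolding bounded_growth_def by (intro exI[of _ 0] exI[of _ N]) auto

lemma bounded_growth_add:
  assumes "bounded_growth e h" "bounded_growth e h'"
  shows "bounded_growth e (\<lambda>t. h t + h' t)"
proof -
  obtain C N C' N' where "\<And>t. t \<ge> N \<Longrightarrow> h t \<le> C * growth e t" "\<And>t. t \<ge> N' \<Longrightarrow> h' t \<le> C' * growth e t"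
    using assms unfolding bounded_growth_def by blast
  then show ?thesis unfolding bounded_growth_def
    by (intro exI[of _ "C + C'"] exI[of _ "max N N'"]) (auto simp: distrib_right intro: add_mono)
qed

lemma bounded_growth_shift:
  assumes "bounded_growth e h"
  shows "bounded_growth e (\<lambda>t. if a \<le> int t then h (nat (int t - a)) else 0)"
proof -
  obtain C N where C: "\<And>t. t \<ge> N \<Longrightarrow> h t \<le> C * growth e t" using assms unfolding bounded_growth_def by blast
  \<comment> \<open>Chosen so that \<open>t - a + 1 \<le> A (t + 1)\<close> also when
    \<open>a\<close> is negative.\<close>
  define A where "A = nat \<bar>a\<bar> + 1"
  have g: "growth e (nat (int t - a)) \<le> A ^ e * growth e t" if "a \<le> int t" for t
  proof (cases e)
    case (Suc e')
    have "nat (int t - a) + 1 \<le> A * (t + 1)"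
    proof -
      have "nat (int t - a) + 1 \<le> nat \<bar>a\<bar> + t + 1" by linarith
      also have "\<dots> \<le> A * (t + 1)" by (simp add: A_def)
      finally show ?thesis .
    qed
    then have "(nat (int t - a) + 1) ^ e' \<le> (A * (t + 1)) ^ e'" by (rule power_mono) simp
    also have "\<dots> = A ^ e' * (t + 1) ^ e'" by (rule power_mult_distrib)
    also have "\<dots> \<le> A ^ e * (t + 1) ^ e'" unfolding Suc by (intro mult_right_mono power_increasing) (auto simp: A_def)
    finally show ?thesis by (simp add: growth_def Suc)
  qed (simp add: growth_def)
  have "(if a \<le> int t then h (nat (int t - a)) else 0) \<le> (C * A ^ e) * growth e t" if "t \<ge> N + nat \<bar>a\<bar>" for t
  proof -
    have "a \<le> int t" "N \<le> nat (int t - a)" using that by linarith+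
    then have "h (nat (int t - a)) \<le> C * growth e (nat (int t - a))" using C by blast
    also have "\<dots> \<le> C * (A ^ e * growth e t)" by (intro mult_left_mono g \<open>a \<le> int t\<close>) simp
    finally show ?thesis using \<open>a \<le> int t\<close> by (simp add: mult.assoc)
  qed
  then show ?thesis unfolding bounded_growth_def by blast
qed

text \<open>Summing increments of order \<open>e\<close> gives order \<open>e + 1\<close>. For
  \<open>e = 0\<close> the values eventually stop increasing, and \<open>growth 1\<close> is
  constant.\<close>

lemma bounded_growth_Suc:
  assumes "bounded_growth e h'" and step: "\<And>t. h (Suc t) \<le> h t + h' (Suc t)"
  shows "bounded_growth (Suc e) h"
proof -
  obtain C N where C: "\<And>t. t \<ge> N \<Longrightarrow> h' t \<le> C * growth e t" using assms unfolding bounded_growth_def by blast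
  have "h t \<le> h N + t * (C * growth e t)" if "t \<ge> N" for t
    using that
  proof (induction t rule: dec_induct)
    case (step t)
    have "h (Suc t) \<le> h t + h' (Suc t)" by (rule assms(2))
    also have "\<dots> \<le> (h N + t * (C * growth e t)) + C * growth e (Suc t)"
      using step.IH C[of "Suc t"] step.hyps by (intro add_mono) auto
    also have "\<dots> \<le> (h N + t * (C * growth e (Suc t))) + C * growth e (Suc t)"
      by (intro add_mono mult_left_mono growth_mono) auto
    finally show ?case by simp
  qed simp
  moreover have "h N + t * (C * growth e t) \<le> (h N + C) * growth (Suc e) t" for t
  proof -
    have "t * growth e t \<le> growth (Suc e) t" "1 \<le> growth (Suc e) t" by (auto simp: growth_def split: nat.split)
    then have "h N * 1 + C * (t * growth e t) \<le> h N * growth (Suc e) t + C * growth (Suc e) t"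
      by (intro add_mono mult_left_mono) auto
    then show ?thesis by (simp add: algebra_simps)
  qed
  ultimately show ?thesis unfolding bounded_growth_def by (meson order_trans)
qed

section \<open>Hilbert functions of quotients by homogeneous ideals\<close>

definition Rt :: "nat \<Rightarrow> ('n::finite, 'k::field) mpoly set" where
  "Rt t = {f. homogeneous t f}"

definition hfun :: "('n::finite, 'k::field) mpoly set \<Rightarrow> nat \<Rightarrow> nat" where
  "hfun I t = (THE n. qdim (kscale (*)) (Rt t) (I \<inter> Rt t) n)"

lemma homogeneous_const_mult: "homogeneous t f \<Longrightarrow> homogeneous t (const c * f)"
  using homogeneous_mult[OF homogeneous_const] by fastforce

lemma subspace_Rt: "kv.subspace (Rt t)"
  by (rule kv.subspaceI) (auto simp: Rt_def homogeneous_add kscale_def homogeneous_const_mult)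

lemma Rt_finite_span: "\<exists>T. finite T \<and> Rt t \<subseteq> kv.span T"
proof (intro exI conjI subsetI)
  let ?T = "(\<lambda>\<alpha>. Poly_Mapping.single \<alpha> 1) ` {\<alpha>. mdeg \<alpha> = t}"
  show "finite ?T" by (simp add: finite_mdeg)
  fix f assume "f \<in> Rt t"
  then have "f = (\<Sum>\<alpha>\<in>{\<alpha>. mdeg \<alpha> = t}. kscale (*) (lookup f \<alpha>) (Poly_Mapping.single \<alpha> 1))"
    unfolding kscale_def by (intro homogeneous_sum_monomials) (simp add: Rt_def)
  also have "\<dots> \<in> kv.span ?T" by (intro kv.span_sum kv.span_scale kv.span_base) auto
  finally show "f \<in> kv.span ?T" .
qed

lemma subspace_ideal_kv: "rng.subspace I \<Longrightarrow> kv.subspace I"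
  by (rule module_subspace_kscale[OF module_mult])

lemma qdim_Rt_exists: "kv.subspace W \<Longrightarrow> \<exists>n. qdim (kscale (*)) (Rt t) W n"
  using Rt_finite_span[of t] kv.qdim_exists[OF subspace_Rt] by blast

lemma qdim_hfun:
  assumes "hom_ideal I"
  shows "qdim (kscale (*)) (Rt t) (I \<inter> Rt t) (hfun I t)"
proof -
  have W: "kv.subspace (I \<inter> Rt t)"
    using assms by (intro kv.subspace_inter subspace_Rt subspace_ideal_kv) (simp add: hom_ideal_def)
  obtain n where n: "qdim (kscale (*)) (Rt t) (I \<inter> Rt t) n" using qdim_Rt_exists[OF W] by blast
  then have "hfun I t = n" unfolding hfun_def by (intro the_equality) (auto dest: kv.qdim_unique[OF W])
  then show ?thesis using n by simp
qed

definition colon :: "('n::finite, 'k::field) mpoly set \<Rightarrow> ('n, 'k) mpoly \<Rightarrow> ('n, 'k) mpoly set" where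
  "colon I f = {g. g * f \<in> I}"

definition ideal_add :: "('n::finite, 'k::field) mpoly set \<Rightarrow> ('n, 'k) mpoly \<Rightarrow> ('n, 'k) mpoly set" where
  "ideal_add I f = {u + g * f | u g. u \<in> I}"

lemma hom_ideal_colon:
  assumes I: "hom_ideal I" and f: "homogeneous a f"
  shows "hom_ideal (colon I f)"
  unfolding hom_ideal_def
proof (intro conjI ballI allI)
  show "rng.subspace (colon I f)"
    by (rule rng.subspaceI) (auto simp: colon_def distrib_right mult.assoc intro: hom_idealD[OF I] hom_ideal_mult[OF I])
  fix g e assume "g \<in> colon I f"
  then have "hc (e + a) (g * f) \<in> I" by (auto simp: colon_def intro: hom_ideal_hc[OF I])
  then show "hc e g \<in> colon I f" by (simp add: colon_def hc_mult_homogeneous[OF f])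
qed

lemma hom_ideal_add:
  assumes I: "hom_ideal I" and f: "homogeneous a f"
  shows "hom_ideal (ideal_add I f)"
  unfolding hom_ideal_def
proof (intro conjI ballI allI)
  show "rng.subspace (ideal_add I f)"
  proof (rule rng.subspaceI)
    show "0 \<in> ideal_add I f" unfolding ideal_add_def using hom_idealD(1)[OF I] by (intro CollectI exI[of _ 0]) auto
  next
    fix x y assume "x \<in> ideal_add I f" "y \<in> ideal_add I f"
    then obtain u g u' g' where "x = u + g * f" "y = u' + g' * f" "u \<in> I" "u' \<in> I" unfolding ideal_add_def by blast
    then show "x + y \<in> ideal_add I f" unfolding ideal_add_def
      by (intro CollectI exI[of _ "u + u'"] exI[of _ "g + g'"]) (auto simp: algebra_simps intro: hom_idealD(2)[OF I])
  next
    fix c x assume "x \<in> ideal_add I f"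
    then obtain u g where "x = u + g * f" "u \<in> I" unfolding ideal_add_def by blast
    then show "c * x \<in> ideal_add I f" unfolding ideal_add_def
      by (intro CollectI exI[of _ "c * u"] exI[of _ "c * g"]) (auto simp: algebra_simps intro: hom_ideal_mult(1)[OF I])
  qed
  fix x e assume "x \<in> ideal_add I f"
  then obtain u g where x: "x = u + g * f" "u \<in> I" unfolding ideal_add_def by blast
  have "hc e x = hc e u + (if a \<le> e then hc (e - a) g else 0) * f"
    by (simp add: x(1) hc_add hc_mult_homogeneous[OF f])
  then show "hc e x \<in> ideal_add I f" unfolding ideal_add_def using hom_ideal_hc[OF I x(2)] by blast
qed

lemma ideal_add_supset: "I \<subseteq> ideal_add I f" "0 \<in> I \<Longrightarrow> f \<in> ideal_add I f"
proof -
  show "I \<subseteq> ideal_add I f"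
  proof
    fix u assume "u \<in> I"
    then show "u \<in> ideal_add I f" unfolding ideal_add_def by (intro CollectI exI[of _ u] exI[of _ 0]) simp
  qed
  show "f \<in> ideal_add I f" if "0 \<in> I"
    unfolding ideal_add_def using that by (intro CollectI exI[of _ 0] exI[of _ 1]) simp
qed

text \<open>Dimensions in the exact sequence \<open>0 \<rightarrow> (R/(I:f))(-a) \<rightarrow> R/I
  \<rightarrow> R/(I+f) \<rightarrow> 0\<close>, whose injection is multiplication by
  \<open>f\<close>.\<close>

lemma hfun_colon_add:
  fixes I :: "('n::finite, 'k::field) mpoly set"
  assumes I: "hom_ideal I" and f: "homogeneous a f" and t: "a \<le> t"
  shows "hfun I t = hfun (ideal_add I f) t + hfun (colon I f) (t - a)"
proof -
  let ?W = "I \<inter> Rt t" and ?V = "ideal_add I f \<inter> Rt t" and ?C = "colon I f \<inter> Rt (t - a)"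
  note IA = hom_ideal_add[OF I f] and IC = hom_ideal_colon[OF I f]
  have V: "kv.subspace ?V" using IA by (intro kv.subspace_inter subspace_Rt subspace_ideal_kv) (simp add: hom_ideal_def)
  have W: "kv.subspace ?W" using I by (intro kv.subspace_inter subspace_Rt subspace_ideal_kv) (simp add: hom_ideal_def)
  have "qdim (kscale (*)) ?V ?W (hfun (colon I f) (t - a))"
  proof (rule qdim_transfer[where \<rho> = "\<lambda>x g. x - g * f \<in> I", OF _ _ _ _ _ V subspace_Rt _ _ _ qdim_hfun[OF IC]])
    show "vector_space (kscale ((*) :: ('n, 'k) mpoly \<Rightarrow> _))" "vector_space (kscale ((*) :: ('n, 'k) mpoly \<Rightarrow> _))" by unfold_locales
    show "0 - 0 * f \<in> I" using hom_idealD(1)[OF I] by simp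
    fix x x' y y' assume "x - x' * f \<in> I" "y - y' * f \<in> I"
    then have "(x - x' * f) + (y - y' * f) \<in> I" by (rule hom_idealD(2)[OF I])
    then show "x + y - (x' + y') * f \<in> I" by (simp add: algebra_simps)
  next
    fix c x x' assume "x - x' * f \<in> I"
    then have "const c * (x - x' * f) \<in> I" by (rule hom_ideal_mult(1)[OF I])
    then show "kscale (*) c x - kscale (*) c x' * f \<in> I" by (simp add: kscale_def algebra_simps)
  next
    fix x assume x: "x \<in> ?V"
    then obtain u g where ug: "x = u + g * f" "u \<in> I" unfolding ideal_add_def by blast
    \<comment> \<open>Replacing \<open>g\<close> by its component of degree \<open>t - a\<close>
      keeps the congruence, since \<open>I\<close> is homogeneous.\<close>
    have "x = hc t x" using x hc_homogeneous[of t x t] by (simp add: Rt_def)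
    also have "\<dots> = hc t u + hc (t - a) g * f" using t by (simp add: ug(1) hc_add hc_mult_homogeneous[OF f])
    finally have "x - hc (t - a) g * f \<in> I" using hom_ideal_hc[OF I ug(2), of t] by (metis add_diff_cancel_right')
    then show "\<exists>g\<in>Rt (t - a). x - g * f \<in> I" by (rule bexI) (simp add: Rt_def homogeneous_hc)
  next
    fix g :: "('n, 'k) mpoly" assume g: "g \<in> Rt (t - a)"
    then have "homogeneous (t - a + a) (g * f)" using f by (intro homogeneous_mult) (auto simp: Rt_def)
    moreover have "g * f \<in> ideal_add I f" unfolding ideal_add_def using hom_idealD(1)[OF I] by (intro CollectI exI[of _ 0] exI[of _ g]) simp
    ultimately have "g * f \<in> ?V" using t by (simp add: Rt_def)
    then show "\<exists>x\<in>?V. x - g * f \<in> I" using hom_idealD(1)[OF I] by (intro bexI[of _ "g * f"]) simp_all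
  next
    fix x g assume x: "x \<in> ?V" and g: "g \<in> Rt (t - a)" and xg: "x - g * f \<in> I"
    have "x \<in> I \<longleftrightarrow> g * f \<in> I"
    proof
      assume "x \<in> I"
      then have "x - (x - g * f) \<in> I" using xg hom_idealD(3)[OF I] by blast
      then show "g * f \<in> I" by simp
    next
      assume "g * f \<in> I"
      then have "g * f + (x - g * f) \<in> I" using xg hom_idealD(2)[OF I] by blast
      then show "x \<in> I" by simp
    qed
    then show "x \<in> ?W \<longleftrightarrow> g \<in> ?C" using x g by (auto simp: colon_def)
  qed
  moreover have "?W \<subseteq> ?V" using ideal_add_supset(1) by blast
  ultimately have "qdim (kscale (*)) (Rt t) ?W (hfun (ideal_add I f) t + hfun (colon I f) (t - a))"
    by (intro kv.qdim_add[OF V _ _ qdim_hfun[OF IA]]) auto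
  then show ?thesis using kv.qdim_unique[OF W qdim_hfun[OF I]] by blast
qed

section \<open>Chains of primes\<close>

text \<open>If \<open>a\<close> and \<open>b\<close> lie outside \<open>I\<close>, take their lowest
  components outside \<open>I\<close>, of degrees \<open>s\<close> and \<open>u\<close>. In the
  component of \<open>a b\<close> of degree \<open>s + u\<close> every other product has a factor in
  \<open>I\<close>, so the product of the two components lies in \<open>I\<close> as well.\<close>

lemma hom_ideal_prime:
  assumes I: "hom_ideal I" and proper: "I \<noteq> UNIV"
    and hom: "\<And>a b f g. homogeneous a f \<Longrightarrow> homogeneous b g \<Longrightarrow> f * g \<in> I \<Longrightarrow> f \<in> I \<or> g \<in> I"
  shows "prime_ideal I"
  unfolding prime_ideal_def
proof (intro conjI allI impI)
  show "rng.subspace I" "I \<noteq> UNIV" using I proper by (simp_all add: hom_ideal_def)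
  fix a b assume ab: "a * b \<in> I"
  show "a \<in> I \<or> b \<in> I"
  proof (rule ccontr)
    assume "\<not> (a \<in> I \<or> b \<in> I)"
    then have ex: "\<exists>s. hc s a \<notin> I" "\<exists>s. hc s b \<notin> I" using hom_ideal_iff_hc[OF I] by blast+
    define s where "s = (LEAST s. hc s a \<notin> I)"
    define u where "u = (LEAST u. hc u b \<notin> I)"
    have s: "hc s a \<notin> I" "\<And>d. d < s \<Longrightarrow> hc d a \<in> I"
      unfolding s_def using LeastI_ex[OF ex(1)] not_less_Least by blast+
    have u: "hc u b \<notin> I" "\<And>d. d < u \<Longrightarrow> hc d b \<in> I"
      unfolding u_def using LeastI_ex[OF ex(2)] not_less_Least by blast+
    define D where "D = mdeg ` keys a - {s}"
    have D: "finite D" "s \<notin> D" by (simp_all add: D_def)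
    have a: "a = (\<Sum>d\<in>insert s D. hc d a)" by (rule sum_hc) (auto simp: D_def)
    have trm: "hc (s + u) (b * hc d a) = (if d \<le> s + u then hc (s + u - d) b * hc d a else 0)" for d
      by (rule hc_mult_homogeneous[OF homogeneous_hc])
    have "hc (s + u) (b * a) = (\<Sum>d\<in>insert s D. hc (s + u) (b * hc d a))"
      by (subst a) (simp only: sum_distrib_left hc_sum)
    also have "\<dots> = hc u b * hc s a + (\<Sum>d\<in>D. hc (s + u) (b * hc d a))"
      using trm[of s] D by simp
    finally have eq: "hc u b * hc s a = hc (s + u) (a * b) - (\<Sum>d\<in>D. hc (s + u) (b * hc d a))"
      by (simp add: mult.commute)
    have "(\<Sum>d\<in>D. hc (s + u) (b * hc d a)) \<in> I"
    proof (rule hom_idealD(4)[OF I])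
      fix d assume "d \<in> D"
      then consider "d < s" | "s < d" by (fastforce simp: D_def)
      then show "hc (s + u) (b * hc d a) \<in> I"
      proof cases
        case 1
        then show ?thesis unfolding trm using s(2) hom_ideal_mult(1)[OF I] hom_idealD(1)[OF I] by auto
      next
        case 2
        then have "hc (s + u - d) b \<in> I" if "d \<le> s + u" using that by (intro u(2)) linarith
        then show ?thesis unfolding trm using hom_ideal_mult(2)[OF I] hom_idealD(1)[OF I] by auto
      qed
    qed
    then have "hc u b * hc s a \<in> I" unfolding eq using hom_ideal_hc[OF I ab] by (intro hom_idealD(3)[OF I])
    then show False using hom[OF homogeneous_hc homogeneous_hc] s(1) u(1) by blast
  qed
qed

lemma hfun_eq_0:
  fixes I :: "('n::finite, 'k::field) mpoly set"
  assumes "hom_ideal I" "Rt t \<subseteq> I"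
  shows "hfun I t = 0"
proof -
  have "I \<inter> Rt t = Rt t" using assms(2) by blast
  then have "qdim (kscale (*)) (Rt t) (Rt t :: ('n, 'k) mpoly set) (hfun I t)" using qdim_hfun[OF assms(1), of t] by simp
  then show ?thesis by (rule kv.qdim_unique[OF subspace_Rt _ kv.qdim_self[OF subspace_Rt]])
qed

text \<open>A homogeneous ideal that is maximal among those of large growth is prime, because
  \<open>R/J\<close> is an extension of \<open>R/(J + f)\<close> by a shift of \<open>R/(J : f)\<close>.\<close>

lemma maximal_growth_prime:
  fixes I :: "('n::{finite,linorder}, 'k::field) mpoly set"
  assumes I: "hom_ideal I" and grow: "\<not> bounded_growth e (hfun I)"
  shows "\<exists>J. hom_ideal J \<and> I \<subseteq> J \<and> \<not> bounded_growth e (hfun J) \<and> prime_ideal J"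
proof -
  let ?r = "{(J, I). hom_ideal (I :: ('n, 'k) mpoly set) \<and> hom_ideal J \<and> I \<subset> J}"
  let ?Q = "{J. hom_ideal J \<and> I \<subseteq> J \<and> \<not> bounded_growth e (hfun J)}"
  obtain J where J: "J \<in> ?Q" "\<And>K. (K, J) \<in> ?r \<Longrightarrow> K \<notin> ?Q"
    supply min = that
  proof (rule wfE_min[OF hom_ideal_acc])
    show "I \<in> ?Q" using I grow by simp
    show thesis if "z \<in> ?Q" "\<And>y. (y, z) \<in> ?r \<Longrightarrow> y \<notin> ?Q" for z using that by (rule min)
  qed
  then have hJ: "hom_ideal J" and IJ: "I \<subseteq> J" and gJ: "\<not> bounded_growth e (hfun J)" by auto
  have mx: "bounded_growth e (hfun K)" if "hom_ideal K" "J \<subset> K" for K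
  proof (rule ccontr)
    assume "\<not> bounded_growth e (hfun K)"
    then have "K \<in> ?Q" using that IJ by auto
    moreover have "(K, J) \<in> ?r" using that hJ by simp
    ultimately show False using J(2)[of K] by metis
  qed
  have "prime_ideal J"
  proof (rule hom_ideal_prime[OF hJ])
    show "J \<noteq> UNIV"
    proof
      assume "J = UNIV"
      then have "hfun J t = 0" for t by (intro hfun_eq_0[OF hJ]) simp
      then have "bounded_growth e (hfun J)" by (intro bounded_growth_zero)
      then show False using gJ by simp
    qed
    fix a b f g assume f: "homogeneous a f" and g: "homogeneous b g" and fg: "f * g \<in> J"
    show "f \<in> J \<or> g \<in> J"
    proof (rule ccontr)
      assume no: "\<not> (f \<in> J \<or> g \<in> J)"
      have "J \<subset> ideal_add J f" using ideal_add_supset[of J f] hom_idealD(1)[OF hJ] no by blast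
      then have 1: "bounded_growth e (hfun (ideal_add J f))" by (rule mx[OF hom_ideal_add[OF hJ f]])
      have "J \<subseteq> colon J f" unfolding colon_def using hom_ideal_mult(2)[OF hJ] by blast
      moreover have "g \<in> colon J f" using fg by (simp add: colon_def mult.commute)
      ultimately have "J \<subset> colon J f" using no by blast
      then have "bounded_growth e (hfun (colon J f))" by (rule mx[OF hom_ideal_colon[OF hJ f]])
      from bounded_growth_shift[OF this, of "int a"]
      have "bounded_growth e (\<lambda>t. hfun (ideal_add J f) t + (if int a \<le> int t then hfun (colon J f) (nat (int t - int a)) else 0))"
        by (rule bounded_growth_add[OF 1])
      \<comment> \<open>The additivity of \<open>hfun\<close> holds from degree \<open>a\<close> on,
        which is enough for growth.\<close>
      then have "bounded_growth e (hfun J)"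
        by (rule bounded_growth_mono[where N = a]) (simp add: hfun_colon_add[OF hJ f] nat_diff_distrib)
      then show False using gJ by blast
    qed
  qed
  then show ?thesis using hJ IJ gJ by blast
qed

lemma lookup_var_mult_zero: "lookup (var i * h) 0 = 0"
proof -
  have "0 \<noteq> Poly_Mapping.single i (1::nat) + \<alpha>" for \<alpha>
  proof
    assume e: "0 = Poly_Mapping.single i (1::nat) + \<alpha>"
    have "(0::nat) = lookup (Poly_Mapping.single i (1::nat) + \<alpha>) i" unfolding e[symmetric] by simp
    then show False by (simp add: lookup_add)
  qed
  then show ?thesis unfolding var_def by (rule lookup_single_mult(2))
qed

text \<open>Evaluation at the origin is multiplicative: the part of \<open>f\<close> without
  constant term is a combination of the variables and contributes nothing.\<close>

lemma lookup_mult_zero: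
  fixes f g :: "('n::finite, 'k::field) mpoly"
  shows "lookup (f * g) 0 = lookup f 0 * lookup g 0"
proof -
  define f' where "f' = f - const (lookup f 0)"
  have "lookup f' 0 = 0" by (simp add: f'_def lookup_minus)
  then obtain h where h: "f' = (\<Sum>i\<in>UNIV. var i * h i)" using lookup_zero_in_mmul unfolding mmul_def by blast
  have "lookup (f' * g) 0 = 0" unfolding h sum_distrib_right lookup_sum mult.assoc by (simp add: lookup_var_mult_zero)
  moreover have "lookup (const (lookup f 0) * g) 0 = lookup f 0 * lookup g 0"
    using lookup_single_mult(1)[of 0 "lookup f 0" g 0] by (simp add: const_def)
  moreover have "f * g = const (lookup f 0) * g + f' * g" by (simp add: f'_def algebra_simps)
  ultimately show ?thesis by (simp add: lookup_add)
qed

lemma prime_irrelevant: "prime_ideal {f :: ('n::finite, 'k::field) mpoly. lookup f 0 = 0}"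
  unfolding prime_ideal_def
proof (intro conjI allI impI)
  show "rng.subspace {f :: ('n, 'k) mpoly. lookup f 0 = 0}"
    by (rule rng.subspaceI) (auto simp: lookup_add lookup_mult_zero)
  have "(1 :: ('n, 'k) mpoly) \<notin> {f. lookup f 0 = 0}" by simp
  then show "{f :: ('n, 'k) mpoly. lookup f 0 = 0} \<noteq> UNIV" by blast
qed (auto simp: lookup_mult_zero)

text \<open>A homogeneous ideal contains the constant terms of its elements, and a nonzero constant
  is a unit.\<close>

lemma hom_ideal_subset_irrelevant:
  fixes J :: "('n::finite, 'k::field) mpoly set"
  assumes J: "hom_ideal J" "J \<noteq> UNIV" and f: "f \<in> J"
  shows "lookup f 0 = 0"
proof (rule ccontr)
  assume c: "lookup f 0 \<noteq> 0"
  have "\<alpha> = 0" if "mdeg \<alpha> = 0" for \<alpha> :: "'n \<Rightarrow>\<^sub>0 nat"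
    by (rule poly_mapping_eqI) (use that in \<open>simp add: mdeg_def\<close>)
  then have "hc 0 f = const (lookup f 0)"
    by (intro poly_mapping_eqI) (auto simp: lookup_hc const_def lookup_single when_def)
  then have "const (1 / lookup f 0) * const (lookup f 0) \<in> J"
    using hom_ideal_hc[OF J(1) f, of 0] hom_ideal_mult(1)[OF J(1)] by metis
  then have "1 \<in> J" using c by (simp flip: const_mult)
  then have "g \<in> J" for g using hom_ideal_mult(1)[OF J(1), of 1 g] by simp
  then show False using J(2) by blast
qed

text \<open>A variable outside the prime \<open>J\<close> is a nonzerodivisor modulo
  \<open>J\<close>, so adding it lowers the order of growth by at most one. The chain found above
  \<open>J + x\<close> is prolonged downwards by \<open>J\<close>.\<close>

lemma growth_prime_chain:
  fixes I :: "('n::{finite,linorder}, 'k::field) mpoly set"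
  assumes "hom_ideal I" "\<not> bounded_growth e (hfun I)"
  shows "\<exists>P. (\<forall>j\<le>Suc e. prime_ideal (P j) \<and> I \<subseteq> P j) \<and> (\<forall>j<Suc e. P j \<subset> P (Suc j))"
  using assms
proof (induction e arbitrary: I rule: less_induct)
  case (less e)
  note I = less.prems
  obtain J where J: "hom_ideal J" "I \<subseteq> J" "\<not> bounded_growth e (hfun J)" "prime_ideal J"
    using maximal_growth_prime[OF I] by blast
  have JU: "J \<noteq> UNIV" using J(4) by (simp add: prime_ideal_def)
  \<comment> \<open>Otherwise \<open>R / J\<close> vanishes in all positive degrees and has no
    growth.\<close>
  have "\<exists>i. var i \<notin> J"
  proof (rule ccontr)
    assume "\<nexists>i. var i \<notin> J"
    then have v: "var i \<in> J" for i by blast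
    have "Rt t \<subseteq> J" if "t \<ge> 1" for t
    proof
      fix f :: "('n, 'k) mpoly" assume "f \<in> Rt t"
      then have "lookup f 0 = 0" using that by (auto simp: Rt_def homogeneous_iff dest: spec[of _ 0])
      then obtain h where "f = (\<Sum>i\<in>UNIV. var i * h i)" using lookup_zero_in_mmul unfolding mmul_def by blast
      then show "f \<in> J" using v by (auto intro: hom_idealD(4)[OF J(1)] hom_ideal_mult(2)[OF J(1)])
    qed
    then have "bounded_growth e (hfun J)" by (intro bounded_growth_zero[where N = 1] hfun_eq_0[OF J(1)])
    then show False using J(3) by blast
  qed
  then obtain x where x: "var x \<notin> J" ..
  have hv: "homogeneous 1 (var x :: ('n, 'k) mpoly)" by (rule homogeneous_var)
  show ?case
  proof (cases e)
    \<comment> \<open>For \<open>e = 0\<close> a chain with one inclusion is wanted: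
      \<open>J\<close> below the maximal graded ideal, strictly since the latter contains the
      missing variable.\<close>
    case 0
    let ?m = "{f :: ('n, 'k) mpoly. lookup f 0 = 0}"
    have "J \<subseteq> ?m" using hom_ideal_subset_irrelevant[OF J(1) JU] by blast
    moreover have "var x \<in> ?m" using lookup_var_mult_zero[of x 1] by simp
    ultimately have "J \<subset> ?m" using x by blast
    then show ?thesis using J(2,4) prime_irrelevant 0
      by (intro exI[of _ "\<lambda>j. if j = 0 then J else ?m"]) auto
  next
    case (Suc e')
    let ?K = "ideal_add J (var x)"
    have K: "hom_ideal ?K" by (rule hom_ideal_add[OF J(1) hv])
    have "colon J (var x) = J"
      using J(4) x hom_ideal_mult(2)[OF J(1)] unfolding prime_ideal_def colon_def by blast
    \<comment> \<open>The values of \<open>hfun ?K\<close> are the increments of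
      \<open>hfun J\<close>, so a bound of order \<open>e'\<close> for them would give one of order
      \<open>e\<close> for \<open>J\<close>.\<close>
    then have "hfun J (Suc t) = hfun ?K (Suc t) + hfun J t" for t
      using hfun_colon_add[OF J(1) hv, of "Suc t"] by simp
    then have "\<not> bounded_growth e' (hfun ?K)"
      using bounded_growth_Suc[of e' "hfun ?K" "hfun J"] J(3) Suc by auto
    then obtain P where P: "\<And>j. j \<le> Suc e' \<Longrightarrow> prime_ideal (P j) \<and> ?K \<subseteq> P j" "\<And>j. j < Suc e' \<Longrightarrow> P j \<subset> P (Suc j)"
      using less.IH[of e', OF _ K] Suc by blast
    have JK: "J \<subseteq> ?K" "var x \<in> ?K" using ideal_add_supset[of J] hom_idealD(1)[OF J(1)] by blast+
    define P' where "P' j = (case j of 0 \<Rightarrow> J | Suc j \<Rightarrow> P j)" for j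
    have "prime_ideal (P' j) \<and> I \<subseteq> P' j" if "j \<le> Suc e" for j
      using that P(1) J(2,4) JK Suc by (cases j) (auto simp: P'_def)
    moreover have "P' j \<subset> P' (Suc j)" if "j < Suc e" for j
    proof (cases j)
      case 0
      then show ?thesis using P(1)[of 0] JK x by (auto simp: P'_def)
    qed (use that P(2) Suc in \<open>simp add: P'_def\<close>)
    ultimately show ?thesis by blast
  qed
qed

section \<open>The degree of the Hilbert polynomial\<close>

context graded
begin

definition ann :: "'m \<Rightarrow> ('n, 'k) mpoly set" where
  "ann g = {f. sm f g = 0}"

lemma hom_ideal_ann:
  assumes "g \<in> G a"
  shows "hom_ideal (ann g)"
  unfolding hom_ideal_def
proof (intro conjI ballI allI)
  show "rng.subspace (ann g)"
  proof (rule rng.subspaceI)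
    fix c f assume "f \<in> ann g"
    then have "sm c (sm f g) = 0" by (simp add: ann_def)
    then show "c * f \<in> ann g" by (simp add: ann_def)
  qed (auto simp: ann_def scale_left_distrib)
  fix f e assume "f \<in> ann g"
  then have "comp (a + int e) (sm f g) = 0" by (simp add: ann_def)
  then show "hc e f \<in> ann g" by (simp add: comp_scale_general[OF assms] ann_def)
qed

text \<open>Adding the generators one at a time filters each component of the module. The quotient
  of two successive steps is a quotient of a shift of \<open>R / ann g\<close>, and finitely many
  bounds of the same order add up.\<close>

lemma bounded_growth_hilbert_function:
  assumes fg: "finitely_generated sm" and J: "finite J" "\<forall>(a, g)\<in>J. g \<in> G a"
    and gen: "\<forall>t. \<forall>x\<in>G t. \<exists>f. (\<forall>(a, g)\<in>J. homogeneous (nat (t - a)) (f (a, g)) \<and> (t < a \<longrightarrow> f (a, g) = 0))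
       \<and> x = (\<Sum>(a, g)\<in>J. sm (f (a, g)) g)"
    and grow: "\<And>a g. (a, g) \<in> J \<Longrightarrow> bounded_growth e (hfun (ann g))"
  shows "bounded_growth e (\<lambda>t. hilbert_function sm G (int t))"
proof -
  \<comment> \<open>The degree \<open>t\<close> part of the submodule generated by the pairs in
    \<open>K\<close>.\<close>
  define V where "V K t = {\<Sum>(a, g)\<in>K. sm (f (a, g)) g | f. \<forall>(a, g)\<in>K. homogeneous (nat (int t - a)) (f (a, g)) \<and> (int t < a \<longrightarrow> f (a, g) = 0)}" for K and t :: nat
  have Vsub: "k.subspace (V K t)" for K t
  proof (rule k.subspaceI)
    show "0 \<in> V K t" unfolding V_def by (intro CollectI exI[of _ "\<lambda>_. 0"]) (auto simp: case_prod_unfold)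
  next
    fix x y assume "x \<in> V K t" "y \<in> V K t"
    then obtain f f' where "x = (\<Sum>(a, g)\<in>K. sm (f (a, g)) g)" "y = (\<Sum>(a, g)\<in>K. sm (f' (a, g)) g)"
      "\<forall>(a, g)\<in>K. homogeneous (nat (int t - a)) (f (a, g)) \<and> (int t < a \<longrightarrow> f (a, g) = 0)"
      "\<forall>(a, g)\<in>K. homogeneous (nat (int t - a)) (f' (a, g)) \<and> (int t < a \<longrightarrow> f' (a, g) = 0)"
      unfolding V_def by blast
    then show "x + y \<in> V K t" unfolding V_def
      by (intro CollectI exI[of _ "\<lambda>j. f j + f' j"])
        (auto simp: scale_left_distrib sum.distrib case_prod_unfold intro: homogeneous_add)
  next
    fix c x assume "x \<in> V K t"
    then obtain f where "x = (\<Sum>(a, g)\<in>K. sm (f (a, g)) g)"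
      "\<forall>(a, g)\<in>K. homogeneous (nat (int t - a)) (f (a, g)) \<and> (int t < a \<longrightarrow> f (a, g) = 0)"
      unfolding V_def by blast
    then show "kscale sm c x \<in> V K t" unfolding V_def
      by (intro CollectI exI[of _ "\<lambda>j. const c * f j"])
        (auto simp: scale_sum_right case_prod_unfold kscale_def intro: homogeneous_const_mult)
  qed
  have "\<exists>h. bounded_growth e h \<and> (\<forall>t. \<exists>n\<le>h t. qdim (kscale sm) (V K t) {0} n)" if "K \<subseteq> J" "finite K" for K
    using that(2,1)
  proof (induction K)
    case empty
    have "V {} t = {0}" for t by (auto simp: V_def)
    then have "qdim (kscale sm) (V {} t) {0} 0" for t using k.qdim_self[OF k.subspace_single_0] by simp
    then show ?case by (intro exI[of _ "\<lambda>_. 0"]) (auto intro: bounded_growth_zero)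
  next
    case (insert j K)
    then obtain h where h: "bounded_growth e h" "\<And>t. \<exists>n\<le>h t. qdim (kscale sm) (V K t) {0} n" by blast
    obtain a g where j: "j = (a, g)" by (cases j)
    have g: "g \<in> G a" and bg: "bounded_growth e (hfun (ann g))" using J(2) grow insert.prems j by auto
    let ?s = "\<lambda>t. if a \<le> int t then hfun (ann g) (nat (int t - a)) else 0"
    have Vins: "x \<in> V (insert j K) t \<longleftrightarrow> (\<exists>f. homogeneous (nat (int t - a)) f \<and> (int t < a \<longrightarrow> f = 0) \<and> x - sm f g \<in> V K t)" for x t
    proof
      assume "x \<in> V (insert j K) t"
      then obtain f where f: "x = (\<Sum>(a, g)\<in>insert j K. sm (f (a, g)) g)"
        "\<forall>(a, g)\<in>insert j K. homogeneous (nat (int t - a)) (f (a, g)) \<and> (int t < a \<longrightarrow> f (a, g) = 0)" unfolding V_def by blast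
      have "x - sm (f (a, g)) g = (\<Sum>(a, g)\<in>K. sm (f (a, g)) g)" using f(1) insert.hyps j by simp
      moreover have "\<dots> \<in> V K t" unfolding V_def using f(2) by blast
      ultimately show "\<exists>f. homogeneous (nat (int t - a)) f \<and> (int t < a \<longrightarrow> f = 0) \<and> x - sm f g \<in> V K t"
        using f(2) j by (intro exI[of _ "f (a, g)"]) auto
    next
      assume "\<exists>f. homogeneous (nat (int t - a)) f \<and> (int t < a \<longrightarrow> f = 0) \<and> x - sm f g \<in> V K t"
      then obtain f0 where f0: "homogeneous (nat (int t - a)) f0" "int t < a \<longrightarrow> f0 = 0" "x - sm f0 g \<in> V K t" by blast
      then obtain f where f: "x - sm f0 g = (\<Sum>(a, g)\<in>K. sm (f (a, g)) g)"
        "\<forall>(a, g)\<in>K. homogeneous (nat (int t - a)) (f (a, g)) \<and> (int t < a \<longrightarrow> f (a, g) = 0)" unfolding V_def by blast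
      define f' where "f' = f(j := f0)"
      have "(\<Sum>(a, g)\<in>K. sm (f' (a, g)) g) = (\<Sum>(a, g)\<in>K. sm (f (a, g)) g)"
        using insert.hyps by (intro sum.cong) (auto simp: f'_def)
      then have "x = (\<Sum>(a, g)\<in>insert j K. sm (f' (a, g)) g)" using f(1) insert.hyps j by (simp add: f'_def algebra_simps)
      moreover have "\<forall>(a, g)\<in>insert j K. homogeneous (nat (int t - a)) (f' (a, g)) \<and> (int t < a \<longrightarrow> f' (a, g) = 0)"
        using f(2) f0 j by (auto simp: f'_def)
      ultimately show "x \<in> V (insert j K) t" unfolding V_def by blast
    qed
    have VK: "V K t \<subseteq> V (insert j K) t" for t unfolding subset_iff Vins by (auto intro: exI[of _ 0])
    have step: "\<exists>n\<le>?s t. qdim (kscale sm) (V (insert j K) t) (V K t) n" for t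
    proof (cases "a \<le> int t")
      case False
      then have "V (insert j K) t \<subseteq> V K t" unfolding subset_iff Vins by auto
      then have "V (insert j K) t = V K t" using VK by blast
      then show ?thesis using k.qdim_self[OF Vsub] by auto
    next
      case True
      define s where "s = nat (int t - a)"
      \<comment> \<open>Multiplication by \<open>g\<close> identifies the successive quotient with
        \<open>Rt s\<close> modulo \<open>I\<close>. As \<open>I\<close> contains
        \<open>ann g\<close>, its dimension is at most that of \<open>R / ann g\<close> in degree
        \<open>s\<close>.\<close>
      define I where "I = {f. sm f g \<in> V K t}"
      have sc: "sm (const c * f) g \<in> V K t" if "sm f g \<in> V K t" for c f
        using k.subspace_scale[OF Vsub that, of c] by (simp add: kscale_def)
      have Isub: "kv.subspace I"
        unfolding I_def using k.subspace_0[OF Vsub] k.subspace_add[OF Vsub]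
        by (intro kv.subspaceI) (auto simp: scale_left_distrib kscale_def sc)
      have IRsub: "kv.subspace (I \<inter> Rt s)" by (intro kv.subspace_inter Isub subspace_Rt)
      have sub: "ann g \<inter> Rt s \<subseteq> I \<inter> Rt s" unfolding ann_def I_def using k.subspace_0[OF Vsub] by auto
      have asub: "kv.subspace (ann g \<inter> Rt s)"
        using hom_ideal_ann[OF g] by (intro kv.subspace_inter subspace_Rt subspace_ideal_kv) (simp add: hom_ideal_def)
      obtain n where n: "qdim (kscale (*)) (Rt s) (I \<inter> Rt s) n" using qdim_Rt_exists[OF IRsub] by blast
      obtain T :: "('n, 'k) mpoly set" where T: "finite T" "Rt s \<subseteq> kv.span T" using Rt_finite_span by blast
      have "I \<inter> Rt s \<subseteq> kv.span T" using T(2) by blast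
      then obtain m where m: "qdim (kscale (*)) (I \<inter> Rt s) (ann g \<inter> Rt s) m"
        using kv.qdim_exists[OF IRsub asub T(1)] by blast
      have "qdim (kscale (*)) (Rt s) (ann g \<inter> Rt s) (n + m)" by (rule kv.qdim_add[OF IRsub sub _ n m]) simp
      then have "hfun (ann g) s = n + m" using kv.qdim_unique[OF asub qdim_hfun[OF hom_ideal_ann[OF g]]] by blast
      then have le: "n \<le> ?s t" using True by (simp add: s_def)
      have "qdim (kscale sm) (V (insert j K) t) (V K t) n"
      proof (rule qdim_transfer[where \<rho> = "\<lambda>x f. x - sm f g \<in> V K t", OF _ _ _ _ _ Vsub subspace_Rt _ _ _ n])
        show "vector_space (kscale sm)" "vector_space (kscale ((*) :: ('n, 'k) mpoly \<Rightarrow> _))" by unfold_locales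
        show "0 - sm 0 g \<in> V K t" using k.subspace_0[OF Vsub] by simp
        fix x x' y y' assume "x - sm x' g \<in> V K t" "y - sm y' g \<in> V K t"
        then have "(x - sm x' g) + (y - sm y' g) \<in> V K t" by (rule k.subspace_add[OF Vsub])
        then show "x + y - sm (x' + y') g \<in> V K t" by (simp add: algebra_simps)
      next
        fix c x x' assume "x - sm x' g \<in> V K t"
        then have "kscale sm c (x - sm x' g) \<in> V K t" by (rule k.subspace_scale[OF Vsub])
        then show "kscale sm c x - sm (kscale (*) c x') g \<in> V K t"
          by (simp add: kscale_def scale_right_diff_distrib)
      next
        fix x assume "x \<in> V (insert j K) t"
        then show "\<exists>f\<in>Rt s. x - sm f g \<in> V K t" unfolding Vins by (auto simp: Rt_def s_def)
      next
        fix f :: "('n, 'k) mpoly" assume "f \<in> Rt s"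
        then have "sm f g \<in> V (insert j K) t" unfolding Vins using True k.subspace_0[OF Vsub]
          by (intro exI[of _ f]) (auto simp: Rt_def s_def)
        then show "\<exists>x\<in>V (insert j K) t. x - sm f g \<in> V K t" using k.subspace_0[OF Vsub] by (intro bexI[of _ "sm f g"]) simp_all
      next
        fix x and f :: "('n, 'k) mpoly" assume f: "f \<in> Rt s" and xf: "x - sm f g \<in> V K t"
        have "x \<in> V K t \<longleftrightarrow> sm f g \<in> V K t"
          using k.subspace_add[OF Vsub xf] k.subspace_diff[OF Vsub _ xf] by fastforce
        then show "x \<in> V K t \<longleftrightarrow> f \<in> I \<inter> Rt s" using f by (simp add: I_def)
      qed
      then show ?thesis using le by blast
    qed
    have "\<exists>n\<le>?s t + h t. qdim (kscale sm) (V (insert j K) t) {0} n" for t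
    proof -
      obtain n1 where n1: "n1 \<le> ?s t" "qdim (kscale sm) (V (insert j K) t) (V K t) n1" using step[of t] by blast
      obtain n2 where n2: "n2 \<le> h t" "qdim (kscale sm) (V K t) {0} n2" using h(2)[of t] by blast
      have "qdim (kscale sm) (V (insert j K) t) {0} (n1 + n2)"
        by (rule k.qdim_add[OF Vsub _ VK n1(2) n2(2)]) (use k.subspace_0[OF Vsub] in simp)
      then show ?thesis using add_mono[OF n1(1) n2(1)] by blast
    qed
    moreover have "bounded_growth e (\<lambda>t. ?s t + h t)" by (intro bounded_growth_add bounded_growth_shift bg h(1))
    ultimately show ?case by blast
  qed
  from this[OF order_refl J(1)] obtain h where h: "bounded_growth e h" "\<And>t. \<exists>n\<le>h t. qdim (kscale sm) (V J t) {0} n" by blast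
  have VJ: "V J t = G (int t)" for t
  proof
    show "V J t \<subseteq> G (int t)"
    proof
      fix x assume "x \<in> V J t"
      then obtain f where f: "x = (\<Sum>(a, g)\<in>J. sm (f (a, g)) g)"
        "\<And>a g. (a, g) \<in> J \<Longrightarrow> homogeneous (nat (int t - a)) (f (a, g)) \<and> (int t < a \<longrightarrow> f (a, g) = 0)" unfolding V_def by blast
      have "sm (f (a, g)) g \<in> G (int t)" if ag: "(a, g) \<in> J" for a g
      proof (cases "a \<le> int t")
        case True
        have "sm (f (a, g)) g \<in> G (a + int (nat (int t - a)))"
          using f(2)[OF ag] J(2) ag by (intro G_homogeneous) auto
        then show ?thesis using True by simp
      qed (use f(2)[OF ag] in simp)
      then show "x \<in> G (int t)" unfolding f(1) by (intro G_sum) auto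
    qed
    show "G (int t) \<subseteq> V J t"
    proof
      fix x assume "x \<in> G (int t)"
      then show "x \<in> V J t" unfolding V_def using gen by blast
    qed
  qed
  have "hilbert_function sm G (int t) \<le> h t" for t
    using h(2)[of t] k.qdim_unique[OF k.subspace_single_0 qdim_hilbert_function[OF fg, of "int t"]] unfolding VJ by metis
  then show ?thesis by (intro bounded_growth_mono[OF h(1), of 0])
qed

end

section \<open>Growth of polynomial values\<close>

lemma poly_eventually_pos:
  fixes p :: "rat poly"
  assumes "lead_coeff p > 0"
  shows "\<exists>\<delta>>0. \<exists>N. \<forall>t::nat. t \<ge> N \<longrightarrow> \<delta> \<le> poly p (of_nat t)"
  using assms
proof (induction p)
  case (pCons a p)
  show ?case
  proof (cases "p = 0")
    case True
    then show ?thesis using pCons.prems by (intro exI[of _ a]) auto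
  next
    case False
    then have "lead_coeff p > 0" using pCons.prems by simp
    then obtain \<delta> N where d: "\<delta> > 0" "\<And>t. t \<ge> N \<Longrightarrow> \<delta> \<le> poly p (of_nat t)" using pCons.IH by blast
    \<comment> \<open>From \<open>M\<close> on, \<open>t \<delta> \<ge> 1 - a\<close>, so
      \<open>a + t p(t)\<close> is at least 1.\<close>
    obtain M where M: "(1 - a) / \<delta> \<le> of_nat M" using real_arch_simple by blast
    have "1 \<le> poly (pCons a p) (of_nat t)" if t: "t \<ge> max N M" for t
    proof -
      have "1 - a \<le> of_nat M * \<delta>" using M d(1) by (simp add: field_simps)
      also have "\<dots> \<le> of_nat t * \<delta>" using t d(1) by (intro mult_right_mono) auto
      also have "\<dots> \<le> of_nat t * poly p (of_nat t)" using d t by (intro mult_left_mono) auto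
      finally show ?thesis by simp
    qed
    then have "\<exists>N. \<forall>t\<ge>N. 1 \<le> poly (pCons a p) (of_nat t)" by blast
    then show ?thesis by (intro exI[of _ 1]) simp
  qed
qed simp

text \<open>\<open>growth (degree P)\<close> is itself given by a polynomial, either zero or of
  smaller degree than \<open>P\<close>. So \<open>P\<close> minus any multiple of it keeps the
  leading coefficient of \<open>P\<close>, which is positive because the values of \<open>P\<close>
  are eventually natural numbers.\<close>

lemma poly_not_bounded_growth:
  fixes P :: "rat poly"
  assumes P: "P \<noteq> 0" and h: "\<And>t. t \<ge> N \<Longrightarrow> poly P (of_nat t) = of_nat (h t)"
  shows "\<not> bounded_growth (degree P) h"
proof
  assume "bounded_growth (degree P) h"
  then obtain C M where C: "\<And>t. t \<ge> M \<Longrightarrow> h t \<le> C * growth (degree P) t" unfolding bounded_growth_def by blast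
  show False
  proof (cases "lead_coeff P > 0")
    case False
    then have "lead_coeff (- P) > 0" using leading_coeff_neq_0[OF P] by (simp add: not_less order.order_iff_strict)
    then obtain \<delta> K where d: "\<delta> > 0" "\<And>t::nat. t \<ge> K \<Longrightarrow> \<delta> \<le> poly (- P) (of_nat t)" using poly_eventually_pos by blast
    have "\<delta> \<le> poly (- P) (of_nat (max N K))" by (rule d(2)) simp
    also have "\<dots> = - of_nat (h (max N K))" using h[of "max N K"] by simp
    finally have "\<delta> \<le> - of_nat (h (max N K))" .
    then show False using d(1) by (metis leD le_minus_iff neg_le_0_iff_le of_nat_0_le_iff order_trans)
  next
    case True
    define g :: "rat poly" where "g = (case degree P of 0 \<Rightarrow> 0 | Suc e \<Rightarrow> [:1, 1:] ^ e)"
    have pg: "poly g (of_nat t) = of_nat (growth (degree P) t)" for t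
      by (simp add: g_def growth_def add.commute split: nat.split)
    define Q where "Q = P - smult (of_nat C) g"
    have "lead_coeff Q = lead_coeff P"
    proof (cases "degree P")
      case 0
      then show ?thesis by (simp add: Q_def g_def)
    next
      case (Suc e)
      have "degree g \<le> e" using degree_power_le[of "[:1, 1:] :: rat poly" e] by (simp add: g_def Suc)
      then have lt: "degree (- smult (of_nat C) g) < degree P" using degree_smult_le[of "of_nat C :: rat" g] Suc by simp
      have Qe: "Q = P + - smult (of_nat C) g" by (simp add: Q_def)
      show ?thesis unfolding Qe degree_add_eq_left[OF lt] coeff_add using coeff_eq_0[OF lt] by simp
    qed
    then have "lead_coeff Q > 0" using True by simp
    then obtain \<delta> K where d: "\<delta> > 0" "\<And>t::nat. t \<ge> K \<Longrightarrow> \<delta> \<le> poly Q (of_nat t)" using poly_eventually_pos by blast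
    define t where "t = max (max N M) K"
    have "poly Q (of_nat t) = of_nat (h t) - of_nat (C * growth (degree P) t)"
      using h[of t] by (simp add: Q_def pg t_def)
    also have "\<dots> \<le> 0" using C[of t] by (simp add: t_def flip: of_nat_mult)
    finally show False using d(2)[of t] d(1) by (simp add: t_def)
  qed
qed

theorem corollary3p4:
  fixes sm :: "('n::{finite,linorder}, 'k::field) mpoly \<Rightarrow> 'm::ab_group_add \<Rightarrow> 'm"
    and G :: "int \<Rightarrow> 'm set"
    and n d i :: nat and r :: int
  assumes "n = CARD('n)" and "n \<ge> 2"
    and "graded_module sm G" and "finitely_generated sm"
    and "\<exists>x::'m. x \<noteq> 0"
    and "krull_dim sm = enat d"
    and "regularity sm G = indeg G" and "indeg G = ereal (real_of_int r)"
    and "\<forall>t. local_cohomology_vanishes sm G 0 t"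
  shows "of_nat (tor_dim sm i) =
    (\<Sum>l = 0..min i (d - 1). (-1) ^ l * of_nat ((n - l - 1) choose (i - l)) *
       poly ((backward_diff ^^ l) (hilbert_poly sm G)) (of_int (r + int l)))"
proof -
  interpret graded sm G by unfold_locales fact
  note fg = assms(4)
  have mod: "module sm" by unfold_locales
  \<comment> \<open>A supremum of \<open>r\<close> over all nonzero pieces of local cohomology
    bounds each of them; the infimum in \<open>indeg\<close> is read in the same way below.\<close>
  have van: "local_cohomology_vanishes sm G p t" if "r < int p + t" for p t
  proof (rule ccontr)
    assume "\<not> local_cohomology_vanishes sm G p t"
    then have "ereal (real_of_int (int p + t)) \<le> regularity sm G"
      unfolding regularity_def by (intro SUP_upper2[of "(p, t)"]) auto
    also have "\<dots> = ereal (real_of_int r)" using assms(7,8) by simp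
    finally have "int p + t \<le> r" by (simp only: ereal_less_eq of_int_le_iff)
    then show False using that by simp
  qed
  have low: "G t = {0}" if "t < r" for t
  proof (rule ccontr)
    assume "G t \<noteq> {0}"
    then have "indeg G \<le> ereal (real_of_int t)" unfolding indeg_def by (intro INF_lower) simp
    then show False using assms(8) that by simp
  qed
  define H where "H q = (of_nat (hilbert_function sm G (r + int q)) :: rat)" for q
  define b where "b i = (of_nat (tor_dim sm i) :: rat)" for i
  have "b i = (\<Sum>q\<le>i. (-1) ^ q * of_nat (n choose (i - q)) * H q) \<and> (i \<ge> n \<longrightarrow> b i = 0)" for i
  proof -
    obtain c where c: "qdim (fscale (kscale sm)) (kcycles sm var (G r) i) {0} c"
      "int c = (\<Sum>q\<le>i. (-1) ^ q * int (CARD('n) choose (i - q)) * int (hilbert_function sm G (r + int q)))"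
      using qdim_kcycles[where i = i and r = r and j = r, OF fg van order_refl] by blast
    have t: "tor_dim sm i = c" by (rule tor_dim_eq_koszul[OF mod fg qdim_koszul_homology[OF van low c(1)]])
    have "b i = of_int (int c)" by (simp add: b_def t)
    also have "\<dots> = (\<Sum>q\<le>i. (-1) ^ q * of_nat (n choose (i - q)) * H q)"
      unfolding c(2) by (simp add: H_def assms(1))
    finally have "b i = (\<Sum>q\<le>i. (-1) ^ q * of_nat (n choose (i - q)) * H q)" .
    moreover have "c = 0" if "i \<ge> n"
    proof -
      have "kcycles sm var (G r) i = {0}" using kcycles_top[of r i] assms(1,9) that by blast
      then show ?thesis using fk.qdim_unique[OF fk.subspace_single_0 _ fk.qdim_self[OF fk.subspace_single_0]] c(1) by metis
    qed
    ultimately show ?thesis by (simp add: b_def t)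
  qed
  then have b: "\<And>i. b i = (\<Sum>q\<le>i. (-1) ^ q * of_nat (n choose (i - q)) * H q)" "\<And>i. i \<ge> n \<Longrightarrow> b i = 0" by blast+
  \<comment> \<open>The Newton interpolant agrees with the Hilbert function from \<open>r\<close>
    on, which identifies it with the Hilbert polynomial.\<close>
  obtain P where P: "\<And>q. poly P (of_int (r + int q)) = (\<Sum>l<n. of_nat (q choose l) * (fd ^^ l) H 0)"
    using newton_polynomial_exists[where r = r and n = n and c = "\<lambda>l. (fd ^^ l) H 0"] by blast
  have PH: "poly P (of_int (r + int q)) = H q" for q
    unfolding P by (rule betti_numeric(1)[OF b, symmetric])
  have Pt: "poly P (of_int t) = of_nat (hilbert_function sm G t)" if "t \<ge> r" for t
    using PH[of "nat (t - r)"] that by (simp add: H_def)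
  have hp: "hilbert_poly sm G = P" by (rule hilbert_poly_eq[OF Pt])
  have deg: "degree P < d" if "P \<noteq> 0"
  proof -
    \<comment> \<open>Natural numbers from \<open>nat \<bar>r\<bar>\<close> on are integers at least
      \<open>r\<close>, where \<open>P\<close> gives the Hilbert function.\<close>
    have "\<not> bounded_growth (degree P) (\<lambda>t. hilbert_function sm G (int t))"
      using Pt by (intro poly_not_bounded_growth[OF that, of "nat \<bar>r\<bar>"]) (metis abs_le_D1 nat_le_iff of_int_of_nat_eq)
    moreover obtain J where J: "finite J" "\<forall>(a, g)\<in>J. g \<in> G a"
      "\<forall>t. \<forall>x\<in>G t. \<exists>f. (\<forall>(a, g)\<in>J. homogeneous (nat (t - a)) (f (a, g)) \<and> (t < a \<longrightarrow> f (a, g) = 0))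
         \<and> x = (\<Sum>(a, g)\<in>J. sm (f (a, g)) g)"
      using homogeneous_generators[OF fg] by blast
    ultimately obtain a g where ag: "(a, g) \<in> J" "\<not> bounded_growth (degree P) (hfun (ann g))"
      using bounded_growth_hilbert_function[OF fg J] by blast
    then have "hom_ideal (ann g)" using J(2) by (intro hom_ideal_ann) auto
    \<comment> \<open>A chain of \<open>degree P + 1\<close> strict inclusions of primes above
      \<open>ann g\<close> also lies above the annihilator of the whole module, so
      \<open>degree P + 1 \<le> d\<close>.\<close>
    then obtain Q where Q: "\<forall>j\<le>Suc (degree P). prime_ideal (Q j) \<and> ann g \<subseteq> Q j" "\<forall>j<Suc (degree P). Q j \<subset> Q (Suc j)"
      using growth_prime_chain[OF _ ag(2)] by blast
    have "annihilator sm \<subseteq> ann g" by (auto simp: annihilator_def ann_def)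
    then have "\<forall>j\<le>Suc (degree P). prime_ideal (Q j) \<and> annihilator sm \<subseteq> Q j" using Q(1) by blast
    then have "enat (Suc (degree P)) \<le> krull_dim sm"
      unfolding krull_dim_def using Q(2) by (intro SUP_upper) blast
    then show ?thesis using assms(6) by simp
  qed
  have coeff: "poly ((backward_diff ^^ l) P) (of_int (r + int l)) = (fd ^^ l) H 0" for l
    using backward_diff_power_eq[OF PH, of l 0] by simp
  \<comment> \<open>For \<open>d = 0\<close> the truncated difference \<open>d - 1\<close> is 0, but
    then \<open>deg\<close> forces \<open>P = 0\<close>, so the claim holds for all
    \<open>l > d - 1\<close> in this case too.\<close>
  have zero: "(fd ^^ l) H 0 = 0" if "l > d - 1" for l
  proof -
    have "P = 0 \<or> degree P < l" using deg that by linarith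
    then show ?thesis using coeff[of l] backward_diff_power_zero[of P l] by simp
  qed
  have "b i = (\<Sum>l = 0..min i (d - 1). (-1) ^ l * of_nat ((n - l - 1) choose (i - l)) * (fd ^^ l) H 0)"
    by (rule betti_numeric(2)[OF b zero])
  then show ?thesis unfolding hp coeff b_def .
qed

end
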